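(* Let $(V,s)$ be a symplectic space of dimension $2n$ over a field $\mathbb{F}$ with $|\mathbb{F}|>2n-2$. Let $\mathcal{S}$ be an optimal trivial spectrum subspace of $\mathcal{A}_s$. Then there exist an integer $r\in\{0,\dots,n\}$, a mixed symplectic basis $\mathbf{B}$ of $(V,s)$ with index $r$, an optimal trivial spectrum subspace $\mathcal{W}$ of $\mathrm{M}_r(\mathbb{F})$, and an irreducible optimal trivial spectrum subspace $\mathcal{C}$ of $\mathcal{A}_{s_{2n-2r}}$ (identified with $K_{2n-2r}^{-1}\mathrm{A}_{2n-2r}(\mathbb{F})$) such that $\mathcal{S}$ is represented in the basis $\mathbf{B}$ by the matrix space $\mathcal{W}\,\triangle\,\mathcal{C}$. Moreover, the following data are uniquely determined by $\mathcal{S}$: the integer $r$, the conjugacy class of $\mathcal{W}$ under $\mathrm{GL}_r(\mathbb{F})$, and the orbit of $\mathcal{C}$ under conjugation by the symplectic group $\mathrm{Sp}_{2n-2r}(\mathbb{F})$.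
   Context: A symplectic space $(V,s)$ is a finite-dimensional $\mathbb{F}$-vector space $V$ with a non-degenerate alternating bilinear form $s$. $\mathrm{M}_{k,l}(\mathbb{F})$ is the space of $k\times l$ matrices, $\mathrm{A}_k(\mathbb{F})$ the space of alternating $k\times k$ matrices (skew-symmetric with zero diagonal). The characteristic of $\mathbb{F}$ is arbitrary. For a bilinear form $b$ on $V$, $\mathcal{A}_b:=\{u\in\mathrm{End}(V): b(x,u(x))=0\ \forall x\in V\}$. A linear subspace $S$ of $\mathrm{End}(V)$ (or of $\mathrm{M}_r(\mathbb{F})$) has trivial spectrum when $1-u$ is invertible for all $u\in S$ (i.e. no element of $S$ has a nonzero fixed vector). A trivial spectrum linear subspace of $\mathcal{A}_s$ (resp. of $\mathrm{M}_r(\mathbb{F})$) is optimal when it has the greatest possible dimension among all trivial spectrum linear subspaces of $\mathcal{A}_s$ (resp. of $\mathrm{M}_r(\mathbb{F})$). A subset of $\mathrm{End}(V)$ is irreducible when no linear subspace of $V$ other than $\{0\}$ and $V$ is invariant under all its elements (over the zero space, $\{0\}$ is irreducible). $K_{2k}:=\begin{bmatrix}0&I_k\\-I_k&0\end{bmatrix}$ and $s_{2k}$ is the symplectic form on $\mathbb{F}^{2k}$ with Gram matrix $K_{2k}$ in the standard basis; $\mathcal{A}_{s_{2k}}$ is represented in the standard basis by $K_{2k}^{-1}\mathrm{A}_{2k}(\mathbb{F})$. $\mathrm{Sp}_{2k}(\mathbb{F})$ is the isometry group of $s_{2k}$. A mixed symplectic basis of $(V,s)$ with index $r$ is a basis $(e_1,\dots,e_r,g_1,\dots,g_{2n-2r},f_1,\dots,f_r)$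 in which the Gram matrix of $s$ is $$\begin{bmatrix}0&0&I_r\\0&K_{2n-2r}&0\\-I_r&0&0\end{bmatrix}.$$ For linear subspaces $\mathcal{W}\subseteq\mathrm{M}_r(\mathbb{F})$ and $\mathcal{C}\subseteq K_{2n-2r}^{-1}\mathrm{A}_{2n-2r}(\mathbb{F})$, $$\mathcal{W}\,\triangle\,\mathcal{C}:=\left\{\begin{bmatrix}M&(K_{2n-2r}B)^T&D\\0&C&B\\0&0&M^T\end{bmatrix}\;\middle|\;(M,C,B,D)\in\mathcal{W}\times\mathcal{C}\times\mathrm{M}_{2n-2r,r}(\mathbb{F})\times\mathrm{A}_r(\mathbb{F})\right\}.$$ *)

theory Defs
  imports "HOL-Library.Function_Algebras" "Jordan_Normal_Form.VS_Connect"
begin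

text \<open>The abstract space \<open>V\<close> is a type with a scalar multiplication, as in
  \<^locale>\<open>vector_space\<close>. Matrices have dimensions varying inside the statement, so they
  are those of \<^theory>\<open>Jordan_Normal_Form.Matrix\<close>, and their linear subspaces are those of
  the space \<^term>\<open>module_mat TYPE('a::field) m m\<close>.\<close>

section \<open>Matrix spaces\<close>

definition trivial_spectrum_mats :: "nat \<Rightarrow> 'a::field mat set \<Rightarrow> bool" where
  "trivial_spectrum_mats m S \<longleftrightarrow> (\<forall>M\<in>S. invertible_mat (1\<^sub>m m - M))"

definition mat_subspace :: "nat \<Rightarrow> 'a::field mat set \<Rightarrow> bool" where
  "mat_subspace m S \<longleftrightarrow> VectorSpace.subspace class_ring S (module_mat TYPE('a) m m)"

definition mat_subspace_dim :: "nat \<Rightarrow> 'a::field mat set \<Rightarrow> nat" where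
  "mat_subspace_dim m S = vectorspace.dim class_ring ((module_mat TYPE('a) m m)\<lparr>carrier := S\<rparr>)"

definition optimal_trivial_spectrum_mats ::
    "nat \<Rightarrow> 'a::field mat set \<Rightarrow> 'a mat set \<Rightarrow> bool" where
  "optimal_trivial_spectrum_mats m A S \<longleftrightarrow>
     mat_subspace m S \<and> S \<subseteq> A \<and> trivial_spectrum_mats m S \<and>
     (\<forall>T. mat_subspace m T \<and> T \<subseteq> A \<and> trivial_spectrum_mats m T \<longrightarrow>
        mat_subspace_dim m T \<le> mat_subspace_dim m S)"

definition irreducible_mats :: "nat \<Rightarrow> 'a::field mat set \<Rightarrow> bool" where
  "irreducible_mats m S \<longleftrightarrow>
     (\<forall>U. VectorSpace.subspace class_ring U (module_vec TYPE('a) m) \<and>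
          (\<forall>M\<in>S. \<forall>x\<in>U. M *\<^sub>v x \<in> U) \<longrightarrow>
        U = {0\<^sub>v m} \<or> U = carrier_vec m)"

definition alternating_mats :: "nat \<Rightarrow> 'a::field mat set" where
  "alternating_mats k =
     {A \<in> carrier_mat k k. transpose_mat A = - A \<and> (\<forall>i<k. A $$ (i, i) = 0)}"

definition GL :: "nat \<Rightarrow> 'a::field mat set" where
  "GL m = {P \<in> carrier_mat m m. invertible_mat P}"

definition conjugate_under :: "nat \<Rightarrow> 'a::field mat set \<Rightarrow> 'a mat set \<Rightarrow> 'a mat set \<Rightarrow> bool" where
  "conjugate_under m G S S' \<longleftrightarrow>
     (\<exists>P\<in>G. \<exists>Q\<in>carrier_mat m m. P * Q = 1\<^sub>m m \<and> Q * P = 1\<^sub>m m \<and> S' = (\<lambda>M. P * M * Q) ` S)"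

section \<open>The standard symplectic form\<close>

text \<open>Throughout, the parameter \<open>k\<close> is half the dimension: \<open>symp_mat k\<close> is $K_{2k}$,
  \<open>symp_form k\<close> is $s_{2k}$, and so on.\<close>

definition symp_mat :: "nat \<Rightarrow> 'a::field mat" where
  "symp_mat k = four_block_mat (0\<^sub>m k k) (1\<^sub>m k) (- 1\<^sub>m k) (0\<^sub>m k k)"

definition symp_form :: "nat \<Rightarrow> 'a::field vec \<Rightarrow> 'a vec \<Rightarrow> 'a" where
  "symp_form k x y = x \<bullet> (symp_mat k *\<^sub>v y)"

definition symp_alt_mats :: "nat \<Rightarrow> 'a::field mat set" where
  "symp_alt_mats k =
     {M \<in> carrier_mat (2*k) (2*k). \<forall>x\<in>carrier_vec (2*k). symp_form k x (M *\<^sub>v x) = 0}"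

definition Sp :: "nat \<Rightarrow> 'a::field mat set" where
  "Sp k = {P \<in> GL (2*k). \<forall>x\<in>carrier_vec (2*k). \<forall>y\<in>carrier_vec (2*k).
             symp_form k (P *\<^sub>v x) (P *\<^sub>v y) = symp_form k x y}"

lemma symp_mat_carrier [simp]: "symp_mat k \<in> carrier_mat (2*k) (2*k)"
  unfolding symp_mat_def mult_2 by (intro four_block_carrier_mat) auto

lemma symp_mat_inverse:
  "symp_mat k * (- symp_mat k) = (1\<^sub>m (2*k) :: 'a::field mat)"
  "- symp_mat k * symp_mat k = (1\<^sub>m (2*k) :: 'a::field mat)"
proof -
  let ?O = "0\<^sub>m k k :: 'a mat" and ?I = "1\<^sub>m k :: 'a mat"
  have neg: "- symp_mat k = four_block_mat ?O (- ?I) ?I ?O"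
    unfolding symp_mat_def
    by (rule eq_matI) (auto simp: one_mat_def)
  have one: "four_block_mat ?I ?O ?O ?I = 1\<^sub>m (2*k)"
    unfolding mult_2 by (rule eq_matI) auto
  have zero: "- ?O = ?O"
    by (rule eq_matI) auto
  show "symp_mat k * (- symp_mat k) = (1\<^sub>m (2*k) :: 'a mat)"
    unfolding neg unfolding symp_mat_def
    by (subst mult_four_block_mat[where ?nr1.0 = k and ?nr2.0 = k and ?n1.0 = k
          and ?n2.0 = k and ?nc1.0 = k and ?nc2.0 = k])
       (auto simp: one zero)
  show "- symp_mat k * symp_mat k = (1\<^sub>m (2*k) :: 'a mat)"
    unfolding neg unfolding symp_mat_def
    by (subst mult_four_block_mat[where ?nr1.0 = k and ?nr2.0 = k and ?n1.0 = k
          and ?n2.0 = k and ?nc1.0 = k and ?nc2.0 = k])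
       (auto simp: one zero)
qed

lemma alternating_mats_iff:
  fixes A :: "'a::field mat"
  assumes A: "A \<in> carrier_mat m m"
  shows "A \<in> alternating_mats m \<longleftrightarrow> (\<forall>x\<in>carrier_vec m. x \<bullet> (A *\<^sub>v x) = 0)"
proof
  assume alt: "A \<in> alternating_mats m"
  have diag: "A $$ (i, i) = 0" if "i < m" for i
    using alt that by (auto simp: alternating_mats_def)
  have skew: "A $$ (j, i) = - A $$ (i, j)" if "i < m" "j < m" for i j
  proof -
    have "transpose_mat A $$ (i, j) = (- A) $$ (i, j)"
      using alt by (auto simp: alternating_mats_def)
    thus ?thesis using that A by simp
  qed
  show "\<forall>x\<in>carrier_vec m. x \<bullet> (A *\<^sub>v x) = 0"
  proof
    fix x :: "'a vec" assume x: "x \<in> carrier_vec m"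
    let ?t = "\<lambda>i j. x $ i * (A $$ (i, j) * x $ j)"
    have upto: "(\<Sum>i<l. \<Sum>j<l. ?t i j) = 0" if "l \<le> m" for l
      using that
    proof (induction l)
      case (Suc l)
      have "(\<Sum>i<Suc l. \<Sum>j<Suc l. ?t i j)
          = (\<Sum>i<l. \<Sum>j<l. ?t i j) + ((\<Sum>i<l. ?t i l + ?t l i) + ?t l l)"
        by (simp add: sum.distrib algebra_simps)
      also have "(\<Sum>i<l. ?t i l + ?t l i) = 0"
        by (rule sum.neutral) (use Suc.prems in \<open>auto simp: skew[of _ l]\<close>)
      finally show ?case using Suc diag[of l] by simp
    qed simp
    have "x \<bullet> (A *\<^sub>v x) = (\<Sum>i<m. \<Sum>j<m. ?t i j)"
      using A x
      by (auto simp: scalar_prod_def sum_distrib_left atLeast0LessThan intro!: sum.cong)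
    thus "x \<bullet> (A *\<^sub>v x) = 0" using upto[of m] by simp
  qed
next
  assume null: "\<forall>x\<in>carrier_vec m. x \<bullet> (A *\<^sub>v x) = 0"
  have unit: "unit_vec m i \<bullet> (A *\<^sub>v unit_vec m j) = A $$ (i, j)" if "i < m" "j < m" for i j
    using that A by (simp add: scalar_prod_left_unit[of _ m])
  have diag: "A $$ (i, i) = 0" if "i < m" for i
    using null unit[OF that that] by auto
  have skew: "A $$ (j, i) = - A $$ (i, j)" if ij: "i < m" "j < m" for i j
  proof -
    let ?e = "unit_vec m i :: 'a vec" and ?f = "unit_vec m j :: 'a vec"
    have c: "A *\<^sub>v ?e \<in> carrier_vec m" "A *\<^sub>v ?f \<in> carrier_vec m"
      using A by auto
    have "0 = (?e + ?f) \<bullet> (A *\<^sub>v (?e + ?f))" using null by simp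
    also have "\<dots> = ?e \<bullet> (A *\<^sub>v ?e) + ?e \<bullet> (A *\<^sub>v ?f) + (?f \<bullet> (A *\<^sub>v ?e) + ?f \<bullet> (A *\<^sub>v ?f))"
      using c by (simp add: mult_add_distrib_mat_vec[OF A] add_scalar_prod_distrib[of _ m]
                   scalar_prod_add_distrib[of _ m])
    also have "\<dots> = A $$ (i, j) + A $$ (j, i)"
      using ij by (simp only: unit diag) simp
    finally show ?thesis by (metis eq_neg_iff_add_eq_0 add.commute)
  qed
  show "A \<in> alternating_mats m"
  proof -
    have "transpose_mat A = - A"
    proof (rule eq_matI)
      fix i j assume "i < dim_row (- A)" "j < dim_col (- A)"
      hence ij: "i < m" "j < m" using A by auto
      thus "transpose_mat A $$ (i, j) = (- A) $$ (i, j)" using A skew[OF ij] by simp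
    qed (use A in auto)
    thus ?thesis using A diag by (simp add: alternating_mats_def)
  qed
qed

text \<open>The identification of the alternating endomorphisms with $K_{2k}^{-1}\mathrm{A}_{2k}$, where
  $K_{2k}^{-1} = -K_{2k}$.\<close>

lemma symp_alt_mats_eq:
  "symp_alt_mats k = (\<lambda>A. - symp_mat k * A) ` alternating_mats (2*k)"
proof -
  let ?K = "symp_mat k :: 'a mat"
  have iff: "M \<in> symp_alt_mats k \<longleftrightarrow> ?K * M \<in> alternating_mats (2*k)"
    if M: "M \<in> carrier_mat (2*k) (2*k)" for M
    using M by (simp add: symp_alt_mats_def symp_form_def
      alternating_mats_iff[OF mult_carrier_mat[OF symp_mat_carrier M]]
      assoc_mult_mat_vec[OF symp_mat_carrier M])
  have inv: "- ?K * (?K * M) = M" "?K * (- ?K * M) = M" if M: "M \<in> carrier_mat (2*k) (2*k)" for M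
    using M by (simp_all add: assoc_mult_mat[of _ "2*k" "2*k" _ "2*k" _ "2*k", symmetric]
      symp_mat_inverse)
  show ?thesis
  proof (intro equalityI subsetI)
    fix M :: "'a mat" assume "M \<in> symp_alt_mats k"
    moreover from this have "M \<in> carrier_mat (2*k) (2*k)" by (simp add: symp_alt_mats_def)
    ultimately show "M \<in> (\<lambda>A. - ?K * A) ` alternating_mats (2*k)"
      by (intro image_eqI[of _ _ "?K * M"]) (simp_all add: inv iff)
  next
    fix M assume "M \<in> (\<lambda>A. - ?K * A) ` alternating_mats (2*k)"
    then obtain A where M: "M = - ?K * A" and A: "A \<in> alternating_mats (2*k)" by auto
    have c: "A \<in> carrier_mat (2*k) (2*k)" using A by (simp add: alternating_mats_def)
    hence "M \<in> carrier_mat (2*k) (2*k)"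
      unfolding M by (intro mult_carrier_mat[of _ _ "2*k"]) auto
    thus "M \<in> symp_alt_mats k" using A by (simp add: iff) (simp add: M inv c)
  qed
qed

section \<open>Three-by-three block matrices\<close>

definition append_cols :: "'a::zero mat \<Rightarrow> 'a mat \<Rightarrow> 'a mat" (infixr \<open>@\<^sub>c\<close> 66) where
  "A @\<^sub>c B = four_block_mat A B (0\<^sub>m 0 (dim_col A)) (0\<^sub>m 0 (dim_col B))"

definition mixed_gram :: "nat \<Rightarrow> nat \<Rightarrow> 'a::field mat" where
  "mixed_gram r k =
     (0\<^sub>m r r       @\<^sub>c 0\<^sub>m r (2*k)   @\<^sub>c 1\<^sub>m r) @\<^sub>r
     (0\<^sub>m (2*k) r   @\<^sub>c symp_mat k   @\<^sub>c 0\<^sub>m (2*k) r) @\<^sub>r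
     (- 1\<^sub>m r       @\<^sub>c 0\<^sub>m r (2*k)   @\<^sub>c 0\<^sub>m r r)"

definition triangle :: "nat \<Rightarrow> nat \<Rightarrow> 'a::field mat set \<Rightarrow> 'a mat set \<Rightarrow> 'a mat set" where
  "triangle r k W C =
     {(M           @\<^sub>c transpose_mat (symp_mat k * B) @\<^sub>c D) @\<^sub>r
      (0\<^sub>m (2*k) r  @\<^sub>c N                             @\<^sub>c B) @\<^sub>r
      (0\<^sub>m r r      @\<^sub>c 0\<^sub>m r (2*k)                    @\<^sub>c transpose_mat M)
      | M N B D. M \<in> W \<and> N \<in> C \<and> B \<in> carrier_mat (2*k) r \<and> D \<in> alternating_mats r}"

section \<open>Symplectic spaces\<close>

locale symplectic_space = vector_space scale
  for scale :: "'a::field \<Rightarrow> 'b::ab_group_add \<Rightarrow> 'b" +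
  fixes s :: "'b \<Rightarrow> 'b \<Rightarrow> 'a"
  assumes finite_dimensional: "\<exists>B. finite B \<and> span B = UNIV"
    and linear_left: "Vector_Spaces.linear scale (*) (\<lambda>x. s x y)"
    and linear_right: "Vector_Spaces.linear scale (*) (s x)"
    and alternating: "s x x = 0"
    and nondegenerate: "(\<And>y. s x y = 0) \<Longrightarrow> x = 0"
begin

text \<open>Functions \<^typ>\<open>'b \<Rightarrow> 'b\<close> with pointwise operations; \<open>End(V)\<close> is the subspace of the
  linear ones.\<close>

sublocale Fun: vector_space "\<lambda>c (u :: 'b \<Rightarrow> 'b) x. scale c (u x)"
  by unfold_locales (auto simp: fun_eq_iff scale_right_distrib scale_left_distrib)

definition alt_endos :: "('b \<Rightarrow> 'b) set" where
  "alt_endos = {u. Vector_Spaces.linear scale scale u \<and> (\<forall>x. s x (u x) = 0)}"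

definition trivial_spectrum :: "('b \<Rightarrow> 'b) set \<Rightarrow> bool" where
  "trivial_spectrum S \<longleftrightarrow> (\<forall>u\<in>S. bij (\<lambda>x. x - u x))"

definition optimal_trivial_spectrum :: "('b \<Rightarrow> 'b) set \<Rightarrow> bool" where
  "optimal_trivial_spectrum S \<longleftrightarrow>
     Fun.subspace S \<and> S \<subseteq> alt_endos \<and> trivial_spectrum S \<and>
     (\<forall>T. Fun.subspace T \<and> T \<subseteq> alt_endos \<and> trivial_spectrum T \<longrightarrow> Fun.dim T \<le> Fun.dim S)"

definition gram_mat :: "'b list \<Rightarrow> 'a mat" where
  "gram_mat bs = mat (length bs) (length bs) (\<lambda>(i, j). s (bs ! i) (bs ! j))"

definition ordered_basis :: "'b list \<Rightarrow> bool" where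
  "ordered_basis bs \<longleftrightarrow> distinct bs \<and> independent (set bs) \<and> span (set bs) = UNIV"

text \<open>The list is $(e_1,\dots,e_r,g_1,\dots,g_{2k},f_1,\dots,f_r)$, where $2k + 2r$ is the
  dimension of the space.\<close>

definition mixed_symplectic_basis :: "nat \<Rightarrow> nat \<Rightarrow> 'b list \<Rightarrow> bool" where
  "mixed_symplectic_basis r k bs \<longleftrightarrow> ordered_basis bs \<and> gram_mat bs = mixed_gram r k"

definition mat_in_basis :: "'b list \<Rightarrow> ('b \<Rightarrow> 'b) \<Rightarrow> 'a mat" where
  "mat_in_basis bs u =
     mat (length bs) (length bs) (\<lambda>(i, j). representation (set bs) (u (bs ! j)) (bs ! i))"

definition optimal_decomposition ::
    "nat \<Rightarrow> ('b \<Rightarrow> 'b) set \<Rightarrow> nat \<Rightarrow> 'b list \<Rightarrow> 'a mat set \<Rightarrow> 'a mat set \<Rightarrow> bool" where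
  "optimal_decomposition n S r bs W C \<longleftrightarrow>
     r \<le> n \<and>
     mixed_symplectic_basis r (n - r) bs \<and>
     optimal_trivial_spectrum_mats r (carrier_mat r r) W \<and>
     optimal_trivial_spectrum_mats (2 * (n - r)) (symp_alt_mats (n - r)) C \<and>
     irreducible_mats (2 * (n - r)) C \<and>
     mat_in_basis bs ` S = triangle r (n - r) W C"

end

end

theory Submission
  imports Defs
begin

text \<open>Every alternating endomorphism \<open>u\<close> is self-adjoint for \<open>s\<close>. So if \<open>u\<close> preserves an isotropic
  subspace \<open>E\<close> then it preserves \<open>perp E\<close>, and \<open>1 - u\<close> is invertible iff it is injective on \<open>E\<close> and on
  \<open>perp E / E\<close>. Optimality therefore forces \<open>S\<close> to contain every alternating endomorphism that acts on
  \<open>E\<close> and on \<open>perp E / E\<close> like elements of \<open>S\<close>. If \<open>E\<close> is maximal among the isotropic subspaces that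
  are stable under \<open>S\<close>, then \<open>S\<close> acts irreducibly on \<open>perp E / E\<close>: from a proper stable intermediate
  subspace one could enlarge \<open>S\<close> by modifying it with endomorphisms
  \<open>z \<mapsto> s(x,z) y - s(y,z) x\<close>. In a mixed basis adapted to \<open>E\<close> this is the required decomposition.

  Conversely every decomposition arises from such an \<open>E\<close>. If \<open>E \<noteq> E'\<close> are two of them, then both are
  Lagrangian and \<open>E \<inter> E'\<close> is a hyperplane in each; a transvection that normalises \<open>S\<close> carries \<open>E\<close> to
  \<open>E'\<close>, and conjugating by it yields the base changes between the blocks.\<close>

section \<open>Finite-dimensional subspaces\<close>

text \<open>Modifying \<open>S\<close> by wedges pays only when the intermediate space
  \<open>U\<close> is small: \<open>perp U / E\<close> measures the gain and \<open>U / E\<close>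
  the loss. A large \<open>U\<close> is treated through \<open>perp U\<close>, and maximality of
  \<open>E\<close> serves to make the form nondegenerate on \<open>U / E\<close>. Uniqueness has to
  work without maximality, since a matrix decomposition only gives back an irreducible action on
  \<open>perp E / E\<close>. Two such spaces that are orthogonal to each other coincide. Otherwise
  choose \<open>x\<close> in \<open>E\<close> and \<open>z\<close> in \<open>E'\<close> with
  \<open>s x z = 1\<close>. By optimality every \<open>wedge x y\<close> with \<open>y\<close> in
  \<open>perp E\<close> belongs to \<open>S\<close>, and applying it to \<open>z\<close> shows that
  \<open>perp E\<close> is \<open>E \<inter> E'\<close> plus the line of \<open>x\<close>; this is
  why both spaces are Lagrangian. Modulo \<open>E \<inter> E'\<close>, the orthogonal of
  \<open>E \<inter> E'\<close> is then a plane, where alternating endomorphisms are scalars, and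
  trivial spectrum leaves only the scalar 0. So \<open>S\<close> maps
  \<open>perp (E \<inter> E')\<close> into \<open>E \<inter> E'\<close>, and conjugation by a
  transvection that fixes \<open>E \<inter> E'\<close> pointwise changes nothing in the two diagonal
  actions that determine membership in \<open>S\<close>.\<close>

context vector_space
begin

text \<open>Finiteness is attached to subsets because \<open>Fun\<close> is the space of all
  functions, which need not be finite-dimensional; only its linear part is shown to be.\<close>

definition fin_dim :: "'b set \<Rightarrow> bool" where
  "fin_dim W \<longleftrightarrow> (\<exists>X. finite X \<and> W \<subseteq> span X)"

lemma fin_dim_mono: "local.fin_dim W \<Longrightarrow> V \<subseteq> W \<Longrightarrow> local.fin_dim V"
  unfolding fin_dim_def by blast

lemma fin_dim_independent:
  assumes "local.fin_dim W" "B \<subseteq> W" "independent B"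
  shows "finite B" "card B \<le> dim W"
proof -
  obtain X where X: "finite X" "W \<subseteq> span X" using assms(1) unfolding fin_dim_def by auto
  obtain C where C: "C \<subseteq> W" "independent C" "W \<subseteq> span C" "card C = dim W"
    by (rule basis_exists)
  have "finite C" using independent_span_bound[OF X(1) C(2)] C(1) X(2) by auto
  from independent_span_bound[OF this assms(3)] assms(2) C
  show "finite B" "card B \<le> dim W" by auto
qed

lemma dim_mono_fin_dim:
  assumes "local.fin_dim W" "V \<subseteq> W"
  shows "dim V \<le> dim W"
proof -
  obtain C where C: "C \<subseteq> V" "independent C" "V \<subseteq> span C" "card C = dim V"
    by (rule basis_exists)
  show ?thesis using fin_dim_independent(2)[OF assms(1) _ C(2)] C assms(2) by auto
qed

lemma subspace_eq_if_dim_le: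
  assumes "local.fin_dim W" "V \<subseteq> W" "subspace V" "dim W \<le> dim V"
  shows "V = W"
proof
  obtain C where C: "C \<subseteq> V" "independent C" "V \<subseteq> span C" "card C = dim V"
    by (rule basis_exists)
  have fC: "finite C" using fin_dim_independent(1)[OF assms(1) _ C(2)] C(1) assms(2) by auto
  show "W \<subseteq> V"
  proof
    fix w assume w: "w \<in> W"
    have "w \<in> span C"
    proof (rule ccontr)
      assume n: "w \<notin> span C"
      have "independent (insert w C)" using independent_insertI[OF n C(2)] .
      from fin_dim_independent(2)[OF assms(1) _ this] w C(1) assms(2)
      have "card (insert w C) \<le> dim W" by auto
      moreover have "w \<notin> C" using n span_base by auto
      ultimately show False using fC C(4) assms(4) by simp
    qed
    thus "w \<in> V" using span_minimal[OF C(1) assms(3)] by auto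
  qed
qed (rule assms(2))

lemma dim_less_fin_dim:
  assumes "local.fin_dim W" "V \<subseteq> W" "subspace V" "x \<in> W" "x \<notin> V"
  shows "dim V < dim W"
  using subspace_eq_if_dim_le[OF assms(1-3)] assms(4,5) by force

lemma dim_zero_set: "dim {0} = 0"
  using dim_le_card[of "{0}" "{}"] by simp

lemma span_Int_independent:
  assumes "independent C" "A \<subseteq> C" "B \<subseteq> C" "A \<inter> B = {}" "x \<in> span A" "x \<in> span B"
  shows "x = 0"
proof -
  have "representation C x = representation A x" "representation C x = representation B x"
    using representation_extend[OF assms(1) assms(5,2)]
      representation_extend[OF assms(1) assms(6,3)] by simp_all
  hence z: "representation A x b = 0" for b
    using representation_ne_zero[of A x b] representation_ne_zero[of B x b] assms(4) by auto
  have "independent A" using assms independent_mono by blast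
  from sum_nonzero_representation_eq[OF this assms(5)] show ?thesis by (simp add: z)
qed

text \<open>The quotient by \<open>B\<close> is realised inside the space itself, as the projection
  along a complement of \<open>B\<close>, so that dimensions of quotients become dimensions of
  ordinary images.\<close>

lemma quotient_map_exists:
  assumes "subspace B"
  shows "\<exists>q. Vector_Spaces.linear scale scale q \<and> (\<forall>x. q x = 0 \<longleftrightarrow> x \<in> B)"
proof -
  interpret p: vector_space_pair scale scale ..
  obtain A where A: "A \<subseteq> B" "independent A" "B \<subseteq> span A" using maximal_independent_subset by blast
  have BA: "B = span A" using A span_minimal[OF A(1) assms] by auto
  obtain C where C: "A \<subseteq> C" "independent C" "UNIV \<subseteq> span C"
    using maximal_independent_subset_extend[OF _ A(2), of UNIV] by auto
  define q where "q = p.construct C (\<lambda>b. if b \<in> A then 0 else b)"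
  have l: "Vector_Spaces.linear scale scale q"
    unfolding q_def by (rule p.linear_construct[OF C(2)])
  interpret q: Vector_Spaces.linear scale scale q by (rule l)
  have q0: "q y = 0" if "y \<in> span A" for y
    by (rule q.eq_0_on_span[OF _ that]) (use C in \<open>auto simp: q_def p.construct_basis subset_iff\<close>)
  have qid: "q z = z" if "z \<in> span (C - A)" for z
    by (rule p.linear_eq_on_span[OF l linear_id _ that, unfolded id_def, simplified])
       (use C in \<open>auto simp: q_def p.construct_basis subset_iff\<close>)
  have "q x = 0 \<longleftrightarrow> x \<in> B" for x
  proof -
    have "x \<in> span (A \<union> (C - A))" using C by (auto simp: Un_absorb1 Diff_partition)
    then obtain y z where x: "x = y + z" "y \<in> span A" "z \<in> span (C - A)"
      unfolding span_Un by auto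
    have qx: "q x = z" using x q0 qid by (simp add: q.add)
    show ?thesis
    proof
      assume "q x = 0" thus "x \<in> B" using qx x BA by simp
    next
      assume "x \<in> B"
      hence "z \<in> span A" using x BA span_diff[of x A y] by (auto simp: algebra_simps)
      thus "q x = 0" using span_Int_independent[OF C(2,1), of "C - A" z] x qx by auto
    qed
  qed
  thus ?thesis using l by blast
qed

end

text \<open>A basis of the kernel inside \<open>S\<close> is extended to a basis of
  \<open>S\<close>, and \<open>f\<close> maps the added vectors \<open>D\<close> injectively onto a
  basis of the image.\<close>

lemma (in vector_space_pair) rank_nullity:
  assumes f: "Vector_Spaces.linear s1 s2 f" and S: "vs1.subspace S" "vs1.fin_dim S"
  shows "vs1.dim S = vs1.dim {x \<in> S. f x = 0} + vs2.dim (f ` S)"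
proof -
  interpret f: Vector_Spaces.linear s1 s2 f by (rule f)
  let ?K = "{x \<in> S. f x = 0}"
  obtain B where B: "B \<subseteq> ?K" "vs1.independent B" "?K \<subseteq> vs1.span B" "card B = vs1.dim ?K"
    by (rule vs1.basis_exists)
  obtain C where C: "B \<subseteq> C" "C \<subseteq> S" "vs1.independent C" "S \<subseteq> vs1.span C"
    using vs1.maximal_independent_subset_extend[of B S] B by auto
  have fC: "finite C" using vs1.fin_dim_independent(1)[OF S(2) C(2,3)] .
  define D where "D = C - B"
  have D: "vs1.independent D" using C(3) vs1.independent_mono unfolding D_def by blast
  have inj: "inj_on f (vs1.span D)"
  proof (subst f.inj_on_iff_eq_0[OF vs1.subspace_span], intro ballI impI)
    fix x assume x: "x \<in> vs1.span D" "f x = 0"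
    have "x \<in> S" using x(1) vs1.span_minimal[OF _ S(1)] C(2) unfolding D_def by blast
    hence "x \<in> vs1.span B" using x(2) B(3) by auto
    thus "x = 0" using vs1.span_Int_independent[OF C(3,1), of D] x(1) D_def by auto
  qed
  have ind: "vs2.independent (f ` D)"
    using linear_independent_injective_image[OF f D inj] .
  have sp: "f ` S \<subseteq> vs2.span (f ` D)"
  proof
    fix y assume "y \<in> f ` S"
    then obtain x where x: "x \<in> S" "y = f x" by auto
    have "x \<in> vs1.span (B \<union> D)" using x(1) C(1,4) unfolding D_def
      by (auto simp: Un_absorb1 Diff_partition)
    then obtain u v where uv: "x = u + v" "u \<in> vs1.span B" "v \<in> vs1.span D"
      unfolding vs1.span_Un by auto
    have "f u = 0" by (rule f.eq_0_on_span[OF _ uv(2)]) (use B(1) in auto)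
    hence "y = f v" using x uv by (simp add: f.add)
    thus "y \<in> vs2.span (f ` D)" using uv(3) f.span_image by auto
  qed
  have "vs2.dim (f ` S) = card (f ` D)"
    by (rule vs2.dim_unique[OF _ sp ind]) (use C(2) D_def in auto)
  also have "\<dots> = card D"
    using inj vs1.span_superset by (intro card_image) (blast intro: inj_on_subset)
  finally have "vs2.dim (f ` S) = card D" .
  moreover have "vs1.dim S = card C" using C by (metis vs1.basis_card_eq_dim)
  moreover have "card C = card B + card D"
    unfolding D_def using fC C(1) by (simp add: card_Diff_subset card_mono finite_subset)
  ultimately show ?thesis using B(4) by simp
qed

section \<open>Spaces of matrices and vectors\<close>

lemma mat_subspace_iff:
  "mat_subspace m S \<longleftrightarrow> S \<subseteq> carrier_mat m m \<and> 0\<^sub>m m m \<in> S \<and>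
     (\<forall>A\<in>S. \<forall>B\<in>S. A + B \<in> S) \<and> (\<forall>c. \<forall>A\<in>S. c \<cdot>\<^sub>m (A :: 'a::field mat) \<in> S)"
proof -
  have v: "vectorspace (class_ring :: 'a ring) (module_mat TYPE('a) m m)" by (rule matrix_vs)
  hence "module (class_ring :: 'a ring) (module_mat TYPE('a) m m)" unfolding vectorspace_def by simp
  thus ?thesis using v
    unfolding mat_subspace_def VectorSpace.subspace_def submodule_def
    by (auto simp: matrix_vs_simps)
qed

lemma vec_subspace_iff:
  "VectorSpace.subspace class_ring U (module_vec TYPE('a::field) m) \<longleftrightarrow>
     U \<subseteq> carrier_vec m \<and> 0\<^sub>v m \<in> U \<and> (\<forall>x\<in>U. \<forall>y\<in>U. x + y \<in> U) \<and> (\<forall>c. \<forall>x\<in>U. c \<cdot>\<^sub>v x \<in> U)"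
proof -
  have v: "vectorspace (class_ring :: 'a ring) (module_vec TYPE('a) m)" by (rule vec_vs)
  hence "module (class_ring :: 'a ring) (module_vec TYPE('a) m)" unfolding vectorspace_def by simp
  thus ?thesis using v
    unfolding VectorSpace.subspace_def submodule_def
    by (auto simp: module_vec_simps class_ring_simps)
qed

text \<open>Matrix spaces get their dimension from a carrier-based structure, endomorphisms from the
  locale \<open>vector_space\<close> on a whole type. An injective linear \<open>\<phi>\<close>
  bridges the two, since it transports linear combinations and hence bases.\<close>

lemma (in vector_space) mat_subspace_dim_eq:
  fixes \<phi> :: "'a mat \<Rightarrow> 'b"
  assumes S: "mat_subspace m S"
    and add: "\<And>A B. A \<in> carrier_mat m m \<Longrightarrow> B \<in> carrier_mat m m \<Longrightarrow> \<phi> (A + B) = \<phi> A + \<phi> B"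
    and smult: "\<And>c A. A \<in> carrier_mat m m \<Longrightarrow> \<phi> (c \<cdot>\<^sub>m A) = scale c (\<phi> A)"
    and inj: "inj_on \<phi> (carrier_mat m m)"
    and fd: "local.fin_dim (\<phi> ` S)"
  shows "mat_subspace_dim m S = dim (\<phi> ` S)"
proof -
  let ?M = "module_mat TYPE('a) m m"
  interpret M: vectorspace "class_ring :: 'a ring" ?M by (rule matrix_vs)
  have sub: "VectorSpace.subspace class_ring S ?M" using S unfolding mat_subspace_def .
  interpret W: vectorspace "class_ring :: 'a ring" "?M\<lparr>carrier := S\<rparr>"
    by (rule M.subspace_is_vs[OF sub])
  have SS: "S \<subseteq> carrier_mat m m" "0\<^sub>m m m \<in> S" "\<And>A B. A \<in> S \<Longrightarrow> B \<in> S \<Longrightarrow> A + B \<in> S"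
    "\<And>c A. A \<in> S \<Longrightarrow> c \<cdot>\<^sub>m A \<in> S"
    using S unfolding mat_subspace_iff by auto
  have injS: "inj_on \<phi> S" using inj SS(1) inj_on_subset by blast
  have \<phi>0: "\<phi> (0\<^sub>m m m) = 0"
    using add[of "0\<^sub>m m m" "0\<^sub>m m m"] by simp
  have lc: "W.lincomb a A \<in> S \<and> \<phi> (W.lincomb a A) = (\<Sum>v\<in>A. scale (a v) (\<phi> v))"
    if "finite A" "A \<subseteq> S" for a A
    using that
  proof (induction A rule: finite_induct)
    case empty
    show ?case by (simp add: W.lincomb_def \<phi>0 matrix_vs_simps SS)
  next
    case (insert x A)
    have "W.lincomb a (insert x A) = a x \<cdot>\<^sub>m x + W.lincomb a A"
      unfolding W.lincomb_def using insert SS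
      by (subst W.finsum_insert) (auto simp: matrix_vs_simps)
    thus ?case using insert SS
      by (auto simp: add[OF subsetD[OF SS(1)] subsetD[OF SS(1)]] smult[OF subsetD[OF SS(1)]])
  qed
  obtain B where B: "B \<subseteq> \<phi> ` S" "independent B" "\<phi> ` S \<subseteq> span B" "card B = dim (\<phi> ` S)"
    by (rule basis_exists)
  have fB: "finite B" using fin_dim_independent(1)[OF fd B(1,2)] .
  define A where "A = {x \<in> S. \<phi> x \<in> B}"
  have AB: "\<phi> ` A = B" unfolding A_def using B(1) by auto
  have AS: "A \<subseteq> S" unfolding A_def by auto
  have injA: "inj_on \<phi> A" using injS AS inj_on_subset by blast
  have fA: "finite A" using fB AB injA finite_image_iff by metis
  have indpt: "\<not> W.lin_dep A"
  proof
    assume "W.lin_dep A"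
    then obtain X a v where X: "finite X" "X \<subseteq> A" "W.lincomb a X = 0\<^sub>m m m" "v \<in> X" "a v \<noteq> 0"
      unfolding W.lin_dep_def by (auto simp: matrix_vs_simps)
    have "X \<subseteq> S" using X AS by auto
    from lc[OF X(1) this, of a] X(3) \<phi>0 have 0: "(\<Sum>v\<in>X. scale (a v) (\<phi> v)) = 0" by simp
    have iX: "inj_on \<phi> X" using injA X(2) inj_on_subset by blast
    have "(\<Sum>y\<in>\<phi> ` X. scale (a (the_inv_into X \<phi> y)) y) = 0"
      using 0 iX by (simp add: sum.reindex the_inv_into_f_f)
    moreover have "independent (\<phi> ` X)" using B(2) AB X(2) independent_mono by blast
    ultimately have "a (the_inv_into X \<phi> (\<phi> v)) = 0"
      using independentD[of "\<phi> ` X" "\<phi> ` X" "\<lambda>y. a (the_inv_into X \<phi> y)" "\<phi> v"] X by auto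
    thus False using X iX by (simp add: the_inv_into_f_f)
  qed
  have gen: "W.span A = S"
  proof
    show "W.span A \<subseteq> S" unfolding W.span_def using lc AS by blast
    show "S \<subseteq> W.span A"
    proof
      fix x assume x: "x \<in> S"
      hence "\<phi> x \<in> span B" using B(3) by auto
      then obtain c where c: "\<phi> x = (\<Sum>y\<in>B. scale (c y) y)"
        unfolding span_finite[OF fB] by auto
      have "\<phi> x = (\<Sum>v\<in>A. scale (c (\<phi> v)) (\<phi> v))"
        unfolding c AB[symmetric] using injA by (simp add: sum.reindex)
      also have "\<dots> = \<phi> (W.lincomb (\<lambda>v. c (\<phi> v)) A)" using lc[OF fA AS] by simp
      finally have "x = W.lincomb (\<lambda>v. c (\<phi> v)) A"
        using lc[OF fA AS] injS x by (auto simp: inj_on_def)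
      thus "x \<in> W.span A" unfolding W.span_def using fA by auto
    qed
  qed
  have "W.basis A" unfolding W.basis_def using indpt gen AS by simp
  hence "W.dim = card A" using W.dim_basis fA by blast
  also have "\<dots> = card B" using AB injA card_image by metis
  finally show ?thesis using B(4) unfolding mat_subspace_dim_def by simp
qed

text \<open>For a square matrix both sides mean that the determinant is nonzero.\<close>

lemma invertible_mat_iff_inj:
  fixes A :: "'a::field mat"
  assumes A: "A \<in> carrier_mat m m"
  shows "invertible_mat A \<longleftrightarrow> (\<forall>v\<in>carrier_vec m. A *\<^sub>v v = 0\<^sub>v m \<longrightarrow> v = 0\<^sub>v m)"
proof -
  have "det A \<noteq> 0" if inv: "invertible_mat A"
  proof -
    obtain B where "A * B = 1\<^sub>m m" "B * A = 1\<^sub>m (dim_row B)"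
      using inv A unfolding invertible_mat_def inverts_mat_def by auto
    hence B: "B \<in> carrier_mat m m" "A * B = 1\<^sub>m m"
      using A by (metis carrier_matD carrier_matI index_mult_mat(2,3) index_one_mat(2,3))+
    from det_mult[OF A B(1)] B(2) show ?thesis by auto
  qed
  moreover have "invertible_mat A" if "det A \<noteq> 0"
    using det_non_zero_imp_unit[OF A that, of "()"] A
    unfolding Units_def ring_mat_def invertible_mat_def inverts_mat_def by auto
  ultimately show ?thesis using det_0_iff_vec_prod_zero_field[OF A] by blast
qed

section \<open>Orthogonality in symplectic spaces\<close>

context symplectic_space
begin

lemma fin_dim: "local.fin_dim W"
  using finite_dimensional unfolding fin_dim_def by auto

lemma form_add_left: "s (x + y) z = s x z + s y z"
  and form_scale_left: "s (scale c x) z = c * s x z"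
  and form_diff_left: "s (x - y) z = s x z - s y z"
  and form_zero_left [simp]: "s 0 z = 0"
proof -
  interpret l: Vector_Spaces.linear scale "(*)" "\<lambda>x. s x z" by (rule linear_left)
  show "s (x + y) z = s x z + s y z" "s (scale c x) z = c * s x z"
    "s (x - y) z = s x z - s y z" "s 0 z = 0"
    by (rule l.add l.scale l.diff l.zero)+
qed

lemma form_add_right: "s z (x + y) = s z x + s z y"
  and form_scale_right: "s z (scale c x) = c * s z x"
  and form_diff_right: "s z (x - y) = s z x - s z y"
  and form_zero_right [simp]: "s z 0 = 0"
  and form_sum_right: "s z (sum f A) = (\<Sum>i\<in>A. s z (f i))"
proof -
  interpret l: Vector_Spaces.linear scale "(*)" "s z" by (rule linear_right)
  show "s z (x + y) = s z x + s z y" "s z (scale c x) = c * s z x"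
    "s z (x - y) = s z x - s z y" "s z 0 = 0" "s z (sum f A) = (\<Sum>i\<in>A. s z (f i))"
    by (rule l.add l.scale l.diff l.zero l.sum)+
qed

lemmas form_simps = form_add_left form_scale_left form_diff_left
  form_add_right form_scale_right form_diff_right alternating

lemma form_skew: "s x y = - s y x"
proof -
  have "s (x + y) (x + y) = 0" by (rule alternating)
  hence "s x y + s y x = 0"
    unfolding form_add_left form_add_right by (simp add: alternating add.commute)
  thus ?thesis by (simp add: eq_neg_iff_add_eq_0)
qed

lemma form_eq_0_commute: "s x y = 0 \<longleftrightarrow> s y x = 0"
  using form_skew[of x y] by simp

definition perp :: "'b set \<Rightarrow> 'b set" where
  "perp X = {y. \<forall>x\<in>X. s x y = 0}"

lemma subspace_perp: "subspace (perp X)"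
  by (rule subspaceI) (auto simp: perp_def form_simps)

lemma perp_antimono: "X \<subseteq> Y \<Longrightarrow> perp Y \<subseteq> perp X"
  by (auto simp: perp_def)

lemma subset_perp_commute: "X \<subseteq> perp Y \<longleftrightarrow> Y \<subseteq> perp X"
  unfolding perp_def using form_eq_0_commute by blast

lemma perp_span: "perp (span X) = perp X"
proof
  have "X \<subseteq> perp (perp X)" using subset_perp_commute by blast
  hence "span X \<subseteq> perp (perp X)" by (rule span_minimal[OF _ subspace_perp])
  thus "perp X \<subseteq> perp (span X)" using subset_perp_commute by blast
qed (rule perp_antimono[OF span_superset])

lemma perp_UNIV: "perp UNIV = {0}"
proof -
  have "y = 0" if "\<forall>x. s x y = 0" for y
    using that by (intro nondegenerate) (simp add: form_eq_0_commute[of y])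
  thus ?thesis by (auto simp: perp_def)
qed

text \<open>Rank-nullity for the functional \<open>s x\<close> on \<open>U\<close>: its range has
  dimension at most one, and exactly one as soon as some value is nonzero.\<close>

lemma dim_form_image:
  assumes "subspace U"
  shows "dim U \<le> Suc (dim (U \<inter> perp {x}))"
    and "u \<in> U \<Longrightarrow> s x u \<noteq> 0 \<Longrightarrow> dim U = Suc (dim (U \<inter> perp {x}))"
proof -
  interpret l: Vector_Spaces.linear scale "(*)" "s x" by (rule linear_right)
  interpret p: vector_space_pair scale "(*)" ..
  have K: "{y \<in> U. s x y = 0} = U \<inter> perp {x}" by (auto simp: perp_def)
  have *: "dim U = dim (U \<inter> perp {x}) + l.vs2.dim (s x ` U)"
    using p.rank_nullity[OF linear_right[of x] assms fin_dim] unfolding K .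
  have sp: "c \<in> l.vs2.span {1}" for c :: 'a
    using l.vs2.span_scale[OF l.vs2.span_base[of 1 "{1}"], of c] by simp
  have "l.vs2.dim (s x ` U) \<le> card {1::'a}"
    by (rule l.vs2.dim_le_card) (use sp in auto)
  thus "dim U \<le> Suc (dim (U \<inter> perp {x}))" using * by simp
  assume u: "u \<in> U" "s x u \<noteq> 0"
  have "l.vs2.dim (s x ` U) = card {1::'a}"
  proof (rule l.vs2.dim_unique)
    have "s x (scale (inverse (s x u)) u) = 1" using u by (simp add: form_simps)
    moreover have "scale (inverse (s x u)) u \<in> U" using assms u by (simp add: subspace_scale)
    ultimately show "{1} \<subseteq> s x ` U" by (metis empty_subsetI image_eqI insert_subset)
  qed (use sp in auto)
  thus "dim U = Suc (dim (U \<inter> perp {x}))" using * by simp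
qed

lemma dim_Int_perp:
  assumes "finite X" "subspace U"
  shows "dim U \<le> dim (U \<inter> perp X) + card X"
  using assms
proof (induction X rule: finite_induct)
  case empty thus ?case by (simp add: perp_def)
next
  case (insert x X)
  have "U \<inter> perp X \<inter> perp {x} = U \<inter> perp (insert x X)" by (auto simp: perp_def)
  thus ?case using insert dim_form_image(1)[of "U \<inter> perp X" x]
    by (simp add: subspace_inter subspace_perp)
qed

text \<open>Two counts of equations. \<open>perp E\<close> is cut out by \<open>card B\<close> of
  them, which bounds its dimension from below; \<open>card (C - B)\<close> further ones reduce it to
  0 by nondegeneracy, which bounds it from above.\<close>

lemma dim_perp:
  assumes "subspace E"
  shows "dim E + dim (perp E) = dim UNIV"
proof -
  obtain B where B: "B \<subseteq> E" "independent B" "E \<subseteq> span B" "card B = dim E"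
    by (rule basis_exists)
  obtain C where C: "B \<subseteq> C" "independent C" "UNIV \<subseteq> span C"
    using maximal_independent_subset_extend[OF _ B(2), of UNIV] by auto
  have fC: "finite C" using fin_dim_independent(1)[OF fin_dim _ C(2)] by blast
  have fB: "finite B" using C(1) fC finite_subset by auto
  have EB: "E = span B" using B span_minimal[OF B(1) assms] by auto
  have "perp E \<inter> perp (C - B) = perp C" unfolding EB perp_span using C(1) by (auto simp: perp_def)
  also have "\<dots> = {0}" using perp_span[of C] perp_UNIV C(3) by (metis top.extremum_uniqueI)
  finally have z: "perp E \<inter> perp (C - B) = {0}" .
  have "dim (perp E) \<le> card (C - B)"
    using dim_Int_perp[OF _ subspace_perp, of "C - B" E] fC z dim_zero_set by simp
  moreover have "card C = card B + card (C - B)"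
    using fC fB C(1) by (simp add: card_Diff_subset card_mono)
  moreover have "card C = dim UNIV" using C by (simp add: basis_card_eq_dim)
  moreover have "dim UNIV \<le> dim (perp B) + card B"
    using dim_Int_perp[OF fB subspace_UNIV] by simp
  ultimately show ?thesis using B(4) EB perp_span by simp
qed

lemma perp_perp:
  assumes "subspace E"
  shows "perp (perp E) = E"
proof -
  have "E \<subseteq> perp (perp E)" using subset_perp_commute by blast
  from subspace_eq_if_dim_le[OF fin_dim this assms]
  show ?thesis using dim_perp[OF assms] dim_perp[OF subspace_perp, of E] by simp
qed

section \<open>Alternating endomorphisms\<close>

lemma alt_endos_linear: "u \<in> alt_endos \<Longrightarrow> Vector_Spaces.linear scale scale u"
  by (simp add: alt_endos_def)

lemma alt_endos_simps:
  assumes "u \<in> alt_endos"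
  shows "u (x + y) = u x + u y" "u (scale c x) = scale c (u x)" "u (x - y) = u x - u y" "u 0 = 0"
proof -
  interpret Vector_Spaces.linear scale scale u using assms by (rule alt_endos_linear)
  show "u (x + y) = u x + u y" "u (scale c x) = scale c (u x)" "u (x - y) = u x - u y" "u 0 = 0"
    by (rule add scale diff zero)+
qed

text \<open>Polarising \<open>s z (u z) = 0\<close> makes \<open>s x (u y)\<close> skew in
  \<open>x\<close> and \<open>y\<close>; the skewness of \<open>s\<close> itself cancels the
  sign.\<close>

lemma alt_endos_selfadjoint:
  assumes "u \<in> alt_endos"
  shows "s x (u y) = s (u x) y"
proof -
  have "s z (u z) = 0" for z using assms by (simp add: alt_endos_def)
  from this[of "x + y"] this[of x] this[of y] have "s x (u y) + s y (u x) = 0"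
    using assms by (simp add: form_simps alt_endos_simps add.commute)
  moreover have "s (u x) y + s y (u x) = 0" using form_skew[of "u x" y] by simp
  ultimately show ?thesis by (metis add_right_cancel)
qed

lemma linear_endoI:
  assumes "\<And>x y. u (x + y) = u x + u y" "\<And>c x. u (scale c x) = scale c (u x)"
  shows "Vector_Spaces.linear scale scale u"
  using assms by (intro Vector_Spaces.linear.intro) (unfold_locales, auto)

lemma alt_endosI:
  assumes "\<And>x y. u (x + y) = u x + u y" "\<And>c x. u (scale c x) = scale c (u x)" "\<And>x. s x (u x) = 0"
  shows "u \<in> alt_endos"
  using assms linear_endoI unfolding alt_endos_def by auto

lemma subspace_alt_endos: "Fun.subspace alt_endos"
proof -
  have s0: "s x (u x) = 0" if "u \<in> alt_endos" for u x using that by (simp add: alt_endos_def)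
  show ?thesis
  proof (rule Fun.subspaceI)
    show "0 \<in> alt_endos" by (rule alt_endosI) simp_all
    show "u + v \<in> alt_endos" if uv: "u \<in> alt_endos" "v \<in> alt_endos" for u v
      by (rule alt_endosI)
         (simp_all add: alt_endos_simps(1,2)[OF uv(1)] alt_endos_simps(1,2)[OF uv(2)]
           form_simps s0[OF uv(1)] s0[OF uv(2)] scale_right_distrib)
    show "(\<lambda>x. scale c (u x)) \<in> alt_endos" if u: "u \<in> alt_endos" for c u
      by (rule alt_endosI)
         (simp_all add: alt_endos_simps(1,2)[OF u] form_simps s0[OF u] scale_right_distrib mult.commute)
  qed
qed

text \<open>The linear maps are spanned by the finitely many matrix units \<open>E b c\<close> of a
  fixed basis.\<close>

lemma fin_dim_endos: "Fun.fin_dim {u. Vector_Spaces.linear scale scale u}"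
proof -
  obtain B where B: "independent B" "UNIV \<subseteq> span B" using basis_exists by metis
  have fB: "finite B" using fin_dim_independent(1)[OF fin_dim _ B(1)] by blast
  define E where "E b c x = scale (representation B x b) c" for b c x
  have "u \<in> Fun.span ((\<lambda>(b, c). E b c) ` (B \<times> B))" if "Vector_Spaces.linear scale scale u" for u
  proof -
    interpret u: Vector_Spaces.linear scale scale u by (rule that)
    have ap: "sum f A x = (\<Sum>i\<in>A. f i x)" for f :: "'b \<Rightarrow> 'b \<Rightarrow> 'b" and A x
      by (induction A rule: infinite_finite_induct) auto
    have ex: "v = (\<Sum>b\<in>B. scale (representation B v b) b)" for v
      using sum_representation_eq[OF B(1) subsetD[OF B(2) UNIV_I] fB order_refl, of v] by simp
    have "u = (\<Sum>b\<in>B. \<Sum>c\<in>B. (\<lambda>x. scale (representation B (u b) c) (E b c x)))"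
    proof
      fix x
      have "u x = u (\<Sum>b\<in>B. scale (representation B x b) b)" by (rule arg_cong[OF ex])
      also have "\<dots> = (\<Sum>b\<in>B. scale (representation B x b) (u b))" by (simp add: u.sum u.scale)
      also have "\<dots> = (\<Sum>b\<in>B. scale (representation B x b) (\<Sum>c\<in>B. scale (representation B (u b) c) c))"
        by (intro sum.cong refl arg_cong2[of _ _ _ _ scale] ex)
      also have "\<dots> = (\<Sum>b\<in>B. \<Sum>c\<in>B. scale (representation B (u b) c) (E b c x))"
        unfolding E_def by (simp add: scale_sum_right mult.commute)
      finally show "u x = (\<Sum>b\<in>B. \<Sum>c\<in>B. (\<lambda>x. scale (representation B (u b) c) (E b c x))) x"
        by (simp add: ap)
    qed
    also have "\<dots> \<in> Fun.span ((\<lambda>(b, c). E b c) ` (B \<times> B))"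
      by (intro Fun.span_sum Fun.span_scale Fun.span_base) auto
    finally show ?thesis .
  qed
  thus ?thesis unfolding Fun.fin_dim_def using fB
    by (intro exI[of _ "(\<lambda>(b, c). E b c) ` (B \<times> B)"]) auto
qed

lemma fin_dim_alt_endos: "T \<subseteq> alt_endos \<Longrightarrow> Fun.fin_dim T"
  by (rule Fun.fin_dim_mono[OF fin_dim_endos]) (auto simp: alt_endos_def)

lemma linear_inj_on_invariant:
  assumes f: "Vector_Spaces.linear scale scale f" and E: "subspace E" "f ` E \<subseteq> E"
    and inj: "\<And>x. x \<in> E \<Longrightarrow> f x = 0 \<Longrightarrow> x = 0"
  shows "f ` E = E"
proof -
  interpret p: vector_space_pair scale scale ..
  interpret f: Vector_Spaces.linear scale scale f by (rule f)
  have "{x \<in> E. f x = 0} = {0}"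
  proof
    show "{x \<in> E. f x = 0} \<subseteq> {0}" using inj by blast
  qed (simp add: subspace_0[OF E(1)] f.zero)
  hence "dim E = dim (f ` E)"
    using p.rank_nullity[OF f E(1) fin_dim] dim_zero_set by simp
  thus ?thesis
    using subspace_eq_if_dim_le[OF fin_dim E(2) f.subspace_image[OF E(1)]] by simp
qed

lemma linear_id_minus:
  assumes "u \<in> alt_endos"
  shows "Vector_Spaces.linear scale scale (\<lambda>x. x - u x)"
  by (rule linear_endoI)
     (simp_all add: alt_endos_simps(1,2)[OF assms] scale_right_diff_distrib)

lemma bij_id_minus_iff:
  assumes "u \<in> alt_endos"
  shows "bij (\<lambda>x. x - u x) \<longleftrightarrow> (\<forall>x. u x = x \<longrightarrow> x = 0)"
proof -
  interpret l: Vector_Spaces.linear scale scale "\<lambda>x. x - u x" by (rule linear_id_minus[OF assms])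
  have "inj (\<lambda>x. x - u x) \<longleftrightarrow> (\<forall>x. u x = x \<longrightarrow> x = 0)"
  proof -
    have "x - u x = 0 \<longleftrightarrow> u x = x" for x by (metis right_minus_eq)
    thus ?thesis using l.inj_iff_eq_0 by presburger
  qed
  moreover have "surj (\<lambda>x. x - u x)" if "inj (\<lambda>x. x - u x)"
  proof (rule linear_inj_on_invariant[OF linear_id_minus[OF assms] subspace_UNIV subset_UNIV])
    show "x = 0" if "x - u x = 0" for x
      using l.inj_iff_eq_0[THEN iffD1, rule_format, OF \<open>inj (\<lambda>x. x - u x)\<close> that] .
  qed
  ultimately show ?thesis unfolding bij_def by argo
qed

text \<open>\<open>1 - u\<close> is injective modulo \<open>E\<close>: by finite dimension it maps
  \<open>E\<close> onto \<open>E\<close>, so \<open>z - u z\<close> also has a preimage in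
  \<open>E\<close>, and injectivity on the whole space identifies that preimage with
  \<open>z\<close>.\<close>

lemma invariant_id_minus:
  assumes u: "u \<in> alt_endos" and bij: "bij (\<lambda>x. x - u x)" and E: "subspace E" "u ` E \<subseteq> E"
    and z: "z - u z \<in> E"
  shows "z \<in> E"
proof -
  have "(\<lambda>x. x - u x) ` E = E"
  proof (rule linear_inj_on_invariant[OF linear_id_minus[OF u] E(1)])
    show "(\<lambda>x. x - u x) ` E \<subseteq> E" using E by (auto intro: subspace_diff)
    show "x = 0" if "x - u x = 0" for x
    proof -
      have "u x = x" using that by (metis right_minus_eq)
      thus ?thesis using bij unfolding bij_id_minus_iff[OF u] by blast
    qed
  qed
  hence "z - u z \<in> (\<lambda>x. x - u x) ` E" using z by (simp only:)
  then obtain e where e: "e \<in> E" "z - u z = e - u e" by blast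
  have "inj (\<lambda>x. x - u x)" using bij unfolding bij_def by blast
  from injD[OF this e(2)] e(1) show ?thesis by simp
qed

lemma perp_invariant:
  assumes "u \<in> alt_endos" "u ` E \<subseteq> E"
  shows "u ` perp E \<subseteq> perp E"
proof safe
  fix z assume z: "z \<in> perp E"
  have "s x (u z) = 0" if "x \<in> E" for x
  proof -
    have "u x \<in> E" using assms(2) that by blast
    thus ?thesis using z alt_endos_selfadjoint[OF assms(1), of x z] by (simp add: perp_def)
  qed
  thus "u z \<in> perp E" by (simp add: perp_def)
qed

text \<open>The range of \<open>1 - u\<close> contains \<open>E\<close>, hence by self-adjointness every fixed vector of \<open>u\<close> lies
  in \<open>perp E\<close>.\<close>
lemma bij_id_minus_isotropic_iff:
  assumes u: "u \<in> alt_endos" and E: "subspace E" "E \<subseteq> perp E" "u ` E \<subseteq> E"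
  shows "bij (\<lambda>x. x - u x) \<longleftrightarrow>
    (\<forall>z\<in>E. u z = z \<longrightarrow> z = 0) \<and> (\<forall>z\<in>perp E. z - u z \<in> E \<longrightarrow> z \<in> E)" (is "?L \<longleftrightarrow> ?R")
proof
  assume ?L
  hence "\<forall>x. u x = x \<longrightarrow> x = 0" by (simp only: bij_id_minus_iff[OF u])
  moreover have "z \<in> E" if "z - u z \<in> E" for z
    using invariant_id_minus[OF u \<open>?L\<close> E(1,3) that] .
  ultimately show ?R by blast
next
  assume R: ?R
  have surj: "(\<lambda>x. x - u x) ` E = E"
  proof (rule linear_inj_on_invariant[OF linear_id_minus[OF u] E(1)])
    show "(\<lambda>x. x - u x) ` E \<subseteq> E" using E(3) subspace_diff[OF E(1)] by blast
    show "x = 0" if "x \<in> E" "x - u x = 0" for x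
    proof -
      have "u x = x" using that(2) by (metis right_minus_eq)
      thus ?thesis using R that(1) by blast
    qed
  qed
  show ?L unfolding bij_id_minus_iff[OF u]
  proof (intro allI impI)
    fix z assume z: "u z = z"
    have "z \<in> perp E" unfolding perp_def
    proof safe
      fix x assume "x \<in> E"
      then obtain e where "x = e - u e" using surj by auto
      thus "s x z = 0" using alt_endos_selfadjoint[OF u, of e z] z by (simp add: form_simps)
    qed
    moreover have "z - u z \<in> E" using subspace_0[OF E(1)] unfolding z by simp
    ultimately have "z \<in> E" using R by blast
    thus "z = 0" using R z by blast
  qed
qed

text \<open>The bilinear form \<open>s v (wedge x y z)\<close> in \<open>v\<close> and
  \<open>z\<close> is the exterior product of the functionals \<open>s x\<close> and
  \<open>s y\<close>, which makes these endomorphisms alternating of rank at most two.\<close>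

definition wedge :: "'b \<Rightarrow> 'b \<Rightarrow> 'b \<Rightarrow> 'b" where
  "wedge x y = (\<lambda>z. scale (s x z) y - scale (s y z) x)"

lemma wedge_alt: "wedge x y \<in> alt_endos"
proof (rule alt_endosI)
  show "s z (wedge x y z) = 0" for z
    using form_skew[of z x] form_skew[of z y] by (simp add: wedge_def form_simps)
qed (simp_all add: wedge_def form_simps scale_left_distrib scale_right_diff_distrib)

section \<open>Optimal trivial spectrum subspaces\<close>

definition stable :: "('b \<Rightarrow> 'b) set \<Rightarrow> 'b set \<Rightarrow> bool" where
  "stable S U \<longleftrightarrow> subspace U \<and> (\<forall>u\<in>S. u ` U \<subseteq> U)"

lemma optimal_trivial_spectrumD:
  assumes "optimal_trivial_spectrum S"
  shows "Fun.subspace S" "S \<subseteq> alt_endos" "\<And>u. u \<in> S \<Longrightarrow> bij (\<lambda>x. x - u x)"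
    "\<And>T. Fun.subspace T \<Longrightarrow> T \<subseteq> alt_endos \<Longrightarrow> (\<And>u. u \<in> T \<Longrightarrow> bij (\<lambda>x. x - u x)) \<Longrightarrow>
      Fun.dim T \<le> Fun.dim S"
  using assms unfolding optimal_trivial_spectrum_def trivial_spectrum_def by auto

text \<open>The elements \<open>u\<close> that act on \<open>E\<close> and on \<open>perp E\<close> modulo \<open>E\<close> like elements of \<open>S\<close> form a trivial
  spectrum subspace which contains \<open>S\<close>.\<close>
lemma optimal_mem:
  assumes S: "optimal_trivial_spectrum S" and E: "stable S E" "E \<subseteq> perp E"
    and u: "u \<in> alt_endos" "u ` E \<subseteq> E" and v: "v \<in> S" "\<And>x. x \<in> E \<Longrightarrow> u x = v x"
    and w: "w \<in> S" "\<And>x. x \<in> perp E \<Longrightarrow> u x - w x \<in> E"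
  shows "u \<in> S"
proof -
  note S' = optimal_trivial_spectrumD[OF S]
  have sE: "subspace E" using E(1) by (simp add: stable_def)
  \<comment> \<open>The witnesses \<open>v\<close> and \<open>w\<close> are chosen independently, so
    \<open>T\<close> forgets any link between the action on \<open>E\<close> and the action on
    \<open>perp E / E\<close>. That is why an optimal \<open>S\<close> turns out to be built from a
    full product of two matrix spaces.\<close>
  define T where "T = {u \<in> alt_endos. u ` E \<subseteq> E \<and> (\<exists>v\<in>S. \<forall>x\<in>E. u x = v x) \<and>
    (\<exists>w\<in>S. \<forall>x\<in>perp E. u x - w x \<in> E)}"
  have TI: "a \<in> T" if "a \<in> alt_endos" "\<And>x. x \<in> E \<Longrightarrow> a x \<in> E" "v \<in> S" "\<And>x. x \<in> E \<Longrightarrow> a x = v x"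
    "w \<in> S" "\<And>x. x \<in> perp E \<Longrightarrow> a x - w x \<in> E" for a v w
    unfolding T_def using that by (intro CollectI conjI bexI[of _ v] bexI[of _ w]) auto
  have TD: "\<exists>v w. v \<in> S \<and> w \<in> S \<and> a \<in> alt_endos \<and> (\<forall>x\<in>E. a x \<in> E) \<and> (\<forall>x\<in>E. a x = v x) \<and>
    (\<forall>x\<in>perp E. a x - w x \<in> E)" if "a \<in> T" for a
    using that unfolding T_def by blast
  have ST: "S \<subseteq> T"
  proof
    fix u assume u: "u \<in> S"
    show "u \<in> T"
      by (rule TI[of u u u]) (use u S'(2) E(1) subspace_0[OF sE] in \<open>auto simp: stable_def\<close>)
  qed
  have subT: "Fun.subspace T"
  proof (rule Fun.subspaceI)
    show "0 \<in> T" using ST Fun.subspace_0[OF S'(1)] by blast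
  next
    fix a b assume a: "a \<in> T" and b: "b \<in> T"
    from TD[OF a] obtain va wa where A: "va \<in> S" "wa \<in> S" "a \<in> alt_endos"
      "\<And>x. x \<in> E \<Longrightarrow> a x \<in> E" "\<And>x. x \<in> E \<Longrightarrow> a x = va x" "\<And>x. x \<in> perp E \<Longrightarrow> a x - wa x \<in> E"
      by blast
    from TD[OF b] obtain vb wb where B: "vb \<in> S" "wb \<in> S" "b \<in> alt_endos"
      "\<And>x. x \<in> E \<Longrightarrow> b x \<in> E" "\<And>x. x \<in> E \<Longrightarrow> b x = vb x" "\<And>x. x \<in> perp E \<Longrightarrow> b x - wb x \<in> E"
      by blast
    show "a + b \<in> T"
    proof (rule TI[of _ "va + vb" "wa + wb"])
      show "va + vb \<in> S" "wa + wb \<in> S" using A(1,2) B(1,2) Fun.subspace_add[OF S'(1)] by blast+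
      show "a + b \<in> alt_endos" using Fun.subspace_add[OF subspace_alt_endos A(3) B(3)] .
      show "(a + b) x \<in> E" if "x \<in> E" for x
        using subspace_add[OF sE A(4)[OF that] B(4)[OF that]] by simp
      show "(a + b) x = (va + vb) x" if "x \<in> E" for x using A(5)[OF that] B(5)[OF that] by simp
      show "(a + b) x - (wa + wb) x \<in> E" if "x \<in> perp E" for x
        using subspace_add[OF sE A(6)[OF that] B(6)[OF that]] by (simp add: algebra_simps)
    qed
  next
    fix c a assume a: "a \<in> T"
    from TD[OF a] obtain va wa where A: "va \<in> S" "wa \<in> S" "a \<in> alt_endos"
      "\<And>x. x \<in> E \<Longrightarrow> a x \<in> E" "\<And>x. x \<in> E \<Longrightarrow> a x = va x" "\<And>x. x \<in> perp E \<Longrightarrow> a x - wa x \<in> E"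
      by blast
    show "(\<lambda>x. scale c (a x)) \<in> T"
    proof (rule TI[of _ "\<lambda>x. scale c (va x)" "\<lambda>x. scale c (wa x)"])
      show "(\<lambda>x. scale c (va x)) \<in> S" "(\<lambda>x. scale c (wa x)) \<in> S"
        using A(1,2) Fun.subspace_scale[OF S'(1)] by blast+
      show "(\<lambda>x. scale c (a x)) \<in> alt_endos" using Fun.subspace_scale[OF subspace_alt_endos A(3)] .
      show "scale c (a x) \<in> E" if "x \<in> E" for x using subspace_scale[OF sE A(4)[OF that]] .
      show "scale c (a x) = scale c (va x)" if "x \<in> E" for x using A(5)[OF that] by simp
      show "scale c (a x) - scale c (wa x) \<in> E" if "x \<in> perp E" for x
        using subspace_scale[OF sE A(6)[OF that], of c] by (simp add: scale_right_diff_distrib)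
    qed
  qed
  have bijT: "bij (\<lambda>x. x - u x)" if uT: "u \<in> T" for u
  proof -
    from TD[OF uT] obtain v w where vw: "v \<in> S" "w \<in> S" "u \<in> alt_endos"
      "\<And>x. x \<in> E \<Longrightarrow> u x \<in> E" "\<And>x. x \<in> E \<Longrightarrow> u x = v x" "\<And>x. x \<in> perp E \<Longrightarrow> u x - w x \<in> E"
      by blast
    have alt: "v \<in> alt_endos" "w \<in> alt_endos" using vw(1,2) S'(2) by blast+
    have "z = 0" if "z \<in> E" "u z = z" for z
      using vw(5)[OF that(1)] that(2) S'(3)[OF vw(1)] unfolding bij_id_minus_iff[OF alt(1)] by simp
    moreover have "z \<in> E" if z: "z \<in> perp E" "z - u z \<in> E" for z
    proof -
      have "z - w z \<in> E" using subspace_add[OF sE z(2) vw(6)[OF z(1)]] by simp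
      moreover have "w ` E \<subseteq> E" using E(1) vw(2) by (simp add: stable_def)
      ultimately show ?thesis using invariant_id_minus[OF alt(2) S'(3)[OF vw(2)] sE] by blast
    qed
    moreover have "u ` E \<subseteq> E" using vw(4) by blast
    ultimately show ?thesis
      using bij_id_minus_isotropic_iff[OF vw(3) sE E(2)] by blast
  qed
  have TA: "T \<subseteq> alt_endos" by (auto simp: T_def)
  have "Fun.dim T \<le> Fun.dim S" by (rule S'(4)[OF subT TA bijT])
  hence "S = T"
    using Fun.subspace_eq_if_dim_le[OF fin_dim_alt_endos[OF TA] ST S'(1)] by simp
  moreover have "u \<in> T" by (rule TI[OF u(1) _ v w]) (use u(2) in auto)
  ultimately show ?thesis by simp
qed

section \<open>Irreducible flags\<close>


text \<open>Irreducibility is recorded instead of maximality of \<open>E\<close>, because it is what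
  can be read off from a matrix decomposition. The Lagrangian case \<open>E = perp E\<close> is
  included.\<close>

definition irreducible_flag :: "('b \<Rightarrow> 'b) set \<Rightarrow> 'b set \<Rightarrow> bool" where
  "irreducible_flag S E \<longleftrightarrow> stable S E \<and> E \<subseteq> perp E \<and>
     (\<forall>U. stable S U \<longrightarrow> E \<subseteq> U \<longrightarrow> U \<subseteq> perp E \<longrightarrow> U = E \<or> U = perp E)"

lemma stableI: "subspace U \<Longrightarrow> (\<And>u x. u \<in> S \<Longrightarrow> x \<in> U \<Longrightarrow> u x \<in> U) \<Longrightarrow> stable S U"
  unfolding stable_def by blast

lemma stableD: "stable S U \<Longrightarrow> subspace U" "stable S U \<Longrightarrow> u \<in> S \<Longrightarrow> x \<in> U \<Longrightarrow> u x \<in> U"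
  unfolding stable_def by blast+

lemma stable_perp: "S \<subseteq> alt_endos \<Longrightarrow> stable S U \<Longrightarrow> stable S (perp U)"
proof (unfold stable_def, intro conjI ballI)
  fix u assume "S \<subseteq> alt_endos" "subspace U \<and> (\<forall>u\<in>S. u ` U \<subseteq> U)" "u \<in> S"
  thus "u ` perp U \<subseteq> perp U" by (intro perp_invariant) auto
qed (rule subspace_perp)

lemma stable_Int: "stable S U \<Longrightarrow> stable S U' \<Longrightarrow> stable S (U \<inter> U')"
  by (intro stableI) (auto intro: subspace_inter dest: stableD)

lemma stable_sum:
  assumes "S \<subseteq> alt_endos" "stable S U" "stable S U'"
  shows "stable S {x + y | x y. x \<in> U \<and> y \<in> U'}"
proof (rule stableI)
  show "subspace {x + y | x y. x \<in> U \<and> y \<in> U'}"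
    using assms(2,3) subspace_sums by (simp add: stable_def)
next
  fix u z assume u: "u \<in> S" and "z \<in> {x + y | x y. x \<in> U \<and> y \<in> U'}"
  then obtain x y where z: "z = x + y" "x \<in> U" "y \<in> U'" by blast
  have "u z = u x + u y" using alt_endos_simps(1)[of u x y] u assms(1) z(1) by blast
  thus "u z \<in> {x + y | x y. x \<in> U \<and> y \<in> U'}"
    using stableD(2)[OF assms(2) u z(2)] stableD(2)[OF assms(3) u z(3)] by blast
qed

lemma wedge_add: "wedge x (y + y') = wedge x y + wedge x y'"
  and wedge_scale: "wedge x (scale c y) = (\<lambda>z. scale c (wedge x y z))"
  by (simp_all add: wedge_def form_simps fun_eq_iff scale_right_distrib scale_left_distrib
    scale_right_diff_distrib mult.commute)

text \<open>The competing space consists of the elements of \<open>S + x \<and> perp E\<^sub>1\<close>, where \<open>E\<^sub>1 = E + \<langle>x\<rangle>\<close>, that map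
  \<open>x\<close> into \<open>E\<close>. It has trivial spectrum because its elements preserve \<open>E\<^sub>1\<close> and act on \<open>perp E\<^sub>1\<close> modulo
  \<open>E\<^sub>1\<close> like elements of \<open>S\<close>; counting dimensions, it would be larger than \<open>S\<close>.\<close>
lemma no_small_intermediate:
  assumes S: "optimal_trivial_spectrum S" and E: "stable S E" "E \<subseteq> perp E"
    and U: "stable S U" "E \<subseteq> U" "U \<subseteq> perp E" "U \<inter> perp U = E" "dim U \<le> dim (perp U)"
  shows "U = E"
proof (rule ccontr)
  assume "U \<noteq> E"
  then obtain x where x: "x \<in> U" "x \<notin> E" using U(2) by blast
  note S' = optimal_trivial_spectrumD[OF S]
  note sE = stableD(1)[OF E(1)] and sU = stableD(1)[OF U(1)]
  have alt: "a \<in> alt_endos" if "a \<in> S" for a using that S'(2) by blast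
  have xpE: "x \<in> perp E" using x U(3) by blast
  \<comment> \<open>Since \<open>U \<inter> perp U = E\<close>, a vector of \<open>U\<close> outside
    \<open>E\<close> cannot be orthogonal to \<open>U\<close>.\<close>
  obtain u0 where u0: "u0 \<in> U" "s x u0 \<noteq> 0"
  proof -
    have "x \<notin> perp U" using x U(4) by blast
    thus ?thesis using that unfolding perp_def using form_eq_0_commute by blast
  qed
  define E1 where "E1 = span (insert x E)"
  have sE1: "subspace E1" unfolding E1_def by simp
  have xE1: "x \<in> E1" unfolding E1_def by (simp add: span_base)
  have EE1: "E \<subseteq> E1" unfolding E1_def using span_superset by blast
  have E1D: "\<exists>c e. e \<in> E \<and> z = scale c x + e" if "z \<in> E1" for z
  proof -
    obtain c where "z - scale c x \<in> span E" using span_breakdown_eq[of z x E] \<open>z \<in> E1\<close> E1_def by blast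
    hence "z - scale c x \<in> E" using span_minimal[OF order_refl sE] by blast
    thus ?thesis by (intro exI[of _ c] exI[of _ "z - scale c x"]) simp
  qed
  have pE1: "perp E1 = perp E \<inter> perp {x}" unfolding E1_def perp_span by (auto simp: perp_def)
  have xpx: "x \<in> perp {x}" by (simp add: perp_def alternating)
  have E1iso: "E1 \<subseteq> perp E1"
  proof -
    have "x \<in> perp E1" using xpE xpx pE1 by blast
    moreover have "E \<subseteq> perp E1"
    proof -
      have "E \<subseteq> perp {x}" using xpE subset_perp_commute[of E "{x}"] by blast
      thus ?thesis using E(2) pE1 by blast
    qed
    ultimately show ?thesis using span_minimal[of "insert x E" "perp E1"] subspace_perp E1_def by blast
  qed
  define Y where "Y = perp E1"
  define Tot where "Tot = {a + b | a b. a \<in> S \<and> b \<in> wedge x ` Y}"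
  have sY: "subspace Y" unfolding Y_def by (rule subspace_perp)
  have linw: "Vector_Spaces.linear scale (\<lambda>c u z. scale c (u z)) (wedge x)"
    unfolding Vector_Spaces.linear_iff
    by (simp add: wedge_add wedge_scale vector_space_axioms Fun.vector_space_axioms)
  interpret w: Vector_Spaces.linear scale "\<lambda>c u z. scale c (u z)" "wedge x" by (rule linw)
  have sB: "Fun.subspace (wedge x ` Y)" by (rule w.subspace_image[OF sY])
  have sTot: "Fun.subspace Tot" unfolding Tot_def by (rule Fun.subspace_sums[OF S'(1) sB])
  have TotA: "Tot \<subseteq> alt_endos"
    unfolding Tot_def using S'(2) wedge_alt Fun.subspace_add[OF subspace_alt_endos] by blast
  have STot: "S \<subseteq> Tot"
  proof
    fix a assume "a \<in> S"
    moreover have "0 \<in> wedge x ` Y" using Fun.subspace_0[OF sB] .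
    ultimately have "a + 0 \<in> Tot" unfolding Tot_def by blast
    thus "a \<in> Tot" by simp
  qed
  have wx: "wedge x y x = 0" if "y \<in> Y" for y
  proof -
    have "s x y = 0" using that xE1 unfolding Y_def perp_def by blast
    thus ?thesis by (simp add: wedge_def alternating form_eq_0_commute[of y])
  qed
  from quotient_map_exists[OF sE] obtain q
    where q1: "Vector_Spaces.linear scale scale q \<and> (\<forall>z. q z = 0 \<longleftrightarrow> z \<in> E)" by (rule exE)
  hence q: "Vector_Spaces.linear scale scale q" "q z = 0 \<longleftrightarrow> z \<in> E" for z by simp_all
  interpret q: Vector_Spaces.linear scale scale q by (rule q(1))
  note V = vector_space_axioms and F = Fun.vector_space_axioms
  note rn = vector_space_pair.rank_nullity[OF vector_space_pair.intro]
  define ev where "ev t = q (t x)" for t :: "'b \<Rightarrow> 'b"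
  have lev: "Vector_Spaces.linear (\<lambda>c u z. scale c (u z)) scale ev"
    unfolding Vector_Spaces.linear_iff
    by (simp add: ev_def q.add q.scale vector_space_axioms Fun.vector_space_axioms)
  interpret ev: Vector_Spaces.linear "\<lambda>c u z. scale c (u z)" scale ev by (rule lev)
  define T where "T = {t \<in> Tot. ev t = 0}"
  have sT: "Fun.subspace T" unfolding T_def
    by (rule Fun.subspaceI)
       (simp_all add: ev.zero ev.add ev.scale Fun.subspace_0[OF sTot] Fun.subspace_add[OF sTot]
          Fun.subspace_scale[OF sTot])
  have TA: "T \<subseteq> alt_endos" using TotA unfolding T_def by blast
  have bijT: "bij (\<lambda>z. z - t z)" if t: "t \<in> T" for t
  proof -
    obtain a y where a: "a \<in> S" "y \<in> Y" "t = a + wedge x y" using t unfolding T_def Tot_def by blast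
    have tx: "t x \<in> E" using t q(2) unfolding T_def ev_def by blast
    hence ax: "a x \<in> E" using wx[OF a(2)] a(3) by simp
    have te: "t e = a e" if "e \<in> E" for e
    proof -
      have "s y e = 0" using that a(2) EE1 form_eq_0_commute[of y e] unfolding Y_def perp_def by blast
      moreover have "s x e = 0" using that xpE form_eq_0_commute[of x e] unfolding perp_def by blast
      ultimately show ?thesis using a(3) by (simp add: wedge_def)
    qed
    have aE: "a e \<in> E" if "e \<in> E" for e using stableD(2)[OF E(1) a(1) that] .
    note talt = subsetD[OF TA t]
    have inv: "f z \<in> E" if f: "f \<in> alt_endos" "f x \<in> E" "\<And>e. e \<in> E \<Longrightarrow> f e \<in> E" and z: "z \<in> E1" for f z
    proof -
      obtain c e where "e \<in> E" "z = scale c x + e" using E1D[OF z] by blast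
      thus ?thesis
        using f subspace_add[OF sE subspace_scale[OF sE f(2), of c] f(3)] by (simp add: alt_endos_simps(1,2)[OF f(1)])
    qed
    have tE1: "t z \<in> E" if "z \<in> E1" for z
      by (rule inv[OF talt tx _ that]) (simp add: te aE)
    have aE1: "a z \<in> E" if "z \<in> E1" for z
      by (rule inv[OF alt[OF a(1)] ax aE that])
    have 1: "z = 0" if "z \<in> E1" "t z = z" for z
    proof -
      have zE: "z \<in> E" using tE1[OF that(1)] unfolding that(2) .
      have "a z = z" using te[OF zE] that(2) by (rule subst)
      thus ?thesis using S'(3)[OF a(1)] unfolding bij_id_minus_iff[OF alt[OF a(1)]] by blast
    qed
    have 2: "z \<in> E1" if z: "z \<in> perp E1" "z - t z \<in> E1" for z
    proof -
      have "s x z = 0" using z(1) xE1 unfolding perp_def by blast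
      hence "t z = a z - scale (s y z) x" using a(3) by (simp add: wedge_def)
      hence "z - a z = (z - t z) - scale (s y z) x" by (simp add: algebra_simps)
      also have "\<dots> \<in> E1" by (rule subspace_diff[OF sE1 z(2) subspace_scale[OF sE1 xE1]])
      finally have "z - a z \<in> E1" .
      moreover have "a ` E1 \<subseteq> E1" using aE1 EE1 by blast
      ultimately show ?thesis using invariant_id_minus[OF alt[OF a(1)] S'(3)[OF a(1)] sE1] by blast
    qed
    have "t ` E1 \<subseteq> E1" using tE1 EE1 by blast
    from bij_id_minus_isotropic_iff[OF talt sE1 E1iso this] 1 2 show ?thesis by blast
  qed
  have i1: "Fun.dim T \<le> Fun.dim S" by (rule S'(4)[OF sT TA bijT])
  have i2: "Fun.dim Tot = Fun.dim T + dim (ev ` Tot)"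
    using rn[OF F V lev sTot fin_dim_alt_endos[OF TotA]] unfolding T_def .
  \<comment> \<open>The wedges in \<open>Tot\<close> kill \<open>x\<close> by \<open>wx\<close>,
    hence they add no new values at \<open>x\<close>.\<close>
  have evTot: "ev ` Tot \<subseteq> ev ` S"
  proof
    fix z assume "z \<in> ev ` Tot"
    then obtain a y where "a \<in> S" "y \<in> Y" "z = ev (a + wedge x y)" unfolding Tot_def by blast
    thus "z \<in> ev ` S" using wx[of y] by (simp add: ev_def)
  qed
  have evS: "ev ` S \<subseteq> q ` U" using stableD(2)[OF U(1) _ x(1)] unfolding ev_def by blast
  \<comment> \<open>Trivial spectrum enters here: \<open>x\<close> modulo \<open>E\<close> is not a
    value at \<open>x\<close> of any element of \<open>S\<close>. The values therefore form a proper
    subspace of \<open>U / E\<close>, and this one missing dimension decides the final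
    inequality.\<close>
  have nx: "q x \<notin> ev ` S"
  proof
    assume "q x \<in> ev ` S"
    then obtain a where a: "a \<in> S" "q x = q (a x)" unfolding ev_def by blast
    hence "q (x - a x) = 0" by (simp add: q.diff)
    hence "x - a x \<in> E" using q(2) by blast
    hence "x \<in> E"
      using invariant_id_minus[OF alt[OF a(1)] S'(3)[OF a(1)] sE] E(1) a(1) unfolding stable_def by blast
    thus False using x(2) by blast
  qed
  have i3: "dim (ev ` Tot) < dim (q ` U)"
  proof -
    have "dim (ev ` Tot) \<le> dim (ev ` S)" by (rule dim_mono_fin_dim[OF fin_dim evTot])
    also have "\<dots> < dim (q ` U)"
      by (rule dim_less_fin_dim[OF fin_dim evS ev.subspace_image[OF S'(1)] _ nx]) (use x(1) in blast)
    finally show ?thesis .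
  qed
  have "{z \<in> U. q z = 0} = E" using U(2) q(2) by blast
  hence i4: "dim U = dim E + dim (q ` U)" using rn[OF V V q(1) sU fin_dim] by simp
  \<comment> \<open>The map \<open>p\<close> has kernel \<open>S\<close>, so the image of
    \<open>Tot\<close> counts what the wedges add to \<open>S\<close>.\<close>
  from Fun.quotient_map_exists[OF S'(1)] obtain p :: "('b \<Rightarrow> 'b) \<Rightarrow> ('b \<Rightarrow> 'b)"
    where p1: "Vector_Spaces.linear (\<lambda>c u z. scale c (u z)) (\<lambda>c u z. scale c (u z)) p \<and>
      (\<forall>z. p z = 0 \<longleftrightarrow> z \<in> S)" by (rule exE)
  hence p: "Vector_Spaces.linear (\<lambda>c u z. scale c (u z)) (\<lambda>c u z. scale c (u z)) p"
    "p z = 0 \<longleftrightarrow> z \<in> S" for z by simp_all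
  interpret p: Vector_Spaces.linear "\<lambda>c u z. scale c (u z)" "\<lambda>c u z. scale c (u z)" p by (rule p(1))
  have "{t \<in> Tot. p t = 0} = S" using STot p(2) by blast
  hence i5: "Fun.dim Tot = Fun.dim S + Fun.dim (p ` Tot)"
    using rn[OF F F p(1) sTot fin_dim_alt_endos[OF TotA]] by simp
  have pTot: "(\<lambda>y. p (wedge x y)) ` Y \<subseteq> p ` Tot"
  proof safe
    fix y assume "y \<in> Y"
    hence "0 + wedge x y \<in> Tot" unfolding Tot_def using Fun.subspace_0[OF S'(1)] by blast
    thus "p (wedge x y) \<in> p ` Tot" by simp
  qed
  have i6: "Fun.dim ((\<lambda>y. p (wedge x y)) ` Y) \<le> Fun.dim (p ` Tot)"
  proof (rule Fun.dim_mono_fin_dim[OF _ pTot])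
    obtain X where "finite X" "Tot \<subseteq> Fun.span X"
      using fin_dim_alt_endos[OF TotA] unfolding Fun.fin_dim_def by blast
    hence "finite (p ` X)" "p ` Tot \<subseteq> Fun.span (p ` X)" using p.span_image by blast+
    thus "Fun.fin_dim (p ` Tot)" unfolding Fun.fin_dim_def by blast
  qed
  have lpw: "Vector_Spaces.linear scale (\<lambda>c u z. scale c (u z)) (\<lambda>y. p (wedge x y))"
    unfolding Vector_Spaces.linear_iff
    by (simp add: wedge_add wedge_scale p.add p.scale vector_space_axioms Fun.vector_space_axioms)
  have i7: "dim Y = dim {y \<in> Y. p (wedge x y) = 0} + Fun.dim ((\<lambda>y. p (wedge x y)) ` Y)"
    by (rule rn[OF V F lpw sY fin_dim])
  \<comment> \<open>A wedge that already lies in \<open>S\<close> preserves \<open>U\<close>. Its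
    value at \<open>u0\<close> is a nonzero multiple of \<open>y\<close> minus a multiple of
    \<open>x\<close>, which forces \<open>y\<close> into \<open>U\<close>.\<close>
  have "{y \<in> Y. p (wedge x y) = 0} \<subseteq> U \<inter> perp {x}"
  proof
    fix y assume "y \<in> {y \<in> Y. p (wedge x y) = 0}"
    hence y: "y \<in> Y" "wedge x y \<in> S" using p(2) by blast+
    have "wedge x y u0 \<in> U" by (rule stableD(2)[OF U(1) y(2) u0(1)])
    hence "wedge x y u0 + scale (s y u0) x \<in> U" using subspace_add[OF sU _ subspace_scale[OF sU x(1)]] by blast
    hence "scale (s x u0) y \<in> U" by (simp add: wedge_def)
    hence "scale (inverse (s x u0)) (scale (s x u0) y) \<in> U" by (rule subspace_scale[OF sU])
    hence "y \<in> U" using u0(2) by simp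
    moreover have "y \<in> perp {x}" using y(1) pE1 unfolding Y_def by blast
    ultimately show "y \<in> U \<inter> perp {x}" by blast
  qed
  hence i8: "dim {y \<in> Y. p (wedge x y) = 0} \<le> dim (U \<inter> perp {x})" by (rule dim_mono_fin_dim[OF fin_dim])
  have i9: "dim U = Suc (dim (U \<inter> perp {x}))" by (rule dim_form_image(2)[OF sU u0])
  have i10: "dim (perp E) = Suc (dim Y)"
    unfolding Y_def pE1 by (rule dim_form_image(2)[OF subspace_perp _ u0(2)]) (use u0(1) U(3) in blast)
  have i11: "dim E + dim (perp E) = dim U + dim (perp U)" using dim_perp[OF sE] dim_perp[OF sU] by simp
  \<comment> \<open>\<open>Tot\<close> exceeds \<open>S\<close> by at least
    \<open>dim (perp E) - dim U\<close>, which is \<open>dim (perp U) - dim E\<close>, while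
    \<open>T\<close> has codimension at most \<open>dim U - dim E - 1\<close> in \<open>Tot\<close>
    and is no larger than \<open>S\<close>. Hence \<open>dim (perp U) < dim U\<close>.\<close>
  show False using i1 i2 i3 i4 i5 i6 i7 i8 i9 i10 i11 U(5) by linarith
qed

text \<open>\<open>U \<inter> perp U\<close> is stable, isotropic and contains \<open>E\<close>, so
  it equals \<open>E\<close>. Then \<open>U\<close> and \<open>perp U\<close> are both candidates
  for \<open>no_small_intermediate\<close>, and the smaller of the two collapses to
  \<open>E\<close>.\<close>

lemma irreducible_flag_if_maximal:
  assumes S: "optimal_trivial_spectrum S" and E: "stable S E" "E \<subseteq> perp E"
    and max: "\<And>N. stable S N \<Longrightarrow> N \<subseteq> perp N \<Longrightarrow> E \<subseteq> N \<Longrightarrow> N = E"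
  shows "irreducible_flag S E"
  unfolding irreducible_flag_def
proof (intro conjI allI impI)
  fix U assume U: "stable S U" "E \<subseteq> U" "U \<subseteq> perp E"
  note S' = optimal_trivial_spectrumD[OF S]
  have pp: "perp (perp U) = U" by (rule perp_perp[OF stableD(1)[OF U(1)]])
  have EpU: "E \<subseteq> perp U" using U(3) subset_perp_commute by blast
  have pUE: "perp U \<subseteq> perp E" by (rule perp_antimono[OF U(2)])
  note pU = stable_perp[OF S'(2) U(1)]
  have UE: "U \<inter> perp U = E"
  proof (rule max)
    show "stable S (U \<inter> perp U)" by (rule stable_Int[OF U(1) pU])
    have "perp U \<subseteq> perp (U \<inter> perp U)" by (rule perp_antimono) blast
    thus "U \<inter> perp U \<subseteq> perp (U \<inter> perp U)" by blast
    show "E \<subseteq> U \<inter> perp U" using U(2) EpU by blast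
  qed
  show "U = E \<or> U = perp E"
  proof (cases "dim U \<le> dim (perp U)")
    case True
    from no_small_intermediate[OF S E U UE this] show ?thesis by blast
  next
    case False
    hence "dim (perp U) \<le> dim (perp (perp U))" unfolding pp by simp
    moreover have "perp U \<inter> perp (perp U) = E" unfolding pp using UE by blast
    ultimately have "perp U = E" using no_small_intermediate[OF S E pU EpU pUE] by blast
    hence "U = perp E" using pp by simp
    thus ?thesis by blast
  qed
qed (rule E)+

lemma irreducible_flag_exists:
  assumes S: "optimal_trivial_spectrum S"
  shows "\<exists>E. irreducible_flag S E"
proof -
  note S' = optimal_trivial_spectrumD[OF S]
  define P where "P N \<longleftrightarrow> stable S N \<and> N \<subseteq> perp N" for N
  have "P {0}" unfolding P_def
  proof
    show "stable S {0}"
    proof (rule stableI)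
      show "u x \<in> {0}" if "u \<in> S" "x \<in> {0}" for u x
        using that alt_endos_simps(4)[of u] S'(2) by blast
    qed simp
  qed (simp add: perp_def)
  moreover have "\<forall>N. P N \<longrightarrow> dim N < Suc (dim UNIV)"
    by (simp add: less_Suc_eq_le dim_mono_fin_dim[OF fin_dim subset_UNIV])
  ultimately have "\<exists>E. P E \<and> (\<forall>N. P N \<longrightarrow> dim N \<le> dim E)"
    by (rule Lattices_Big.ex_has_greatest_nat)
  then obtain E where E: "P E" "\<And>N. P N \<Longrightarrow> dim N \<le> dim E" by metis
  have "N = E" if "stable S N" "N \<subseteq> perp N" "E \<subseteq> N" for N
  proof -
    have "dim N \<le> dim E" by (rule E(2)) (simp add: P_def that(1,2))
    moreover have "subspace E" by (rule stableD(1)[of S]) (use E(1) in \<open>simp add: P_def\<close>)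
    ultimately show ?thesis using subspace_eq_if_dim_le[OF fin_dim that(3)] by simp
  qed
  hence "irreducible_flag S E"
    by (intro irreducible_flag_if_maximal[OF S]) (use E(1) in \<open>simp_all add: P_def\<close>)
  thus ?thesis by (rule exI)
qed

section \<open>Irreducible flags are unique up to isometry\<close>

lemma irreducible_flagD:
  assumes "irreducible_flag S E"
  shows "stable S E" "E \<subseteq> perp E" "subspace E"
  using assms unfolding irreducible_flag_def stable_def by blast+

text \<open>\<open>(E' \<inter> perp E) + E\<close> is stable and lies between \<open>E\<close> and
  \<open>perp E\<close>. It is also isotropic, so if it were all of \<open>perp E\<close>, then
  \<open>perp E\<close> would already be \<open>E\<close>.\<close>

lemma irreducible_flag_Int_perp:
  assumes S: "S \<subseteq> alt_endos" and E: "irreducible_flag S E" and E': "stable S E'" "E' \<subseteq> perp E'"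
  shows "E' \<inter> perp E \<subseteq> E"
proof -
  note D = irreducible_flagD[OF E]
  define U where "U = {x + y | x y. x \<in> E' \<inter> perp E \<and> y \<in> E}"
  have "stable S U"
    unfolding U_def by (rule stable_sum[OF S stable_Int[OF E'(1) stable_perp[OF S D(1)]] D(1)])
  moreover have EU: "E \<subseteq> U"
  proof
    fix e assume "e \<in> E"
    moreover have "0 \<in> E' \<inter> perp E" using subspace_0 stableD(1)[OF E'(1)] subspace_perp by blast
    ultimately have "0 + e \<in> U" unfolding U_def by blast
    thus "e \<in> U" by simp
  qed
  moreover have IU: "E' \<inter> perp E \<subseteq> U"
  proof
    fix e assume "e \<in> E' \<inter> perp E"
    hence "e + 0 \<in> U" using subspace_0[OF D(3)] unfolding U_def by blast
    thus "e \<in> U" by simp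
  qed
  moreover have UE: "U \<subseteq> perp E"
    unfolding U_def using subspace_add[OF subspace_perp, of _ E] D(2) by blast
  ultimately consider "U = E" | "U = perp E" using E unfolding irreducible_flag_def by blast
  thus ?thesis
  proof cases
    case 1 thus ?thesis using IU by blast
  next
    case 2
    have "U \<subseteq> perp U"
    proof
      fix z assume "z \<in> U"
      then obtain x y where z: "z = x + y" "x \<in> E'" "x \<in> perp E" "y \<in> E" unfolding U_def by blast
      have "s w z = 0" if wU: "w \<in> U" for w
      proof -
        obtain x' y' where w: "w = x' + y'" "x' \<in> E'" "x' \<in> perp E" "y' \<in> E"
          using wU unfolding U_def by blast
        have "s x' x = 0" using w(2) z(2) E'(2) unfolding perp_def by blast
        moreover have "s y x' = 0" using z(4) w(3) unfolding perp_def by blast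
        moreover have "s y' x = 0" using w(4) z(3) unfolding perp_def by blast
        moreover have "s y' y = 0" using w(4) z(4) D(2) unfolding perp_def by blast
        ultimately show ?thesis using form_eq_0_commute[of y x'] by (simp add: w(1) z(1) form_simps)
      qed
      thus "z \<in> perp U" unfolding perp_def by blast
    qed
    hence "perp E \<subseteq> perp (perp E)" using 2 by simp
    hence "perp E \<subseteq> E" using perp_perp[OF D(3)] by simp
    thus ?thesis by blast
  qed
qed

text \<open>Such a wedge vanishes on \<open>E\<close> and maps \<open>perp E\<close> into the line
  of \<open>x\<close>, so both diagonal actions agree with those of the zero element of
  \<open>S\<close>.\<close>

lemma wedge_mem:
  assumes S: "optimal_trivial_spectrum S" and E: "stable S E" "E \<subseteq> perp E"
    and x: "x \<in> E" and y: "y \<in> perp E"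
  shows "wedge x y \<in> S"
proof (rule optimal_mem[OF S E wedge_alt])
  show "0 \<in> S" "0 \<in> S" by (rule Fun.subspace_0[OF optimal_trivial_spectrumD(1)[OF S]])+
  have 0: "wedge x y z = 0 z" if "z \<in> E" for z
  proof -
    have "s x z = 0" using x that E(2) unfolding perp_def by blast
    moreover have "s y z = 0" using y that form_eq_0_commute[of y z] unfolding perp_def by blast
    ultimately show ?thesis by (simp add: wedge_def)
  qed
  show "wedge x y z = 0 z" if "z \<in> E" for z by (rule 0[OF that])
  show "wedge x y ` E \<subseteq> E" using 0 subspace_0[OF stableD(1)[OF E(1)]] by auto
  show "wedge x y z - 0 z \<in> E" if "z \<in> perp E" for z
  proof -
    have "s x z = 0" using x that unfolding perp_def by blast
    moreover have "0 - scale (s y z) x \<in> E"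
      by (intro subspace_diff subspace_scale subspace_0 stableD(1)[OF E(1)] x)
    ultimately show ?thesis by (simp add: wedge_def)
  qed
qed

text \<open>If \<open>E\<close> and \<open>E'\<close> were orthogonal,
  \<open>irreducible_flag_Int_perp\<close> would apply in both directions and give
  \<open>E = E'\<close>. A nonzero value of the form is then rescaled to 1.\<close>

lemma irreducible_flag_eq_or_paired:
  assumes S: "S \<subseteq> alt_endos" and E: "irreducible_flag S E" "irreducible_flag S E'"
    and ne: "E \<noteq> E'"
  shows "\<exists>x\<in>E. \<exists>z\<in>E'. s x z = 1"
proof -
  note D = irreducible_flagD[OF E(1)] and D' = irreducible_flagD[OF E(2)]
  have "\<not> E \<subseteq> perp E'"
  proof
    assume sub: "E \<subseteq> perp E'"
    hence "E \<subseteq> E'" using irreducible_flag_Int_perp[OF S E(2) D(1,2)] by blast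
    moreover have "E' \<subseteq> perp E" using sub subset_perp_commute by blast
    hence "E' \<subseteq> E" using irreducible_flag_Int_perp[OF S E(1) D'(1,2)] by blast
    ultimately show False using ne by blast
  qed
  then obtain x z where x: "x \<in> E" and z: "z \<in> E'" "s z x \<noteq> 0" unfolding perp_def by blast
  have nz: "s x z \<noteq> 0" using z(2) form_eq_0_commute[of x z] by blast
  have "scale (inverse (s x z)) z \<in> E'" by (rule subspace_scale[OF D'(3) z(1)])
  moreover have "s x (scale (inverse (s x z)) z) = 1" using nz by (simp add: form_simps)
  ultimately show ?thesis using x by blast
qed

text \<open>The vector in question is \<open>wedge x y z\<close>, and the wedge belongs to
  \<open>S\<close>, which preserves \<open>E'\<close>. As a consequence \<open>perp E\<close> lies
  in \<open>E\<close>, and \<open>E \<inter> E'\<close> together with \<open>x\<close> spans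
  \<open>E\<close>.\<close>

lemma paired_flags_decompose:
  assumes S: "optimal_trivial_spectrum S" and E: "irreducible_flag S E" "irreducible_flag S E'"
    and x: "x \<in> E" and z: "z \<in> E'" and xz: "s x z = 1" and y: "y \<in> perp E"
  shows "y - scale (s y z) x \<in> E \<inter> E'"
proof -
  note D = irreducible_flagD[OF E(1)] and D' = irreducible_flagD[OF E(2)]
  have "wedge x y \<in> S" by (rule wedge_mem[OF S D(1,2) x y])
  hence "wedge x y z \<in> E'" using stableD(2)[OF D'(1) _ z] by blast
  hence 1: "y - scale (s y z) x \<in> E'" using xz by (simp add: wedge_def)
  moreover have "x \<in> perp E" using x D(2) by blast
  hence "y - scale (s y z) x \<in> perp E" by (intro subspace_diff subspace_scale subspace_perp y)
  ultimately show ?thesis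
    using irreducible_flag_Int_perp[OF optimal_trivial_spectrumD(2)[OF S] E(1) D'(1,2)] by blast
qed

section \<open>Transvections normalising an optimal space\<close>

definition transvection :: "'a \<Rightarrow> 'b \<Rightarrow> 'b \<Rightarrow> 'b" where
  "transvection c w v = v + scale (c * s v w) w"

lemma transvection_inverse: "transvection (- c) w (transvection c w v) = v"
  by (simp add: transvection_def form_simps)

lemma transvection_isometry: "s (transvection c w v) (transvection c w v') = s v v'"
  using form_skew[of w v'] by (simp add: transvection_def form_simps)

lemma transvection_simps:
  "transvection c w (v + v') = transvection c w v + transvection c w v'"
  "transvection c w (scale d v) = scale d (transvection c w v)"
  by (simp_all add: transvection_def form_simps scale_right_distrib scale_left_distrib
    distrib_left mult.left_commute mult.commute)

text \<open>\<open>perp (E \<inter> E')\<close> is \<open>E \<inter> E'\<close> plus the plane of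
  \<open>x\<close> and \<open>z\<close>. Modulo \<open>E \<inter> E'\<close>, \<open>u\<close> keeps
  both lines of that plane, with the same eigenvalue by self-adjointness. A nonzero eigenvalue
  \<open>a\<close> is impossible, because \<open>u\<close> divided by \<open>a\<close> belongs to
  \<open>S\<close> and would fix \<open>x\<close> modulo \<open>E \<inter> E'\<close>.\<close>

lemma paired_flags_map_perp_Int:
  assumes S: "optimal_trivial_spectrum S" and E: "irreducible_flag S E" "irreducible_flag S E'"
    and x: "x \<in> E" and z: "z \<in> E'" and xz: "s x z = 1"
    and u: "u \<in> S" and y: "y \<in> perp (E \<inter> E')"
  shows "u y \<in> E \<inter> E'"
proof -
  note D = irreducible_flagD[OF E(1)] and D' = irreducible_flagD[OF E(2)]
  note S' = optimal_trivial_spectrumD[OF S]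
  let ?I = "E \<inter> E'"
  have sI: "stable S ?I" by (rule stable_Int[OF D(1) D'(1)])
  note subI = stableD(1)[OF sI]
  have ualt: "u \<in> alt_endos" using u S'(2) by blast
  have dec: "v - scale (s v z) x \<in> ?I" if "v \<in> perp E" for v
    by (rule paired_flags_decompose[OF S E x z xz that])
  \<comment> \<open>The pair \<open>z\<close>, \<open>- x\<close> is normalised like
    \<open>x\<close>, \<open>z\<close>, so the decomposition can be reused with \<open>E\<close> and
    \<open>E'\<close> exchanged.\<close>
  have zx: "s z (- x) = 1" using xz form_skew[of z "- x"] form_scale_left[of "-1" x z] by simp
  have mx: "- x \<in> E" using subspace_neg[OF D(3) x] .
  have dec': "v - scale (s v (- x)) z \<in> ?I" if "v \<in> perp E'" for v
    using paired_flags_decompose[OF S E(2,1) z mx zx that] by blast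
  have Iz: "s i z = 0" if "i \<in> ?I" for i using that D'(2) z unfolding perp_def by blast
  have ux: "u x \<in> ?I"
  proof -
    have "u x \<in> perp E" using stableD(2)[OF D(1) u x] D(2) by blast
    from dec[OF this] have d: "u x - scale (s (u x) z) x \<in> ?I" .
    have "s (u x) z = 0"
    proof (rule ccontr)
      define a where "a = s (u x) z"
      assume "s (u x) z \<noteq> 0"
      hence a: "a \<noteq> 0" by (simp add: a_def)
      define v where "v y = scale (inverse a) (u y)" for y
      have v: "v \<in> S" using Fun.subspace_scale[OF S'(1) u, of "inverse a"] unfolding v_def .
      have "scale (- inverse a) (u x - scale a x) \<in> ?I"
        using d unfolding a_def by (rule subspace_scale[OF subI])
      moreover have "scale (- inverse a) (u x - scale a x) = x - v x"
        using a by (simp add: v_def scale_right_diff_distrib)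
      ultimately have "x - v x \<in> ?I" by (simp only:)
      moreover have "v ` ?I \<subseteq> ?I" using sI v unfolding stable_def by blast
      moreover have "v \<in> alt_endos" using v S'(2) by blast
      ultimately have "x \<in> ?I" using invariant_id_minus[OF _ S'(3)[OF v] subI] by blast
      thus False using Iz xz by simp
    qed
    thus ?thesis using d by simp
  qed
  have uz: "u z \<in> ?I"
  proof -
    have "u z \<in> perp E'" using stableD(2)[OF D'(1) u z] D'(2) by blast
    from dec'[OF this] have d: "u z - scale (s (u z) (- x)) z \<in> ?I" .
    have "s (- x) (u z) = s (u (- x)) z" by (rule alt_endos_selfadjoint[OF ualt])
    also have "u (- x) = - u x"
      using alt_endos_simps(3)[OF ualt, of 0 x] alt_endos_simps(4)[OF ualt] by simp
    also have "s (- u x) z = 0" using Iz[OF subspace_neg[OF subI ux]] .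
    finally have "s (u z) (- x) = 0" using form_eq_0_commute[of "u z" "- x"] by blast
    thus ?thesis using d by simp
  qed
  \<comment> \<open>This removes from \<open>y\<close> its component in the hyperbolic plane of
    \<open>x\<close> and \<open>z\<close>: both \<open>s x y'\<close> and \<open>s y' z\<close>
    vanish. As \<open>E\<close> is spanned by \<open>E \<inter> E'\<close> and \<open>x\<close>,
    this places \<open>y'\<close> in \<open>perp E\<close>.\<close>
  define y' where "y' = y - scale (s y z) x - scale (s x y) z"
  have "s e y' = 0" if e: "e \<in> E" for e
  proof -
    define i where "i = e - scale (s e z) x"
    have i: "i \<in> ?I" unfolding i_def by (rule dec) (use e D(2) in blast)
    have "s i y = 0" using y i unfolding perp_def by blast
    moreover have "s i x = 0" using i x D(2) unfolding perp_def by blast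
    moreover have "s i z = 0" by (rule Iz[OF i])
    ultimately have iy: "s i y' = 0" unfolding y'_def by (simp add: form_simps)
    have "s x y' = 0" unfolding y'_def using xz by (simp add: form_simps)
    moreover have "e = i + scale (s e z) x" unfolding i_def by simp
    hence "s e y' = s (i + scale (s e z) x) y'" by (rule arg_cong)
    hence "s e y' = s i y' + s e z * s x y'" by (simp only: form_add_left form_scale_left)
    ultimately show ?thesis using iy by simp
  qed
  hence "y' \<in> perp E" unfolding perp_def by blast
  from dec[OF this] have "y' - scale (s y' z) x \<in> ?I" .
  moreover have "s y' z = 0" unfolding y'_def using xz by (simp add: form_simps)
  ultimately have y': "y' \<in> ?I" by simp
  have "y = y' + scale (s y z) x + scale (s x y) z" unfolding y'_def by simp
  hence "u y = u (y' + scale (s y z) x + scale (s x y) z)" by (rule arg_cong)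
  also have "\<dots> = u y' + scale (s y z) (u x) + scale (s x y) (u z)"
    by (simp only: alt_endos_simps(1,2)[OF ualt])
  also have "\<dots> \<in> ?I"
    by (intro subspace_add[OF subI] subspace_scale[OF subI] ux uz stableD(2)[OF sI u y'])
  finally show ?thesis .
qed

text \<open>Because \<open>w\<close> is orthogonal to \<open>I\<close>, the transvection fixes
  \<open>I\<close> pointwise and preserves \<open>perp I\<close>. The conjugate thus agrees with
  \<open>u\<close> on \<open>I\<close>, and on \<open>perp I\<close> both have values in
  \<open>I\<close>; \<open>optimal_mem\<close> for \<open>I\<close> finishes.\<close>

lemma transvection_conj_mem:
  assumes S: "optimal_trivial_spectrum S" and I: "stable S I" "I \<subseteq> perp I"
    and map: "\<And>u y. u \<in> S \<Longrightarrow> y \<in> perp I \<Longrightarrow> u y \<in> I"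
    and w: "w \<in> perp I" and u: "u \<in> S"
  shows "(\<lambda>v. transvection c w (u (transvection (- c) w v))) \<in> S"
proof -
  have ualt: "u \<in> alt_endos" using u optimal_trivial_spectrumD(2)[OF S] by blast
  note subI = stableD(1)[OF I(1)]
  have fix_I: "transvection d w i = i" if "i \<in> I" for d i
  proof -
    have "s i w = 0" using that w unfolding perp_def by blast
    thus ?thesis by (simp add: transvection_def)
  qed
  have pI: "transvection d w y \<in> perp I" if "y \<in> perp I" for d y
    unfolding transvection_def by (intro subspace_add subspace_scale subspace_perp w that)
  let ?u = "\<lambda>v. transvection c w (u (transvection (- c) w v))"
  have uI: "?u y = u (transvection (- c) w y)" if "y \<in> perp I" for y
    using fix_I[OF map[OF u pI[OF that]]] .
  have uI': "?u i = u i" if "i \<in> I" for i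
    using uI[of i] fix_I[OF that] that I(2) by auto
  show ?thesis
  proof (rule optimal_mem[OF S I _ _ u uI' u])
    show "?u \<in> alt_endos"
    proof (rule alt_endosI)
      fix v
      let ?v = "transvection (- c) w v"
      have v: "transvection c w ?v = v" using transvection_inverse[of "- c" w v] by simp
      have "s v (?u v) = s (transvection c w ?v) (?u v)" unfolding v ..
      also have "\<dots> = s ?v (u ?v)" by (rule transvection_isometry)
      also have "\<dots> = 0" using ualt by (simp add: alt_endos_def)
      finally show "s v (?u v) = 0" .
    qed (simp_all add: transvection_simps alt_endos_simps(1,2)[OF ualt])
    show "?u ` I \<subseteq> I"
    proof safe
      fix i assume i: "i \<in> I"
      show "?u i \<in> I" unfolding uI'[OF i] by (rule stableD(2)[OF I(1) u i])
    qed
    show "?u y - u y \<in> I" if "y \<in> perp I" for y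
      unfolding uI[OF that] by (intro subspace_diff[OF subI] map u pI that)
  qed
qed

text \<open>The inverse \<open>g\<close> is part of the conclusion, and conjugation is stated both
  ways, so that block images of \<open>S\<close> can later be compared as equal sets and not merely
  by inclusion.\<close>

lemma irreducible_flags_isometric:
  assumes S: "optimal_trivial_spectrum S" and E: "irreducible_flag S E" "irreducible_flag S E'"
  shows "\<exists>f g. Vector_Spaces.linear scale scale f \<and> (\<forall>v. f (g v) = v) \<and> (\<forall>v. g (f v) = v) \<and>
    (\<forall>v w. s (f v) (f w) = s v w) \<and> f ` E = E' \<and>
    (\<forall>u\<in>S. (\<lambda>v. f (u (g v))) \<in> S \<and> (\<lambda>v. g (u (f v))) \<in> S)"
proof (cases "E = E'")
  case True
  thus ?thesis by (intro exI[of _ "\<lambda>v. v"]) (auto simp: linear_ident)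
next
  case False
  note D = irreducible_flagD[OF E(1)] and D' = irreducible_flagD[OF E(2)]
  obtain x z where x: "x \<in> E" and z: "z \<in> E'" and xz: "s x z = 1"
    using irreducible_flag_eq_or_paired[OF optimal_trivial_spectrumD(2)[OF S] E False] by blast
  \<comment> \<open>Since \<open>s x (x - z) = - 1\<close>, the transvection along
    \<open>x - z\<close> sends \<open>x\<close> to \<open>x - (x - z) = z\<close>. It also fixes
    \<open>E \<inter> E'\<close>, and therefore carries \<open>E\<close> to
    \<open>E'\<close>.\<close>
  define w where "w = x - z"
  let ?I = "E \<inter> E'"
  let ?f = "transvection 1 w" and ?g = "transvection (- 1) w"
  have sI: "stable S ?I" by (rule stable_Int[OF D(1) D'(1)])
  have "perp E \<subseteq> perp ?I" "perp E' \<subseteq> perp ?I" by (rule perp_antimono, blast)+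
  hence Iiso: "?I \<subseteq> perp ?I" and xI: "x \<in> perp ?I" and zI: "z \<in> perp ?I"
    using D(2) D'(2) x z by blast+
  have wI: "w \<in> perp ?I" unfolding w_def by (rule subspace_diff[OF subspace_perp xI zI])
  have fix_I: "transvection d w i = i" if "i \<in> ?I" for d i
  proof -
    have "s i w = 0" using that wI unfolding perp_def by blast
    thus ?thesis by (simp add: transvection_def)
  qed
  have fx: "?f x = z" unfolding transvection_def w_def using xz by (simp add: form_simps)
  have zx: "s z x = - 1" using xz form_skew[of z x] by simp
  have gz: "?g z = x" unfolding transvection_def w_def using zx by (simp add: form_simps)
  have fE: "?f ` E \<subseteq> E'"
  proof safe
    fix e assume e: "e \<in> E"
    define i where "i = e - scale (s e z) x"
    have i: "i \<in> ?I" unfolding i_def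
      by (rule paired_flags_decompose[OF S E x z xz]) (use e D(2) in blast)
    have "e = i + scale (s e z) x" unfolding i_def by simp
    hence "?f e = ?f (i + scale (s e z) x)" by (rule arg_cong)
    also have "\<dots> = i + scale (s e z) z" by (simp only: transvection_simps fix_I[OF i] fx)
    also have "\<dots> \<in> E'" using i by (intro subspace_add subspace_scale D'(3) z) blast
    finally show "?f e \<in> E'" .
  qed
  have gE: "?g ` E' \<subseteq> E"
  proof safe
    fix e assume e: "e \<in> E'"
    have zmx: "s z (- x) = 1" using zx form_scale_right[of z "-1" x] by simp
    define i where "i = e - scale (s e (- x)) z"
    have i: "i \<in> E' \<inter> E" unfolding i_def
      by (rule paired_flags_decompose[OF S E(2,1) z subspace_neg[OF D(3) x] zmx]) (use e D'(2) in blast)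
    hence i': "i \<in> ?I" by blast
    have "e = i + scale (s e (- x)) z" unfolding i_def by simp
    hence "?g e = ?g (i + scale (s e (- x)) z)" by (rule arg_cong)
    also have "\<dots> = i + scale (s e (- x)) x" by (simp only: transvection_simps fix_I[OF i'] gz)
    also have "\<dots> \<in> E" using i by (intro subspace_add subspace_scale D(3) x) blast
    finally show "?g e \<in> E" .
  qed
  have inv: "?f (?g v) = v" "?g (?f v) = v" for v
    using transvection_inverse[of "- 1" w v] transvection_inverse[of 1 w v] by simp_all
  have "f `E = E'" if "f = ?f" for f
  proof -
    have "e \<in> ?f ` E" if "e \<in> E'" for e
    proof -
      have "?g e \<in> E" using gE that by blast
      hence "?f (?g e) \<in> ?f ` E" by blast
      thus ?thesis unfolding inv .
    qed
    thus ?thesis using fE that by blast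
  qed
  moreover have map: "u y \<in> ?I" if "u \<in> S" "y \<in> perp ?I" for u y
    by (rule paired_flags_map_perp_Int[OF S E x z xz that])
  have "(\<lambda>v. ?f (u (?g v))) \<in> S \<and> (\<lambda>v. ?g (u (?f v))) \<in> S" if u: "u \<in> S" for u
  proof -
    have "(\<lambda>v. transvection c w (u (transvection (- c) w v))) \<in> S" for c
      by (rule transvection_conj_mem[OF S sI Iiso _ wI u]) (rule map)
    from this[of 1] this[of "- 1"] show ?thesis by simp
  qed
  moreover have "Vector_Spaces.linear scale scale ?f"
    by (rule linear_endoI) (simp_all add: transvection_simps)
  ultimately show ?thesis
    by (intro exI[of _ ?f] exI[of _ ?g]) (simp add: inv transvection_isometry)
qed

section \<open>Coordinates and diagonal blocks\<close>


definition coord :: "'b list \<Rightarrow> 'b \<Rightarrow> nat \<Rightarrow> 'a" where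
  "coord bs v i = representation (set bs) v (bs ! i)"

lemma
  assumes bs: "ordered_basis bs"
  shows coord_add: "coord bs (x + y) i = coord bs x i + coord bs y i"
    and coord_scale: "coord bs (scale c x) i = c * coord bs x i"
    and coord_zero: "coord bs 0 i = 0"
    and coord_diff: "coord bs (x - y) i = coord bs x i - coord bs y i"
proof -
  have *: "independent (set bs)" "z \<in> span (set bs)" for z using bs by (auto simp: ordered_basis_def)
  show "coord bs (x + y) i = coord bs x i + coord bs y i" "coord bs (scale c x) i = c * coord bs x i"
    "coord bs 0 i = 0" "coord bs (x - y) i = coord bs x i - coord bs y i"
    unfolding coord_def by (simp_all add: representation_add representation_scale
      representation_zero representation_diff *)
qed

lemma coord_sum:
  assumes bs: "ordered_basis bs"
  shows "coord bs (sum f A) i = (\<Sum>j\<in>A. coord bs (f j) i)"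
  by (induction A rule: infinite_finite_induct) (simp_all add: coord_add[OF bs] coord_zero[OF bs])

lemma coord_expand:
  assumes bs: "ordered_basis bs"
  shows "(\<Sum>i<length bs. scale (coord bs v i) (bs ! i)) = v"
proof -
  have "(\<Sum>b\<in>set bs. scale (representation (set bs) v b) b) = v"
    by (rule sum_representation_eq) (use bs in \<open>auto simp: ordered_basis_def\<close>)
  moreover have "bij_betw ((!) bs) {..<length bs} (set bs)"
    using bs by (intro bij_betw_nth) (auto simp: ordered_basis_def)
  ultimately show ?thesis unfolding coord_def
    by (simp add: sum.reindex_bij_betw[of "(!) bs" "{..<length bs}" "set bs"
          "\<lambda>b. scale (representation (set bs) v b) b"])
qed

lemma coord_basis:
  assumes bs: "ordered_basis bs" and ij: "i < length bs" "j < length bs"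
  shows "coord bs (bs ! j) i = (if i = j then 1 else 0)"
  unfolding coord_def using assms
  by (subst representation_basis) (auto simp: ordered_basis_def nth_eq_iff_index_eq)

lemma coord_eqI:
  assumes bs: "ordered_basis bs" and eq: "\<And>i. i < length bs \<Longrightarrow> coord bs v i = coord bs w i"
  shows "v = w"
proof -
  have "v = (\<Sum>i<length bs. scale (coord bs v i) (bs ! i))" by (rule coord_expand[OF bs, symmetric])
  also have "\<dots> = (\<Sum>i<length bs. scale (coord bs w i) (bs ! i))"
    by (intro sum.cong refl) (simp add: eq)
  also have "\<dots> = w" by (rule coord_expand[OF bs])
  finally show ?thesis .
qed

lemma coord_linear_image:
  assumes bs: "ordered_basis bs" and bs': "ordered_basis bs'"
    and u: "Vector_Spaces.linear scale scale u"
  shows "coord bs' (u z) i = (\<Sum>j<length bs. coord bs z j * coord bs' (u (bs ! j)) i)"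
proof -
  interpret u: Vector_Spaces.linear scale scale u by (rule u)
  have "u z = u (\<Sum>j<length bs. scale (coord bs z j) (bs ! j))"
    by (rule arg_cong[OF coord_expand[OF bs, symmetric]])
  also have "\<dots> = (\<Sum>j<length bs. scale (coord bs z j) (u (bs ! j)))"
    by (simp only: u.sum u.scale)
  finally show ?thesis by (simp only: coord_sum[OF bs'] coord_scale[OF bs'])
qed

lemma linear_with_coords_exists:
  assumes bs: "ordered_basis bs"
  shows "\<exists>u. Vector_Spaces.linear scale scale u \<and>
    (\<forall>i<length bs. \<forall>j<length bs. coord bs (u (bs ! j)) i = f i j)"
proof -
  define u where "u z = (\<Sum>j<length bs. scale (coord bs z j) (\<Sum>i<length bs. scale (f i j) (bs ! i)))" for z
  have "Vector_Spaces.linear scale scale u"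
    by (rule linear_endoI)
       (simp_all only: u_def coord_add[OF bs] coord_scale[OF bs] scale_left_distrib sum.distrib
          scale_sum_right[symmetric] scale_scale[symmetric])
  moreover have "coord bs (u (bs ! j)) i = f i j" if "i < length bs" "j < length bs" for i j
  proof -
    have "coord bs (u (bs ! j)) i =
      (\<Sum>j'<length bs. coord bs (bs ! j) j' * (\<Sum>i'<length bs. f i' j' * coord bs (bs ! i') i))"
      by (simp only: u_def coord_sum[OF bs] coord_scale[OF bs])
    also have "\<dots> = (\<Sum>j'<length bs. (if j' = j then f i j' else 0))"
    proof (intro sum.cong refl)
      fix j' assume j': "j' \<in> {..<length bs}"
      have "(\<Sum>i'<length bs. f i' j' * coord bs (bs ! i') i) = (\<Sum>i'<length bs. if i' = i then f i' j' else 0)"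
        by (intro sum.cong refl) (use that in \<open>simp add: coord_basis[OF bs]\<close>)
      also have "\<dots> = f i j'" using that by simp
      finally have e: "(\<Sum>i'<length bs. f i' j' * coord bs (bs ! i') i) = f i j'" .
      show "coord bs (bs ! j) j' * (\<Sum>i'<length bs. f i' j' * coord bs (bs ! i') i) =
        (if j' = j then f i j' else 0)"
        unfolding e using that j' by (simp add: coord_basis[OF bs])
    qed
    also have "\<dots> = f i j" using that by simp
    finally show ?thesis .
  qed
  ultimately show ?thesis by blast
qed

section \<open>The coordinate flag of an ordered basis\<close>

definition seg :: "'b list \<Rightarrow> nat \<Rightarrow> 'b set" where
  "seg bs j = {v. \<forall>i<length bs. j \<le> i \<longrightarrow> coord bs v i = 0}"

lemma segD: "v \<in> seg bs j \<Longrightarrow> i < length bs \<Longrightarrow> j \<le> i \<Longrightarrow> coord bs v i = 0"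
  by (simp add: seg_def)

lemma subspace_seg: "ordered_basis bs \<Longrightarrow> subspace (seg bs j)"
  by (rule subspaceI) (simp_all add: seg_def coord_add coord_scale coord_zero)

lemma seg_0: "ordered_basis bs \<Longrightarrow> seg bs 0 = {0}"
  by (auto simp: seg_def coord_zero intro: coord_eqI[of bs])

lemma seg_length: "seg bs (length bs) = UNIV"
  by (auto simp: seg_def)

lemma seg_mono: "i \<le> j \<Longrightarrow> seg bs i \<subseteq> seg bs j"
  by (auto simp: seg_def)

lemma nth_mem_seg:
  assumes "ordered_basis bs" "i < j" "i < length bs"
  shows "bs ! i \<in> seg bs j"
  using assms by (auto simp: seg_def coord_basis)

lemma seg_eq_span:
  assumes bs: "ordered_basis bs" and j: "j \<le> length bs"
  shows "seg bs j = span (set (take j bs))"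
proof
  show "span (set (take j bs)) \<subseteq> seg bs j"
  proof (rule span_minimal[OF _ subspace_seg[OF bs]], rule subsetI)
    fix x assume "x \<in> set (take j bs)"
    then obtain i where "i < j" "i < length bs" "x = bs ! i" by (auto simp: in_set_conv_nth)
    thus "x \<in> seg bs j" using nth_mem_seg[OF bs] by simp
  qed
  show "seg bs j \<subseteq> span (set (take j bs))"
  proof
    fix v assume v: "v \<in> seg bs j"
    have "(\<Sum>i<length bs. scale (coord bs v i) (bs ! i)) \<in> span (set (take j bs))"
    proof (rule span_sum)
      fix i assume i: "i \<in> {..<length bs}"
      show "scale (coord bs v i) (bs ! i) \<in> span (set (take j bs))"
      proof (cases "i < j")
        case True
        hence "bs ! i \<in> set (take j bs)" using i nth_mem[of i "take j bs"] by simp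
        thus ?thesis by (intro span_scale span_base)
      next
        case False
        thus ?thesis using segD[OF v, of i] i span_zero by simp
      qed
    qed
    thus "v \<in> span (set (take j bs))" by (simp only: coord_expand[OF bs])
  qed
qed

lemma dim_seg:
  assumes bs: "ordered_basis bs" and j: "j \<le> length bs"
  shows "dim (seg bs j) = j"
proof -
  have "independent (set (take j bs))"
    by (rule independent_mono[OF _ set_take_subset]) (use bs in \<open>simp add: ordered_basis_def\<close>)
  hence "dim (seg bs j) = card (set (take j bs))"
    unfolding seg_eq_span[OF assms] by (rule dim_span_eq_card_independent)
  also have "\<dots> = length (take j bs)"
    using bs by (intro distinct_card) (simp add: ordered_basis_def)
  finally show ?thesis using j by simp
qed

lemma linear_image_seg:
  assumes bs: "ordered_basis bs" and j: "j \<le> length bs"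
    and u: "Vector_Spaces.linear scale scale u" and V: "subspace V" "\<And>i. i < j \<Longrightarrow> u (bs ! i) \<in> V"
  shows "u ` seg bs j \<subseteq> V"
proof -
  interpret u: Vector_Spaces.linear scale scale u by (rule u)
  have "set (take j bs) \<subseteq> u -` V"
  proof
    fix x assume "x \<in> set (take j bs)"
    then obtain i where "i < j" "x = bs ! i" by (auto simp: in_set_conv_nth)
    thus "x \<in> u -` V" using V(2) by simp
  qed
  hence "span (set (take j bs)) \<subseteq> u -` V"
    by (rule span_minimal[OF _ u.subspace_vimage[OF V(1)]])
  thus ?thesis unfolding seg_eq_span[OF bs j] by auto
qed

section \<open>Diagonal blocks as matrices of maps on subquotients\<close>

definition vc :: "'b list \<Rightarrow> nat \<Rightarrow> nat \<Rightarrow> 'b \<Rightarrow> 'a vec" where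
  "vc bs a m z = vec m (\<lambda>i. coord bs z (a + i))"

text \<open>For \<open>u\<close> compatible with the coordinate flags this is the matrix of the
  induced map from \<open>seg bs (a + m)\<close> modulo \<open>seg bs a\<close> to the corresponding
  subquotient for \<open>bs'\<close>. With \<open>a = 0\<close> and \<open>a = r\<close> it gives
  the actions on \<open>E\<close> and on \<open>perp E / E\<close>; allowing two bases makes base
  changes blocks as well.\<close>

definition blk :: "'b list \<Rightarrow> 'b list \<Rightarrow> nat \<Rightarrow> nat \<Rightarrow> ('b \<Rightarrow> 'b) \<Rightarrow> 'a mat" where
  "blk bs' bs a m u = mat m m (\<lambda>(i, j). coord bs' (u (bs ! (a + j))) (a + i))"

lemma vc_carrier [simp]: "vc bs a m z \<in> carrier_vec m"
  by (simp add: vc_def)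

lemma blk_carrier [simp]: "blk bs' bs a m u \<in> carrier_mat m m"
  by (simp add: blk_def)

lemma
  assumes bs: "ordered_basis bs"
  shows vc_add: "vc bs a m (x + y) = vc bs a m x + vc bs a m y"
    and vc_scale: "vc bs a m (scale c x) = c \<cdot>\<^sub>v vc bs a m x"
    and vc_diff: "vc bs a m (x - y) = vc bs a m x - vc bs a m y"
  by (rule eq_vecI; simp add: vc_def coord_add[OF bs] coord_scale[OF bs] coord_diff[OF bs])+

lemma vc_eq_0_iff:
  assumes bs: "ordered_basis bs" and l: "a + m \<le> length bs" and z: "z \<in> seg bs (a + m)"
  shows "vc bs a m z = 0\<^sub>v m \<longleftrightarrow> z \<in> seg bs a"
proof
  assume v: "vc bs a m z = 0\<^sub>v m"
  show "z \<in> seg bs a" unfolding seg_def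
  proof safe
    fix i assume i: "i < length bs" "a \<le> i"
    show "coord bs z i = 0"
    proof (cases "i < a + m")
      case True
      obtain t where t: "i = a + t" using i(2) le_Suc_ex by blast
      have "vc bs a m z $ t = 0" unfolding v using True t by simp
      thus ?thesis using True t by (simp add: vc_def)
    qed (use z i segD in auto)
  qed
next
  assume "z \<in> seg bs a"
  thus "vc bs a m z = 0\<^sub>v m" using l by (intro eq_vecI) (auto simp: vc_def segD)
qed

lemma vc_surj:
  assumes bs: "ordered_basis bs" and l: "a + m \<le> length bs" and v: "v \<in> carrier_vec m"
  shows "\<exists>z\<in>seg bs (a + m). vc bs a m z = v"
proof -
  let ?z = "\<Sum>j<m. scale (v $ j) (bs ! (a + j))"
  have "?z \<in> seg bs (a + m)"
    by (intro subspace_sum subspace_scale subspace_seg bs nth_mem_seg) (use l in auto)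
  moreover have "vc bs a m ?z = v"
  proof (rule eq_vecI)
    fix i assume i: "i < dim_vec v"
    have "coord bs ?z (a + i) = (\<Sum>j<m. v $ j * coord bs (bs ! (a + j)) (a + i))"
      by (simp only: coord_sum[OF bs] coord_scale[OF bs])
    also have "\<dots> = (\<Sum>j<m. if j = i then v $ j else 0)"
      by (intro sum.cong refl) (use i v l in \<open>simp add: coord_basis[OF bs]\<close>)
    finally show "vc bs a m ?z $ i = v $ i" using i v by (simp add: vc_def)
  qed (use v in \<open>simp add: vc_def\<close>)
  ultimately show ?thesis by blast
qed

text \<open>In the full coordinate sum for \<open>u z\<close>, indices below \<open>a\<close> drop
  out because \<open>u\<close> maps \<open>seg bs a\<close> into \<open>seg bs' a\<close>, and
  indices from \<open>a + m\<close> on drop out because \<open>z\<close> has no such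
  coordinates.\<close>

lemma vc_apply:
  assumes bs: "ordered_basis bs" and bs': "ordered_basis bs'"
    and l: "a + m \<le> length bs" "length bs' = length bs"
    and u: "Vector_Spaces.linear scale scale u" "u ` seg bs a \<subseteq> seg bs' a"
    and z: "z \<in> seg bs (a + m)"
  shows "vc bs' a m (u z) = blk bs' bs a m u *\<^sub>v vc bs a m z"
proof (rule eq_vecI)
  fix i assume "i < dim_vec (blk bs' bs a m u *\<^sub>v vc bs a m z)"
  hence i: "i < m" by (simp add: blk_def)
  let ?f = "\<lambda>j. coord bs z j * coord bs' (u (bs ! j)) (a + i)"
  have "coord bs' (u z) (a + i) = (\<Sum>j<length bs. ?f j)" by (rule coord_linear_image[OF bs bs' u(1)])
  also have "\<dots> = (\<Sum>j=a..<a+m. ?f j)"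
  proof (rule sum.mono_neutral_right)
    show "\<forall>j\<in>{..<length bs} - {a..<a+m}. ?f j = 0"
    proof
      fix j assume j: "j \<in> {..<length bs} - {a..<a+m}"
      show "?f j = 0"
      proof (cases "j < a")
        case True
        hence "u (bs ! j) \<in> seg bs' a" using u(2) nth_mem_seg[OF bs True] j by blast
        thus ?thesis using segD[of "u (bs ! j)" bs' a "a + i"] i l by simp
      next
        case False
        thus ?thesis using segD[OF z, of j] j by simp
      qed
    qed
  qed (use l in auto)
  also have "\<dots> = (\<Sum>j<m. ?f (a + j))"
    using sum.shift_bounds_nat_ivl[of ?f 0 a m] by (simp add: add.commute atLeast0LessThan)
  also have "\<dots> = (blk bs' bs a m u *\<^sub>v vc bs a m z) $ i"
    using i by (simp add: blk_def vc_def scalar_prod_def atLeast0LessThan mult.commute)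
  finally show "vc bs' a m (u z) $ i = (blk bs' bs a m u *\<^sub>v vc bs a m z) $ i"
    using i by (simp add: vc_def)
qed (simp add: blk_def vc_def)

lemma col_blk: "j < m \<Longrightarrow> col (blk bs' bs a m u) j = vc bs' a m (u (bs ! (a + j)))"
  by (rule eq_vecI) (simp_all add: blk_def vc_def)

text \<open>Functoriality of passing to the subquotient. The inner map only has to respect the upper
  step of the flag, the outer one only the lower step.\<close>

lemma blk_mult:
  assumes bs: "ordered_basis bs" "ordered_basis bs'" "ordered_basis bs''"
    and l: "a + m \<le> length bs" "length bs' = length bs" "length bs'' = length bs"
    and u: "Vector_Spaces.linear scale scale u" "u ` seg bs' a \<subseteq> seg bs'' a"
    and v: "v ` seg bs (a + m) \<subseteq> seg bs' (a + m)"
  shows "blk bs'' bs a m (\<lambda>x. u (v x)) = blk bs'' bs' a m u * blk bs' bs a m v"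
proof (rule mat_col_eqI)
  fix j assume "j < dim_col (blk bs'' bs' a m u * blk bs' bs a m v)"
  hence j: "j < m" by (simp add: blk_def)
  have "bs ! (a + j) \<in> seg bs (a + m)" by (rule nth_mem_seg[OF bs(1)]) (use j l in auto)
  hence vz: "v (bs ! (a + j)) \<in> seg bs' (a + m)" using v by blast
  have l': "a + m \<le> length bs'" "length bs'' = length bs'" using l by auto
  have "col (blk bs'' bs a m (\<lambda>x. u (v x))) j = vc bs'' a m (u (v (bs ! (a + j))))"
    by (rule col_blk[OF j])
  also have "\<dots> = blk bs'' bs' a m u *\<^sub>v vc bs' a m (v (bs ! (a + j)))"
    by (rule vc_apply[OF bs(2,3) l' u vz])
  also have "\<dots> = blk bs'' bs' a m u *\<^sub>v col (blk bs' bs a m v) j" by (simp only: col_blk[OF j])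
  also have "\<dots> = col (blk bs'' bs' a m u * blk bs' bs a m v) j"
    by (rule col_mult2[symmetric, of _ m m _ m]) (simp_all add: j)
  finally show "col (blk bs'' bs a m (\<lambda>x. u (v x))) j = col (blk bs'' bs' a m u * blk bs' bs a m v) j" .
qed (simp_all add: blk_def)

lemma blk_id:
  assumes bs: "ordered_basis bs" and l: "a + m \<le> length bs"
  shows "blk bs bs a m (\<lambda>x. x) = 1\<^sub>m m"
  by (rule eq_matI) (use l in \<open>auto simp: blk_def coord_basis[OF bs]\<close>)

lemma blk_add: "ordered_basis bs' \<Longrightarrow> blk bs' bs a m (u + v) = blk bs' bs a m u + blk bs' bs a m v"
  and blk_scale: "ordered_basis bs' \<Longrightarrow> blk bs' bs a m (\<lambda>x. scale c (u x)) = c \<cdot>\<^sub>m blk bs' bs a m u"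
  by (rule eq_matI; simp add: blk_def coord_add coord_scale)+

lemma blk_zero: "ordered_basis bs' \<Longrightarrow> blk bs' bs a m 0 = 0\<^sub>m m m"
  by (rule eq_matI; simp add: blk_def coord_zero)

lemma blk_eq_imp:
  assumes bs: "ordered_basis bs" and l: "a + m \<le> length bs"
    and u: "Vector_Spaces.linear scale scale u" "u ` seg bs a \<subseteq> seg bs a" "u ` seg bs (a + m) \<subseteq> seg bs (a + m)"
    and w: "Vector_Spaces.linear scale scale w" "w ` seg bs a \<subseteq> seg bs a" "w ` seg bs (a + m) \<subseteq> seg bs (a + m)"
    and eq: "blk bs bs a m u = blk bs bs a m w" and z: "z \<in> seg bs (a + m)"
  shows "u z - w z \<in> seg bs a"
proof -
  have d: "u z - w z \<in> seg bs (a + m)" using u(3) w(3) z subspace_diff[OF subspace_seg[OF bs]] by blast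
  have "vc bs a m (u z) = vc bs a m (w z)"
    using vc_apply[OF bs bs l refl u(1,2) z] vc_apply[OF bs bs l refl w(1,2) z] eq by simp
  hence "vc bs a m (u z - w z) = 0\<^sub>v m" unfolding vc_diff[OF bs] by simp
  thus ?thesis using vc_eq_0_iff[OF bs l d] by blast
qed

text \<open>The matrix on the left represents \<open>1 - u\<close> on the subquotient, and for a
  square matrix invertibility is injectivity.\<close>

lemma blk_invertible_iff:
  assumes bs: "ordered_basis bs" and l: "a + m \<le> length bs"
    and u: "Vector_Spaces.linear scale scale u" "u ` seg bs a \<subseteq> seg bs a" "u ` seg bs (a + m) \<subseteq> seg bs (a + m)"
  shows "invertible_mat (1\<^sub>m m - blk bs bs a m u) \<longleftrightarrow>
    (\<forall>z\<in>seg bs (a + m). z - u z \<in> seg bs a \<longrightarrow> z \<in> seg bs a)"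
proof -
  let ?A = "1\<^sub>m m - blk bs bs a m u"
  have A: "?A \<in> carrier_mat m m" by (simp add: minus_carrier_mat)
  have key: "?A *\<^sub>v vc bs a m z = 0\<^sub>v m \<longleftrightarrow> z - u z \<in> seg bs a" if z: "z \<in> seg bs (a + m)" for z
  proof -
    have d: "z - u z \<in> seg bs (a + m)" using u(3) z subspace_diff[OF subspace_seg[OF bs]] by blast
    have "?A *\<^sub>v vc bs a m z = vc bs a m z - blk bs bs a m u *\<^sub>v vc bs a m z"
      by (subst minus_mult_distrib_mat_vec[of _ m m]) simp_all
    also have "\<dots> = vc bs a m (z - u z)"
      by (simp only: vc_diff[OF bs] vc_apply[OF bs bs l refl u(1,2) z])
    finally show ?thesis using vc_eq_0_iff[OF bs l d] by simp
  qed
  show ?thesis unfolding invertible_mat_iff_inj[OF A]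
  proof (intro iffI ballI impI)
    fix z assume inj: "\<forall>v\<in>carrier_vec m. ?A *\<^sub>v v = 0\<^sub>v m \<longrightarrow> v = 0\<^sub>v m"
      and z: "z \<in> seg bs (a + m)" "z - u z \<in> seg bs a"
    have "?A *\<^sub>v vc bs a m z = 0\<^sub>v m" using key[OF z(1)] z(2) by blast
    hence "vc bs a m z = 0\<^sub>v m" using inj vc_carrier by blast
    thus "z \<in> seg bs a" using vc_eq_0_iff[OF bs l z(1)] by blast
  next
    fix v assume inj: "\<forall>z\<in>seg bs (a + m). z - u z \<in> seg bs a \<longrightarrow> z \<in> seg bs a"
      and v: "v \<in> carrier_vec m" "?A *\<^sub>v v = 0\<^sub>v m"
    obtain z where z: "z \<in> seg bs (a + m)" "vc bs a m z = v" using vc_surj[OF bs l v(1)] by blast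
    have "z - u z \<in> seg bs a" using key[OF z(1)] v(2) unfolding z(2) by blast
    hence "z \<in> seg bs a" using inj z(1) by blast
    hence "vc bs a m z = 0\<^sub>v m" using vc_eq_0_iff[OF bs l z(1)] by blast
    thus "v = 0\<^sub>v m" unfolding z(2) .
  qed
qed

text \<open>The lattice correspondence for a subquotient: stable spaces between the two steps of the
  flag and invariant spaces of column vectors are images and preimages of each other under
  \<open>vc\<close>, whose kernel is the lower step.\<close>

lemma irreducible_mats_blk_iff:
  assumes bs: "ordered_basis bs" and l: "a + m \<le> length bs"
    and S: "\<And>u. u \<in> S \<Longrightarrow> Vector_Spaces.linear scale scale u"
      "\<And>u. u \<in> S \<Longrightarrow> u ` seg bs a \<subseteq> seg bs a" "\<And>u. u \<in> S \<Longrightarrow> u ` seg bs (a + m) \<subseteq> seg bs (a + m)"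
  shows "irreducible_mats m (blk bs bs a m ` S) \<longleftrightarrow>
    (\<forall>U. stable S U \<longrightarrow> seg bs a \<subseteq> U \<longrightarrow> U \<subseteq> seg bs (a + m) \<longrightarrow> U = seg bs a \<or> U = seg bs (a + m))"
proof (intro iffI allI impI)
  fix U assume irr: "irreducible_mats m (blk bs bs a m ` S)"
    and U: "stable S U" "seg bs a \<subseteq> U" "U \<subseteq> seg bs (a + m)"
  note sU = stableD(1)[OF U(1)]
  let ?V = "vc bs a m ` U"
  have "VectorSpace.subspace class_ring ?V (module_vec TYPE('a) m)"
    unfolding vec_subspace_iff
  proof (intro conjI ballI allI)
    have "vc bs a m 0 = 0\<^sub>v m" by (rule eq_vecI) (simp_all add: vc_def coord_zero[OF bs])
    thus "0\<^sub>v m \<in> ?V" using subspace_0[OF sU] by (metis image_eqI)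
    show "x + y \<in> ?V" if xy: "x \<in> ?V" "y \<in> ?V" for x y
    proof -
      obtain x' y' where "x = vc bs a m x'" "y = vc bs a m y'" "x' \<in> U" "y' \<in> U" using xy by blast
      thus ?thesis using subspace_add[OF sU, of x' y'] by (auto simp: vc_add[OF bs, symmetric])
    qed
    show "c \<cdot>\<^sub>v x \<in> ?V" if x: "x \<in> ?V" for c x
    proof -
      obtain x' where "x = vc bs a m x'" "x' \<in> U" using x by blast
      thus ?thesis using subspace_scale[OF sU, of x'] by (auto simp: vc_scale[OF bs, symmetric])
    qed
  qed auto
  moreover have "\<forall>M\<in>blk bs bs a m ` S. \<forall>x\<in>?V. M *\<^sub>v x \<in> ?V"
  proof (intro ballI)
    fix M x assume "M \<in> blk bs bs a m ` S" "x \<in> ?V"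
    then obtain u z where uz: "u \<in> S" "M = blk bs bs a m u" "z \<in> U" "x = vc bs a m z" by blast
    have "z \<in> seg bs (a + m)" using uz(3) U(3) by blast
    hence "M *\<^sub>v x = vc bs a m (u z)"
      unfolding uz(2,4) by (rule vc_apply[OF bs bs l refl S(1,2)[OF uz(1)], symmetric])
    thus "M *\<^sub>v x \<in> ?V" using stableD(2)[OF U(1) uz(1,3)] by blast
  qed
  ultimately have "?V = {0\<^sub>v m} \<or> ?V = carrier_vec m" using irr unfolding irreducible_mats_def by blast
  thus "U = seg bs a \<or> U = seg bs (a + m)"
  proof
    assume V: "?V = {0\<^sub>v m}"
    have "U \<subseteq> seg bs a"
    proof
      fix z assume z: "z \<in> U"
      hence "vc bs a m z = 0\<^sub>v m" using V by blast
      thus "z \<in> seg bs a" using vc_eq_0_iff[OF bs l] z U(3) by blast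
    qed
    thus ?thesis using U(2) by blast
  next
    assume V: "?V = carrier_vec m"
    have "seg bs (a + m) \<subseteq> U"
    proof
      fix z assume z: "z \<in> seg bs (a + m)"
      have "vc bs a m z \<in> ?V" unfolding V by simp
      then obtain y where y: "y \<in> U" "vc bs a m z = vc bs a m y" by blast
      have d: "z - y \<in> seg bs (a + m)" using z y(1) U(3) subspace_diff[OF subspace_seg[OF bs]] by blast
      have "vc bs a m (z - y) = 0\<^sub>v m" unfolding vc_diff[OF bs] y(2) by simp
      hence "z - y \<in> U" using vc_eq_0_iff[OF bs l d] U(2) by blast
      from subspace_add[OF sU this y(1)] show "z \<in> U" by simp
    qed
    thus ?thesis using U(3) by blast
  qed
next
  assume irr: "\<forall>U. stable S U \<longrightarrow> seg bs a \<subseteq> U \<longrightarrow> U \<subseteq> seg bs (a + m) \<longrightarrow> U = seg bs a \<or> U = seg bs (a + m)"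
  show "irreducible_mats m (blk bs bs a m ` S)"
    unfolding irreducible_mats_def vec_subspace_iff
  proof (intro allI impI)
    fix V :: "'a vec set"
    assume "(V \<subseteq> carrier_vec m \<and> 0\<^sub>v m \<in> V \<and> (\<forall>x\<in>V. \<forall>y\<in>V. x + y \<in> V) \<and> (\<forall>c. \<forall>x\<in>V. c \<cdot>\<^sub>v x \<in> V)) \<and>
      (\<forall>M\<in>blk bs bs a m ` S. \<forall>x\<in>V. M *\<^sub>v x \<in> V)"
    hence V: "V \<subseteq> carrier_vec m" "0\<^sub>v m \<in> V" "\<And>x y. x \<in> V \<Longrightarrow> y \<in> V \<Longrightarrow> x + y \<in> V"
      "\<And>c x. x \<in> V \<Longrightarrow> c \<cdot>\<^sub>v x \<in> V" "\<And>u x. u \<in> S \<Longrightarrow> x \<in> V \<Longrightarrow> blk bs bs a m u *\<^sub>v x \<in> V"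
      by blast+
    define U where "U = {z \<in> seg bs (a + m). vc bs a m z \<in> V}"
    have sa: "seg bs a \<subseteq> seg bs (a + m)" by (rule seg_mono) simp
    have aU: "seg bs a \<subseteq> U"
    proof
      fix z assume z: "z \<in> seg bs a"
      hence "vc bs a m z = 0\<^sub>v m" using vc_eq_0_iff[OF bs l] sa by blast
      thus "z \<in> U" using z sa V(2) unfolding U_def by auto
    qed
    have "stable S U"
    proof (rule stableI)
      show "subspace U"
      proof (rule subspaceI)
        show "0 \<in> U" using aU subspace_0[OF subspace_seg[OF bs]] by blast
        show "x + y \<in> U" if "x \<in> U" "y \<in> U" for x y
          using that subspace_add[OF subspace_seg[OF bs]] V(3) by (simp add: U_def vc_add[OF bs])
        show "scale c x \<in> U" if "x \<in> U" for c x
          using that subspace_scale[OF subspace_seg[OF bs]] V(4) by (simp add: U_def vc_scale[OF bs])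
      qed
      fix u z assume u: "u \<in> S" and z: "z \<in> U"
      have z': "z \<in> seg bs (a + m)" "vc bs a m z \<in> V" using z by (simp_all add: U_def)
      have "vc bs a m (u z) \<in> V"
        unfolding vc_apply[OF bs bs l refl S(1,2)[OF u] z'(1)] by (rule V(5)[OF u z'(2)])
      moreover have "u z \<in> seg bs (a + m)" using S(3)[OF u] z'(1) by blast
      ultimately show "u z \<in> U" by (simp add: U_def)
    qed
    moreover have "U \<subseteq> seg bs (a + m)" by (auto simp: U_def)
    ultimately consider "U = seg bs a" | "U = seg bs (a + m)" using irr aU by blast
    thus "V = {0\<^sub>v m} \<or> V = carrier_vec m"
    proof cases
      case 1
      have "v = 0\<^sub>v m" if v: "v \<in> V" for v
      proof -
        obtain z where z: "z \<in> seg bs (a + m)" "vc bs a m z = v" using vc_surj[OF bs l] v V(1) by blast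
        hence "z \<in> seg bs a" using v 1 by (auto simp: U_def)
        thus ?thesis using vc_eq_0_iff[OF bs l z(1)] z(2) by simp
      qed
      thus ?thesis using V(2) by blast
    next
      case 2
      have "v \<in> V" if v: "v \<in> carrier_vec m" for v
      proof -
        obtain z where z: "z \<in> seg bs (a + m)" "vc bs a m z = v" using vc_surj[OF bs l v] by blast
        thus ?thesis using 2 by (auto simp: U_def)
      qed
      thus ?thesis using V(1) by blast
    qed
  qed
qed

end

section \<open>Entries of the block matrices\<close>

lemma append_cols_carrier:
  "A \<in> carrier_mat nr n1 \<Longrightarrow> B \<in> carrier_mat nr n2 \<Longrightarrow> A @\<^sub>c B \<in> carrier_mat nr (n1 + n2)"
  by (auto simp: append_cols_def)

lemma index_append_cols:
  assumes "A \<in> carrier_mat nr n1" "B \<in> carrier_mat nr n2" "i < nr" "j < n1 + n2"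
  shows "(A @\<^sub>c B) $$ (i, j) = (if j < n1 then A $$ (i, j) else B $$ (i, j - n1))"
  using assms by (auto simp: append_cols_def)

lemma index_append_rows:
  assumes "A \<in> carrier_mat n1 nc" "B \<in> carrier_mat n2 nc" "i < n1 + n2" "j < nc"
  shows "(A @\<^sub>r B) $$ (i, j) = (if i < n1 then A $$ (i, j) else B $$ (i - n1, j))"
  using assms by (auto simp: append_rows_def)

text \<open>Indices are nested as \<open>r + (m + j)\<close> to follow the right-associated appends;
  every entry is then located by comparisons with \<open>r\<close> and \<open>m\<close>
  only.\<close>

lemma blocks_3x3:
  assumes c: "A1 \<in> carrier_mat r r" "A2 \<in> carrier_mat r m" "A3 \<in> carrier_mat r r"
    "B1 \<in> carrier_mat m r" "B2 \<in> carrier_mat m m" "B3 \<in> carrier_mat m r"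
    "C1 \<in> carrier_mat r r" "C2 \<in> carrier_mat r m" "C3 \<in> carrier_mat r r"
  defines "X \<equiv> (A1 @\<^sub>c A2 @\<^sub>c A3) @\<^sub>r (B1 @\<^sub>c B2 @\<^sub>c B3) @\<^sub>r (C1 @\<^sub>c C2 @\<^sub>c C3)"
  shows "X \<in> carrier_mat (r + (m + r)) (r + (m + r))"
    and "i < r \<Longrightarrow> j < r \<Longrightarrow> X $$ (i, j) = A1 $$ (i, j)"
    and "i < r \<Longrightarrow> j < m \<Longrightarrow> X $$ (i, r + j) = A2 $$ (i, j)"
    and "i < r \<Longrightarrow> j < r \<Longrightarrow> X $$ (i, r + (m + j)) = A3 $$ (i, j)"
    and "i < m \<Longrightarrow> j < r \<Longrightarrow> X $$ (r + i, j) = B1 $$ (i, j)"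
    and "i < m \<Longrightarrow> j < m \<Longrightarrow> X $$ (r + i, r + j) = B2 $$ (i, j)"
    and "i < m \<Longrightarrow> j < r \<Longrightarrow> X $$ (r + i, r + (m + j)) = B3 $$ (i, j)"
    and "i < r \<Longrightarrow> j < r \<Longrightarrow> X $$ (r + (m + i), j) = C1 $$ (i, j)"
    and "i < r \<Longrightarrow> j < m \<Longrightarrow> X $$ (r + (m + i), r + j) = C2 $$ (i, j)"
    and "i < r \<Longrightarrow> j < r \<Longrightarrow> X $$ (r + (m + i), r + (m + j)) = C3 $$ (i, j)"
proof -
  let ?A = "A1 @\<^sub>c A2 @\<^sub>c A3" and ?B = "B1 @\<^sub>c B2 @\<^sub>c B3" and ?C = "C1 @\<^sub>c C2 @\<^sub>c C3"
  have A': "A2 @\<^sub>c A3 \<in> carrier_mat r (m + r)" "B2 @\<^sub>c B3 \<in> carrier_mat m (m + r)"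
    "C2 @\<^sub>c C3 \<in> carrier_mat r (m + r)"
    by (intro append_cols_carrier c)+
  have A: "?A \<in> carrier_mat r (r + (m + r))" "?B \<in> carrier_mat m (r + (m + r))" "?C \<in> carrier_mat r (r + (m + r))"
    by (intro append_cols_carrier c A')+
  have BC: "?B @\<^sub>r ?C \<in> carrier_mat (m + r) (r + (m + r))" by (rule carrier_append_rows[OF A(2,3)])
  show "X \<in> carrier_mat (r + (m + r)) (r + (m + r))"
    unfolding X_def by (rule carrier_append_rows[OF A(1) BC])
  note ix = index_append_rows[OF A(1) BC, folded X_def] index_append_rows[OF A(2,3)]
    index_append_cols[OF c(1) A'(1)] index_append_cols[OF c(4) A'(2)] index_append_cols[OF c(7) A'(3)]
    index_append_cols[OF c(2,3)] index_append_cols[OF c(5,6)] index_append_cols[OF c(8,9)]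
  show "i < r \<Longrightarrow> j < r \<Longrightarrow> X $$ (i, j) = A1 $$ (i, j)"
    "i < r \<Longrightarrow> j < m \<Longrightarrow> X $$ (i, r + j) = A2 $$ (i, j)"
    "i < r \<Longrightarrow> j < r \<Longrightarrow> X $$ (i, r + (m + j)) = A3 $$ (i, j)"
    "i < m \<Longrightarrow> j < r \<Longrightarrow> X $$ (r + i, j) = B1 $$ (i, j)"
    "i < m \<Longrightarrow> j < m \<Longrightarrow> X $$ (r + i, r + j) = B2 $$ (i, j)"
    "i < m \<Longrightarrow> j < r \<Longrightarrow> X $$ (r + i, r + (m + j)) = B3 $$ (i, j)"
    "i < r \<Longrightarrow> j < r \<Longrightarrow> X $$ (r + (m + i), j) = C1 $$ (i, j)"
    "i < r \<Longrightarrow> j < m \<Longrightarrow> X $$ (r + (m + i), r + j) = C2 $$ (i, j)"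
    "i < r \<Longrightarrow> j < r \<Longrightarrow> X $$ (r + (m + i), r + (m + j)) = C3 $$ (i, j)"
    by (simp_all add: ix)
qed

section \<open>Entries of the standard symplectic and alternating matrices\<close>

lemma symp_mat_index:
  assumes "a < 2 * k" "b < 2 * k"
  shows "symp_mat k $$ (a, b) =
    (if a < k then if b = k + a then 1 else 0 else if a = k + b then - 1 else (0 :: 'a::field))"
  using assms by (auto simp: symp_mat_def one_mat_def)

lemma symp_mat_mult_vec_index:
  fixes v :: "'a::field vec"
  assumes v: "v \<in> carrier_vec (2 * k)" and a: "a < 2 * k"
  shows "(symp_mat k *\<^sub>v v) $ a = (if a < k then v $ (k + a) else - v $ (a - k))"
proof -
  have "(symp_mat k *\<^sub>v v) $ a = (\<Sum>b<2*k. symp_mat k $$ (a, b) * v $ b)"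
    using v a carrier_matD[OF symp_mat_carrier[where ?'a = 'a, of k]]
    by (simp add: scalar_prod_def atLeast0LessThan)
  also have "\<dots> = (\<Sum>b<2*k. if b = (if a < k then k + a else a - k)
      then (if a < k then v $ b else - v $ b) else 0)"
    by (intro sum.cong refl) (use a in \<open>auto simp: symp_mat_index\<close>)
  also have "\<dots> = (if a < k then v $ (k + a) else - v $ (a - k))"
    using a by (auto simp: sum.delta)
  finally show ?thesis .
qed

lemma symp_mat_mult_index:
  fixes B :: "'a::field mat"
  assumes B: "B \<in> carrier_mat (2 * k) m" and a: "a < 2 * k" and j: "j < m"
  shows "(symp_mat k * B) $$ (a, j) = (if a < k then B $$ (k + a, j) else - B $$ (a - k, j))"
proof -
  have "(symp_mat k * B) $$ (a, j) = (symp_mat k *\<^sub>v col B j) $ a"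
    using B a j carrier_matD[OF symp_mat_carrier[where ?'a = 'a, of k]] by simp
  also have "\<dots> = (if a < k then B $$ (k + a, j) else - B $$ (a - k, j))"
    using B a j by (subst symp_mat_mult_vec_index) auto
  finally show ?thesis .
qed

lemma symp_alt_mats_iff:
  assumes N: "N \<in> carrier_mat (2 * k) (2 * k)"
  shows "N \<in> symp_alt_mats k \<longleftrightarrow> symp_mat k * N \<in> alternating_mats (2 * k)"
  using N by (simp add: symp_alt_mats_def symp_form_def
      alternating_mats_iff[OF mult_carrier_mat[OF symp_mat_carrier N]]
      assoc_mult_mat_vec[OF symp_mat_carrier N])

lemma alternating_mats_index_iff:
  assumes A: "A \<in> carrier_mat m m"
  shows "A \<in> alternating_mats m \<longleftrightarrow>
    (\<forall>i<m. \<forall>j<m. A $$ (j, i) = - A $$ (i, j)) \<and> (\<forall>i<m. A $$ (i, i) = 0)"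
proof -
  have "transpose_mat A = - A \<longleftrightarrow> (\<forall>i<m. \<forall>j<m. A $$ (j, i) = - A $$ (i, j))"
  proof
    assume e: "transpose_mat A = - A"
    show "\<forall>i<m. \<forall>j<m. A $$ (j, i) = - A $$ (i, j)"
    proof (intro allI impI)
      fix i j assume ij: "i < m" "j < m"
      have "A $$ (j, i) = transpose_mat A $$ (i, j)" using A ij by simp
      also have "\<dots> = - A $$ (i, j)" unfolding e using A ij by simp
      finally show "A $$ (j, i) = - A $$ (i, j)" .
    qed
  next
    assume *: "\<forall>i<m. \<forall>j<m. A $$ (j, i) = - A $$ (i, j)"
    show "transpose_mat A = - A"
    proof (rule eq_matI)
      fix i j assume "i < dim_row (- A)" "j < dim_col (- A)"
      hence ij: "i < m" "j < m" using A by auto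
      have "transpose_mat A $$ (i, j) = A $$ (j, i)" using A ij by simp
      also have "\<dots> = - A $$ (i, j)" using * ij by blast
      also have "\<dots> = (- A) $$ (i, j)" using A ij by simp
      finally show "transpose_mat A $$ (i, j) = (- A) $$ (i, j)" .
    qed (use A in auto)
  qed
  thus ?thesis using A by (simp add: alternating_mats_def)
qed

lemma symp_alt_mats_zero: "0\<^sub>m (2 * k) (2 * k) \<in> symp_alt_mats k"
proof -
  have "x \<bullet> (symp_mat k *\<^sub>v (0\<^sub>m (2 * k) (2 * k) *\<^sub>v x)) = 0" if x: "x \<in> carrier_vec (2 * k)" for x :: "'a vec"
  proof -
    have "0\<^sub>m (2 * k) (2 * k) *\<^sub>v x = 0\<^sub>v (2 * k)"
      by (rule eq_vecI) (use x in \<open>auto simp: scalar_prod_def\<close>)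
    moreover have "symp_mat k *\<^sub>v (0\<^sub>v (2 * k) :: 'a vec) = 0\<^sub>v (2 * k)"
      by (rule eq_vecI) (auto simp: symp_mat_mult_vec_index symp_mat_carrier[THEN carrier_matD(1)]
            simp del: index_mult_mat_vec)
    ultimately show ?thesis using x by simp
  qed
  thus ?thesis by (simp add: symp_alt_mats_def symp_form_def)
qed

section \<open>Mixed symplectic bases\<close>

text \<open>The position of the only basis vector that pairs nontrivially with the one at position
  \<open>i\<close>: \<open>e_i\<close> is matched with \<open>f_i\<close>, and \<open>g_a\<close>
  with \<open>g_(k+a)\<close>. \<open>partner_sign\<close> is the value of that pairing.\<close>

definition partner :: "nat \<Rightarrow> nat \<Rightarrow> nat \<Rightarrow> nat" where
  "partner r k i = (if i < r then r + (2 * k + i) else if i < r + k then i + k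
     else if i < r + 2 * k then i - k else i - (r + 2 * k))"

definition partner_sign :: "nat \<Rightarrow> nat \<Rightarrow> nat \<Rightarrow> 'a::field" where
  "partner_sign r k i = (if i < r + k then 1 else - 1)"

lemma partner_less: "i < r + (2 * k + r) \<Longrightarrow> partner r k i < r + (2 * k + r)"
  and partner_partner: "i < r + (2 * k + r) \<Longrightarrow> partner r k (partner r k i) = i"
  by (auto simp: partner_def)

lemma nat_split3:
  assumes "i < r + (m + r :: nat)"
  obtains "i < r" | a where "a < m" "i = r + a" | a where "a < r" "i = r + (m + a)"
proof -
  consider "i < r" | "r \<le> i" "i < r + m" | "r + m \<le> i" by linarith
  thus ?thesis
  proof cases
    case 2
    thus ?thesis using that(2)[of "i - r"] by simp
  next
    case 3
    thus ?thesis using that(3)[of "i - (r + m)"] assms by simp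
  qed (rule that(1))
qed

lemma mixed_gram_carrier: "mixed_gram r k \<in> carrier_mat (r + (2 * k + r)) (r + (2 * k + r))"
  unfolding mixed_gram_def by (rule blocks_3x3) auto

lemma mixed_gram_index:
  assumes i: "i < r + (2 * k + r)" and j: "j < r + (2 * k + r)"
  shows "(mixed_gram r k :: 'a::field mat) $$ (i, j) = (if j = partner r k i then partner_sign r k i else 0)"
proof -
  have c: "0\<^sub>m r r \<in> carrier_mat r r" "0\<^sub>m r (2 * k) \<in> carrier_mat r (2 * k)"
    "1\<^sub>m r \<in> carrier_mat r r" "0\<^sub>m (2 * k) r \<in> carrier_mat (2 * k) r" "- 1\<^sub>m r \<in> carrier_mat r r" by auto
  note G = blocks_3x3[OF c(1,2,3,4) symp_mat_carrier c(4,5,2,1), folded mixed_gram_def]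
  show ?thesis
    using i
  proof (cases rule: nat_split3)
    case 1
    show ?thesis using j by (cases rule: nat_split3; use 1 in \<open>simp add: G partner_def partner_sign_def\<close>)
  next
    case (2 a)
    show ?thesis using j
      by (cases rule: nat_split3; use 2 in \<open>auto simp: G partner_def partner_sign_def symp_mat_index\<close>)
  next
    case (3 a)
    show ?thesis using j by (cases rule: nat_split3; use 3 in \<open>auto simp: G partner_def partner_sign_def\<close>)
  qed
qed

context symplectic_space
begin

lemma mixed_symplectic_basis_iff:
  "mixed_symplectic_basis r k bs \<longleftrightarrow> ordered_basis bs \<and> length bs = r + (2 * k + r) \<and>
    (\<forall>i<length bs. \<forall>j<length bs. s (bs ! i) (bs ! j) = (if j = partner r k i then partner_sign r k i else 0))"
proof -
  have "gram_mat bs = mixed_gram r k \<longleftrightarrow> length bs = r + (2 * k + r) \<and>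
    (\<forall>i<length bs. \<forall>j<length bs. s (bs ! i) (bs ! j) = (if j = partner r k i then partner_sign r k i else 0))"
  proof
    assume g: "gram_mat bs = mixed_gram r k"
    have "dim_row (gram_mat bs) = dim_row (mixed_gram r k :: 'a mat)" by (simp only: g)
    hence l: "length bs = r + (2 * k + r)"
      using mixed_gram_carrier[where ?'a = 'a, of r k] by (simp add: gram_mat_def)
    have "s (bs ! i) (bs ! j) = (if j = partner r k i then partner_sign r k i else 0)"
      if ij: "i < length bs" "j < length bs" for i j
    proof -
      have "s (bs ! i) (bs ! j) = gram_mat bs $$ (i, j)" using ij by (simp add: gram_mat_def)
      thus ?thesis unfolding g using mixed_gram_index[of i r k j] ij l by simp
    qed
    thus "length bs = r + (2 * k + r) \<and>
      (\<forall>i<length bs. \<forall>j<length bs. s (bs ! i) (bs ! j) = (if j = partner r k i then partner_sign r k i else 0))"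
      using l by blast
  next
    assume *: "length bs = r + (2 * k + r) \<and>
      (\<forall>i<length bs. \<forall>j<length bs. s (bs ! i) (bs ! j) = (if j = partner r k i then partner_sign r k i else 0))"
    show "gram_mat bs = mixed_gram r k"
      by (rule eq_matI)
         (use * mixed_gram_carrier[where ?'a = 'a, of r k] in \<open>auto simp: gram_mat_def mixed_gram_index\<close>)
  qed
  thus ?thesis unfolding mixed_symplectic_basis_def by blast
qed

lemma mixed_symplectic_basisD:
  assumes "mixed_symplectic_basis r k bs"
  shows "ordered_basis bs" "length bs = r + (2 * k + r)"
    "\<And>i j. i < length bs \<Longrightarrow> j < length bs \<Longrightarrow>
      s (bs ! i) (bs ! j) = (if j = partner r k i then partner_sign r k i else 0)"
  using assms unfolding mixed_symplectic_basis_iff by blast+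

text \<open>Each row of the Gram matrix has a single nonzero entry, so expanding \<open>v\<close> in
  the basis leaves one term. This turns statements about the form into statements about matrix
  entries.\<close>

lemma mixed_form:
  assumes B: "mixed_symplectic_basis r k bs" and i: "i < length bs"
  shows "s (bs ! i) v = partner_sign r k i * coord bs v (partner r k i)"
proof -
  note D = mixed_symplectic_basisD[OF B]
  have p: "partner r k i < length bs" using i unfolding D(2) by (rule partner_less)
  have "s (bs ! i) v = s (bs ! i) (\<Sum>j<length bs. scale (coord bs v j) (bs ! j))"
    by (rule arg_cong[OF coord_expand[OF D(1), symmetric]])
  also have "\<dots> = (\<Sum>j<length bs. coord bs v j * s (bs ! i) (bs ! j))"
    by (simp only: form_sum_right form_scale_right)
  also have "\<dots> = (\<Sum>j<length bs. if j = partner r k i then partner_sign r k i * coord bs v j else 0)"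
    by (intro sum.cong refl) (use D(3)[OF i] in simp)
  also have "\<dots> = partner_sign r k i * coord bs v (partner r k i)" using p by simp
  finally show ?thesis .
qed

lemma
  assumes B: "mixed_symplectic_basis r k bs"
  shows mixed_form_e: "i < r \<Longrightarrow> s (bs ! i) v = coord bs v (r + (2 * k + i))"
    and mixed_form_g: "a < 2 * k \<Longrightarrow>
      s (bs ! (r + a)) v = (if a < k then coord bs v (r + (k + a)) else - coord bs v (r + (a - k)))"
    and mixed_form_f: "i < r \<Longrightarrow> s (bs ! (r + (2 * k + i))) v = - coord bs v i"
proof -
  have l: "length bs = r + (2 * k + r)" using mixed_symplectic_basisD(2)[OF B] .
  show "i < r \<Longrightarrow> s (bs ! i) v = coord bs v (r + (2 * k + i))"
    by (subst mixed_form[OF B]) (auto simp: l partner_def partner_sign_def)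
  show "i < r \<Longrightarrow> s (bs ! (r + (2 * k + i))) v = - coord bs v i"
    by (subst mixed_form[OF B]) (auto simp: l partner_def partner_sign_def)
  assume a: "a < 2 * k"
  have "partner r k (r + a) = (if a < k then r + (k + a) else r + (a - k))"
    using a by (auto simp: partner_def)
  thus "s (bs ! (r + a)) v = (if a < k then coord bs v (r + (k + a)) else - coord bs v (r + (a - k)))"
    using a by (subst mixed_form[OF B]) (auto simp: l partner_sign_def)
qed

text \<open>The vectors \<open>e_i\<close> pair only with the \<open>f_i\<close>, so orthogonality
  to all \<open>e_i\<close> is the vanishing of the last \<open>r\<close> coordinates.\<close>

lemma perp_seg:
  assumes B: "mixed_symplectic_basis r k bs"
  shows "perp (seg bs r) = seg bs (r + 2 * k)"
proof -
  note D = mixed_symplectic_basisD[OF B]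
  have "perp (seg bs r) = perp (set (take r bs))"
    using seg_eq_span[OF D(1), of r] D(2) perp_span by simp
  also have "set (take r bs) = (!) bs ` {..<r}" using D(2) by (simp add: nth_image[symmetric] lessThan_atLeast0)
  also have "perp ((!) bs ` {..<r}) = {v. \<forall>i<r. s (bs ! i) v = 0}" by (auto simp: perp_def)
  also have "\<dots> = {v. \<forall>i<r. coord bs v (r + (2 * k + i)) = 0}"
    using mixed_form_e[OF B] by auto
  also have "\<dots> = seg bs (r + 2 * k)"
  proof (rule equalityI; rule subsetI)
    fix v assume v: "v \<in> {v. \<forall>i<r. coord bs v (r + (2 * k + i)) = 0}"
    have "coord bs v i = 0" if i: "i < length bs" "r + 2 * k \<le> i" for i
    proof -
      obtain j where j: "i = r + 2 * k + j" using i(2) le_Suc_ex by blast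
      hence "j < r" using i(1) D(2) by simp
      thus ?thesis using v j by (simp add: add.assoc)
    qed
    thus "v \<in> seg bs (r + 2 * k)" by (simp add: seg_def)
  next
    fix v assume "v \<in> seg bs (r + 2 * k)"
    thus "v \<in> {v. \<forall>i<r. coord bs v (r + (2 * k + i)) = 0}"
      using segD[of v bs "r + 2 * k"] D(2) by simp
  qed
  finally show ?thesis .
qed

lemma seg_isotropic:
  assumes B: "mixed_symplectic_basis r k bs"
  shows "seg bs r \<subseteq> perp (seg bs r)"
  unfolding perp_seg[OF B] by (rule seg_mono) simp

text \<open>The form induced on \<open>perp E / E\<close> is the standard one: the
  \<open>e\<close>-coordinates of \<open>x\<close> meet vectors orthogonal to \<open>y\<close>, and
  \<open>x\<close> has no \<open>f\<close>-coordinates, so only the \<open>g\<close>-block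
  contributes.\<close>

lemma symp_form_vc:
  assumes B: "mixed_symplectic_basis r k bs"
    and x: "x \<in> seg bs (r + 2 * k)" and y: "y \<in> seg bs (r + 2 * k)"
  shows "symp_form k (vc bs r (2 * k) x) (vc bs r (2 * k) y) = s x y"
proof -
  note D = mixed_symplectic_basisD[OF B]
  let ?f = "\<lambda>i. coord bs x i * s (bs ! i) y"
  have "s x y = s (\<Sum>i<length bs. scale (coord bs x i) (bs ! i)) y"
    by (rule arg_cong[OF coord_expand[OF D(1), symmetric]])
  also have "\<dots> = - (\<Sum>i<length bs. coord bs x i * s y (bs ! i))"
    by (subst form_skew) (simp only: form_sum_right form_scale_right)
  also have "\<dots> = (\<Sum>i<length bs. ?f i)"
    unfolding sum_negf[symmetric] by (intro sum.cong refl) (simp add: form_skew[of y])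
  also have "\<dots> = (\<Sum>i=r..<r+2*k. ?f i)"
  proof (rule sum.mono_neutral_right)
    show "\<forall>i\<in>{..<length bs} - {r..<r+2*k}. ?f i = 0"
    proof
      fix i assume i: "i \<in> {..<length bs} - {r..<r+2*k}"
      show "?f i = 0"
      proof (cases "i < r")
        case True
        thus ?thesis using mixed_form_e[OF B True, of y] segD[OF y, of "r + (2 * k + i)"] D(2) by simp
      next
        case False
        thus ?thesis using segD[OF x, of i] i by simp
      qed
    qed
  qed (use D(2) in auto)
  also have "\<dots> = (\<Sum>a<2*k. ?f (r + a))"
    using sum.shift_bounds_nat_ivl[of ?f 0 r "2*k"] by (simp add: add.commute atLeast0LessThan)
  also have "\<dots> = (\<Sum>a<2*k. vc bs r (2 * k) x $ a * (symp_mat k *\<^sub>v vc bs r (2 * k) y) $ a)"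
  proof (intro sum.cong refl)
    fix a assume "a \<in> {..<2*k}"
    hence a: "a < 2 * k" by simp
    show "?f (r + a) = vc bs r (2 * k) x $ a * (symp_mat k *\<^sub>v vc bs r (2 * k) y) $ a"
      unfolding symp_mat_mult_vec_index[OF vc_carrier a] mixed_form_g[OF B a]
      using a by (auto simp: vc_def)
  qed
  also have "\<dots> = symp_form k (vc bs r (2 * k) x) (vc bs r (2 * k) y)"
    using carrier_matD[OF symp_mat_carrier[where ?'a = 'a, of k]]
    by (simp add: symp_form_def scalar_prod_def atLeast0LessThan del: index_mult_mat_vec)
  finally show ?thesis by simp
qed

text \<open>Skewness extends from basis vectors one argument at a time, and it then makes the
  vectors with \<open>s x (u x) = 0\<close> a subspace. The diagonal condition is listed separately
  because in characteristic two it does not follow from skewness.\<close>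

lemma alt_endos_basis_iff:
  assumes bs: "ordered_basis bs" and u: "Vector_Spaces.linear scale scale u"
  shows "u \<in> alt_endos \<longleftrightarrow>
    (\<forall>i<length bs. \<forall>j<length bs. s (bs ! j) (u (bs ! i)) = - s (bs ! i) (u (bs ! j))) \<and>
    (\<forall>i<length bs. s (bs ! i) (u (bs ! i)) = 0)"
proof
  assume A: "u \<in> alt_endos"
  show "(\<forall>i<length bs. \<forall>j<length bs. s (bs ! j) (u (bs ! i)) = - s (bs ! i) (u (bs ! j))) \<and>
    (\<forall>i<length bs. s (bs ! i) (u (bs ! i)) = 0)"
  proof (intro conjI allI impI)
    fix i j
    have "s (bs ! j) (u (bs ! i)) = s (u (bs ! j)) (bs ! i)" by (rule alt_endos_selfadjoint[OF A])
    also have "\<dots> = - s (bs ! i) (u (bs ! j))" by (rule form_skew)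
    finally show "s (bs ! j) (u (bs ! i)) = - s (bs ! i) (u (bs ! j))" .
  qed (use A in \<open>simp add: alt_endos_def\<close>)
next
  assume *: "(\<forall>i<length bs. \<forall>j<length bs. s (bs ! j) (u (bs ! i)) = - s (bs ! i) (u (bs ! j))) \<and>
    (\<forall>i<length bs. s (bs ! i) (u (bs ! i)) = 0)"
  interpret u: Vector_Spaces.linear scale scale u by (rule u)
  have sp: "v \<in> span (set bs)" for v using bs by (simp add: ordered_basis_def)
  have 1: "s x (u y) = - s y (u x)" if x: "x \<in> set bs" for x y
    using sp[of y]
  proof (induction rule: span_induct)
    case base
    show ?case by (rule subspaceI) (simp_all add: u.add u.scale u.zero form_simps)
  next
    case (step y)
    thus ?case using x * unfolding in_set_conv_nth by blast
  qed
  have 2: "s x (u y) = - s y (u x)" for x y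
    using sp[of x]
  proof (induction rule: span_induct)
    case base
    show ?case by (rule subspaceI) (simp_all add: u.add u.scale u.zero form_simps)
  next
    case (step x)
    thus ?case by (rule 1)
  qed
  have "s x (u x) = 0" for x
    using sp[of x]
  proof (induction rule: span_induct)
    case base
    show ?case
    proof (rule subspaceI)
      fix x y assume "x \<in> {x. s x (u x) = 0}" "y \<in> {x. s x (u x) = 0}"
      thus "x + y \<in> {x. s x (u x) = 0}" using 2[of x y] by (simp add: u.add form_simps)
    qed (simp_all add: u.scale u.zero form_simps)
  next
    case (step x)
    thus ?case using * unfolding in_set_conv_nth by blast
  qed
  thus "u \<in> alt_endos" using u by (simp add: alt_endos_def)
qed


section \<open>Alternating endomorphisms and the matrices of the triangle space\<close>

lemma mat_in_basis_index:
  "i < length bs \<Longrightarrow> j < length bs \<Longrightarrow> mat_in_basis bs u $$ (i, j) = coord bs (u (bs ! j)) i"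
  by (simp add: mat_in_basis_def coord_def)

text \<open>The matrix \<open>A\<close> of the form \<open>s x (u y)\<close> is the matrix
  \<open>U\<close> of \<open>u\<close> with rows permuted by \<open>partner\<close> and signs
  adjusted. The pattern of \<open>triangle\<close> is what makes \<open>A\<close> alternating, which
  is checked for each pair of blocks.\<close>

lemma triangle_imp:
  assumes B: "mixed_symplectic_basis r k bs" and u: "Vector_Spaces.linear scale scale u"
    and W: "W \<subseteq> carrier_mat r r" and C: "C \<subseteq> symp_alt_mats k"
    and X: "mat_in_basis bs u \<in> triangle r k W C"
  shows "u \<in> alt_endos \<and> u ` seg bs r \<subseteq> seg bs r \<and> blk bs bs 0 r u \<in> W \<and> blk bs bs r (2 * k) u \<in> C"
proof -
  note bs = mixed_symplectic_basisD(1)[OF B] and l = mixed_symplectic_basisD(2)[OF B]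
  obtain M N P D where E: "mat_in_basis bs u =
      (M @\<^sub>c transpose_mat (symp_mat k * P) @\<^sub>c D) @\<^sub>r (0\<^sub>m (2*k) r @\<^sub>c N @\<^sub>c P) @\<^sub>r
      (0\<^sub>m r r @\<^sub>c 0\<^sub>m r (2*k) @\<^sub>c transpose_mat M)"
    and M: "M \<in> W" and N: "N \<in> C" and P: "P \<in> carrier_mat (2*k) r" and D: "D \<in> alternating_mats r"
    using X unfolding triangle_def by blast
  have Mc: "M \<in> carrier_mat r r" using M W by blast
  have Nc: "N \<in> carrier_mat (2*k) (2*k)" using N C by (auto simp: symp_alt_mats_def)
  have Dc: "D \<in> carrier_mat r r" using D by (simp add: alternating_mats_def)
  have KPc: "symp_mat k * P \<in> carrier_mat (2*k) r" by (rule mult_carrier_mat[OF symp_mat_carrier P])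
  have KPt: "transpose_mat (symp_mat k * P) $$ (i, b) = (symp_mat k * P) $$ (b, i)"
    if "i < r" "b < 2*k" for i b
    by (rule index_transpose_mat(1)) (use that carrier_matD[OF KPc] in \<open>simp_all only:\<close>)
  have KNc: "symp_mat k * N \<in> carrier_mat (2*k) (2*k)" by (rule mult_carrier_mat[OF symp_mat_carrier Nc])
  have c: "transpose_mat (symp_mat k * P) \<in> carrier_mat r (2*k)" "0\<^sub>m (2*k) r \<in> carrier_mat (2*k) r"
    "0\<^sub>m r r \<in> carrier_mat r r" "0\<^sub>m r (2*k) \<in> carrier_mat r (2*k)" "transpose_mat M \<in> carrier_mat r r"
    using KPc Mc by auto
  define U where "U i j = coord bs (u (bs ! j)) i" for i j
  have ix: "mat_in_basis bs u $$ (i, j) = U i j" if "i < length bs" "j < length bs" for i j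
    unfolding U_def by (rule mat_in_basis_index[OF that])
  note G = blocks_3x3(2-10)[OF Mc c(1) Dc c(2) Nc P c(3,4,5), folded E]
  have ee: "U i j = M $$ (i, j)" if "i < r" "j < r" for i j
    using G(1)[OF that] ix[of i j] that l by simp
  have eg: "U i (r + b) = (symp_mat k * P) $$ (b, i)" if "i < r" "b < 2*k" for i b
    using G(2)[OF that] ix[of i "r + b"] that l KPt by simp
  have ef: "U i (r + (2*k + j)) = D $$ (i, j)" if "i < r" "j < r" for i j
    using G(3)[OF that] ix[of i "r + (2*k + j)"] that l by simp
  have ge: "U (r + a) j = 0" if "a < 2*k" "j < r" for a j
    using G(4)[OF that] ix[of "r + a" j] that l by simp
  have gg: "U (r + a) (r + b) = N $$ (a, b)" if "a < 2*k" "b < 2*k" for a b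
    using G(5)[OF that] ix[of "r + a" "r + b"] that l by simp
  have gf: "U (r + a) (r + (2*k + j)) = P $$ (a, j)" if "a < 2*k" "j < r" for a j
    using G(6)[OF that] ix[of "r + a" "r + (2*k + j)"] that l by simp
  have fe: "U (r + (2*k + i)) j = 0" if "i < r" "j < r" for i j
    using G(7)[OF that] ix[of "r + (2*k + i)" j] that l by simp
  have fg: "U (r + (2*k + i)) (r + b) = 0" if "i < r" "b < 2*k" for i b
    using G(8)[OF that] ix[of "r + (2*k + i)" "r + b"] that l by simp
  have ff: "U (r + (2*k + i)) (r + (2*k + j)) = M $$ (j, i)" if "i < r" "j < r" for i j
    using G(9)[OF that] ix[of "r + (2*k + i)" "r + (2*k + j)"] that l Mc by simp
  define A where "A i j = s (bs ! i) (u (bs ! j))" for i j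
  have Ae: "A i j = U (r + (2*k + i)) j" if "i < r" for i j
    unfolding A_def U_def by (rule mixed_form_e[OF B that])
  have Ag: "A (r + a) j = (if a < k then U (r + (k + a)) j else - U (r + (a - k)) j)" if "a < 2*k" for a j
    unfolding A_def U_def by (rule mixed_form_g[OF B that])
  have Af: "A (r + (2*k + i)) j = - U i j" if "i < r" for i j
    unfolding A_def U_def by (rule mixed_form_f[OF B that])
  have Agg: "A (r + a) (r + b) = (symp_mat k * N) $$ (a, b)" if ab: "a < 2*k" "b < 2*k" for a b
    unfolding Ag[OF ab(1)] symp_mat_mult_index[OF Nc ab] using gg[of "k + a" b] gg[of "a - k" b] ab by auto
  have Agf: "A (r + a) (r + (2*k + j)) = (symp_mat k * P) $$ (a, j)" if aj: "a < 2*k" "j < r" for a j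
    unfolding Ag[OF aj(1)] symp_mat_mult_index[OF P aj] using gf[of "k + a" j] gf[of "a - k" j] aj by auto
  have Age: "A (r + a) j = 0" if aj: "a < 2*k" "j < r" for a j
    unfolding Ag[OF aj(1)] using ge[of "k + a" j] ge[of "a - k" j] aj by auto
  have "N \<in> symp_alt_mats k" using N C by blast
  hence KN: "(symp_mat k * N) $$ (b, a) = - (symp_mat k * N) $$ (a, b)" "(symp_mat k * N) $$ (a, a) = 0"
    if "a < 2*k" "b < 2*k" for a b
    using that unfolding symp_alt_mats_iff[OF Nc] alternating_mats_index_iff[OF KNc] by blast+
  have Ds: "D $$ (j, i) = - D $$ (i, j)" "D $$ (i, i) = 0" if "i < r" "j < r" for i j
    using that D unfolding alternating_mats_index_iff[OF Dc] by blast+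
  have "A j i = - A i j" if ij: "i < r + (2*k + r)" "j < r + (2*k + r)" for i j
    using ij(1)
  proof (cases rule: nat_split3)
    case i: 1
    show ?thesis using ij(2)
    proof (cases rule: nat_split3)
      case 1 thus ?thesis using i by (simp add: Ae fe)
    next
      case 2 thus ?thesis using i by (simp add: Ae Age fg)
    next
      case 3 thus ?thesis using i by (simp add: Ae Af ee ff)
    qed
  next
    case i: (2 a)
    show ?thesis using ij(2)
    proof (cases rule: nat_split3)
      case 1 thus ?thesis using i by (simp add: Ae Age fg)
    next
      case (2 b) thus ?thesis using i KN(1)[of a b] by (simp add: Agg)
    next
      case 3 thus ?thesis using i by (simp add: Agf Af eg)
    qed
  next
    case i: (3 a)
    show ?thesis using ij(2)
    proof (cases rule: nat_split3)
      case 1 thus ?thesis using i by (simp add: Ae Af ee ff)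
    next
      case 2 thus ?thesis using i by (simp add: Agf Af eg)
    next
      case (3 b) thus ?thesis using i Ds(1)[of a b] by (simp add: Af ef)
    qed
  qed
  moreover have "A i i = 0" if "i < r + (2*k + r)" for i
    using that
  proof (cases rule: nat_split3)
    case 1 thus ?thesis by (simp add: Ae fe)
  next
    case (2 a) thus ?thesis using KN(2)[of a a] by (simp add: Agg)
  next
    case (3 a) thus ?thesis using Ds(2)[of a a] by (simp add: Af ef)
  qed
  ultimately have "u \<in> alt_endos"
    unfolding alt_endos_basis_iff[OF bs u] A_def l by blast
  moreover have "u ` seg bs r \<subseteq> seg bs r"
  proof (rule linear_image_seg[OF bs _ u subspace_seg[OF bs]])
    fix j assume j: "j < r"
    show "u (bs ! j) \<in> seg bs r" unfolding seg_def
    proof safe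
      fix i assume i: "i < length bs" "r \<le> i"
      from i(1)[unfolded l] have "U i j = 0"
        by (cases rule: nat_split3) (use i(2) j in \<open>simp_all add: ge fe\<close>)
      thus "coord bs (u (bs ! j)) i = 0" by (simp add: U_def)
    qed
  qed (use l in simp)
  moreover have "blk bs bs 0 r u = M"
  proof (rule eq_matI)
    fix i j assume "i < dim_row M" "j < dim_col M"
    thus "blk bs bs 0 r u $$ (i, j) = M $$ (i, j)" using Mc ee[of i j] by (simp add: blk_def U_def)
  qed (use Mc in \<open>auto simp: blk_def\<close>)
  moreover have "blk bs bs r (2*k) u = N"
  proof (rule eq_matI)
    fix i j assume "i < dim_row N" "j < dim_col N"
    thus "blk bs bs r (2*k) u $$ (i, j) = N $$ (i, j)" using Nc gg[of i j] by (simp add: blk_def U_def)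
  qed (use Nc in \<open>auto simp: blk_def\<close>)
  ultimately show ?thesis using M N by simp
qed

text \<open>Stability of \<open>seg bs r\<close> clears the first block column below its top entry.
  Skewness of \<open>A\<close> does the rest: it clears the \<open>f\<close>-\<open>g\<close> block,
  makes the last diagonal block a transpose, ties the \<open>e\<close>-\<open>g\<close> block to
  \<open>P\<close>, and makes \<open>D\<close> alternating.\<close>

lemma triangle_if:
  assumes B: "mixed_symplectic_basis r k bs"
    and u: "u \<in> alt_endos" "u ` seg bs r \<subseteq> seg bs r"
    and M: "blk bs bs 0 r u \<in> W" and N: "blk bs bs r (2 * k) u \<in> C"
  shows "mat_in_basis bs u \<in> triangle r k W C"
proof -
  note bs = mixed_symplectic_basisD(1)[OF B] and l = mixed_symplectic_basisD(2)[OF B]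
  define U where "U i j = coord bs (u (bs ! j)) i" for i j
  define A where "A i j = s (bs ! i) (u (bs ! j))" for i j
  have Ae: "A i j = U (r + (2*k + i)) j" if "i < r" for i j
    unfolding A_def U_def by (rule mixed_form_e[OF B that])
  have Ag: "A (r + a) j = (if a < k then U (r + (k + a)) j else - U (r + (a - k)) j)" if "a < 2*k" for a j
    unfolding A_def U_def by (rule mixed_form_g[OF B that])
  have Af: "A (r + (2*k + i)) j = - U i j" if "i < r" for i j
    unfolding A_def U_def by (rule mixed_form_f[OF B that])
  have skew: "A j i = - A i j" "A i i = 0" if "i < length bs" "j < length bs" for i j
    using u(1) that unfolding alt_endos_basis_iff[OF bs alt_endos_linear[OF u(1)]] A_def by blast+
  define M' where "M' = blk bs bs 0 r u"
  define N' where "N' = blk bs bs r (2*k) u"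
  define P where "P = mat (2*k) r (\<lambda>(a, j). U (r + a) (r + (2*k + j)))"
  define D where "D = mat r r (\<lambda>(i, j). U i (r + (2*k + j)))"
  have Mc: "M' \<in> carrier_mat r r" and Nc: "N' \<in> carrier_mat (2*k) (2*k)"
    and P: "P \<in> carrier_mat (2*k) r" and Dc: "D \<in> carrier_mat r r"
    by (auto simp: M'_def N'_def P_def D_def)
  have KPc: "symp_mat k * P \<in> carrier_mat (2*k) r" by (rule mult_carrier_mat[OF symp_mat_carrier P])
  have KPt: "transpose_mat (symp_mat k * P) $$ (i, b) = (symp_mat k * P) $$ (b, i)"
    if "i < r" "b < 2*k" for i b
    by (rule index_transpose_mat(1)) (use that carrier_matD[OF KPc] in \<open>simp_all only:\<close>)
  have c: "transpose_mat (symp_mat k * P) \<in> carrier_mat r (2*k)" "0\<^sub>m (2*k) r \<in> carrier_mat (2*k) r"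
    "0\<^sub>m r r \<in> carrier_mat r r" "0\<^sub>m r (2*k) \<in> carrier_mat r (2*k)" "transpose_mat M' \<in> carrier_mat r r"
    using KPc Mc by auto
  have Ue: "U i j = 0" if "r \<le> i" "i < length bs" "j < r" for i j
  proof -
    have "bs ! j \<in> seg bs r" by (rule nth_mem_seg[OF bs]) (use that l in auto)
    hence "u (bs ! j) \<in> seg bs r" using u(2) by blast
    thus ?thesis unfolding U_def using segD that by blast
  qed
  have eg: "U i (r + b) = (symp_mat k * P) $$ (b, i)" if ib: "i < r" "b < 2*k" for i b
  proof -
    have "U i (r + b) = - A (r + (2*k + i)) (r + b)" using Af[OF ib(1)] by simp
    also have "\<dots> = A (r + b) (r + (2*k + i))"
      using skew(1)[of "r + (2*k + i)" "r + b"] ib l by simp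
    also have "\<dots> = (symp_mat k * P) $$ (b, i)"
      unfolding Ag[OF ib(2)] symp_mat_mult_index[OF P ib(2,1)] using ib by (auto simp: P_def)
    finally show ?thesis .
  qed
  have fg: "U (r + (2*k + i)) (r + b) = 0" if ib: "i < r" "b < 2*k" for i b
  proof -
    have "A (r + b) i = 0" unfolding Ag[OF ib(2)] using Ue[of "r + (k + b)" i] Ue[of "r + (b - k)" i] ib l by auto
    moreover have "A i (r + b) = - A (r + b) i" by (rule skew(1)) (use ib l in auto)
    ultimately show ?thesis using Ae[OF ib(1), of "r + b"] by simp
  qed
  have ff: "U (r + (2*k + i)) (r + (2*k + j)) = U j i" if ij: "i < r" "j < r" for i j
  proof -
    have "A i (r + (2*k + j)) = - A (r + (2*k + j)) i" by (rule skew(1)) (use ij l in auto)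
    thus ?thesis unfolding Ae[OF ij(1)] Af[OF ij(2)] by simp
  qed
  have D: "D \<in> alternating_mats r" unfolding alternating_mats_index_iff[OF Dc]
  proof (intro conjI allI impI)
    fix i j assume ij: "i < r" "j < r"
    have D': "D $$ (i, j) = - A (r + (2*k + i)) (r + (2*k + j))" if "i < r" "j < r" for i j
      using that Af by (simp add: D_def)
    have "A (r + (2*k + j)) (r + (2*k + i)) = - A (r + (2*k + i)) (r + (2*k + j))"
      by (rule skew(1)) (use ij l in auto)
    thus "D $$ (j, i) = - D $$ (i, j)" unfolding D'[OF ij] D'[OF ij(2,1)] by simp
  next
    fix i assume i: "i < r"
    have "A (r + (2*k + i)) (r + (2*k + i)) = 0" by (rule skew(2)) (use i l in auto)
    thus "D $$ (i, i) = 0" using i Af by (simp add: D_def)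
  qed
  define X where "X = (M' @\<^sub>c transpose_mat (symp_mat k * P) @\<^sub>c D) @\<^sub>r (0\<^sub>m (2*k) r @\<^sub>c N' @\<^sub>c P) @\<^sub>r
      (0\<^sub>m r r @\<^sub>c 0\<^sub>m r (2*k) @\<^sub>c transpose_mat M')"
  note G = blocks_3x3[OF Mc c(1) Dc c(2) Nc P c(3,4,5), folded X_def]
  have "mat_in_basis bs u = X"
  proof (rule eq_matI)
    fix i j assume "i < dim_row X" "j < dim_col X"
    hence i: "i < r + (2*k + r)" and j: "j < r + (2*k + r)" using G(1) by auto
    have "mat_in_basis bs u $$ (i, j) = U i j"
      unfolding U_def by (rule mat_in_basis_index) (use i j l in auto)
    also have "U i j = X $$ (i, j)" using i
    proof (cases rule: nat_split3)
      case i': 1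
      show ?thesis using j
      proof (cases rule: nat_split3)
        case 1 thus ?thesis using i' G(2)[of i j] by (simp add: M'_def blk_def U_def)
      next
        case (2 b) thus ?thesis using i' G(3)[of i b] eg[of i b] KPt by simp
      next
        case (3 b) thus ?thesis using i' G(4)[of i b] by (simp add: D_def)
      qed
    next
      case i': (2 a)
      show ?thesis using j
      proof (cases rule: nat_split3)
        case 1 thus ?thesis using i' G(5)[of a j] Ue[of i j] l by simp
      next
        case (2 b) thus ?thesis using i' G(6)[of a b] by (simp add: N'_def blk_def U_def)
      next
        case (3 b) thus ?thesis using i' G(7)[of a b] by (simp add: P_def)
      qed
    next
      case i': (3 a)
      show ?thesis using j
      proof (cases rule: nat_split3)
        case 1 thus ?thesis using i' G(8)[of a j] Ue[of i j] l by simp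
      next
        case (2 b) thus ?thesis using i' G(9)[of a b] fg[of a b] by simp
      next
        case (3 b) thus ?thesis using i' G(10)[of a b] ff[of a b] Mc by (simp add: M'_def blk_def U_def)
      qed
    qed
    finally show "mat_in_basis bs u $$ (i, j) = X $$ (i, j)" .
  qed (use G(1) l in \<open>auto simp: mat_in_basis_def\<close>)
  thus ?thesis unfolding triangle_def X_def
    using M N P D unfolding M'_def N'_def by blast
qed

section \<open>Mixed bases adapted to an isotropic subspace\<close>

lemma lagrangian_exists:
  assumes E: "subspace E" "E \<subseteq> perp E"
  shows "\<exists>L. subspace L \<and> E \<subseteq> L \<and> perp L = L"
proof -
  define Q where "Q N \<longleftrightarrow> subspace N \<and> E \<subseteq> N \<and> N \<subseteq> perp N" for N
  have "Q E" using E by (simp add: Q_def)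
  moreover have "\<forall>N. Q N \<longrightarrow> dim N < Suc (dim UNIV)"
    by (simp add: less_Suc_eq_le dim_mono_fin_dim[OF fin_dim subset_UNIV])
  ultimately have "\<exists>L. Q L \<and> (\<forall>N. Q N \<longrightarrow> dim N \<le> dim L)"
    by (rule Lattices_Big.ex_has_greatest_nat)
  then obtain L where L: "Q L" "\<And>N. Q N \<Longrightarrow> dim N \<le> dim L" by metis
  have sL: "subspace L" "E \<subseteq> L" "L \<subseteq> perp L" using L(1) by (simp_all add: Q_def)
  \<comment> \<open>Adjoining to \<open>L\<close> any vector of \<open>perp L\<close> keeps it
    isotropic, so by maximality of the dimension there is no such vector outside
    \<open>L\<close>.\<close>
  have "perp L \<subseteq> L"
  proof (rule subsetI, rule ccontr)
    fix x assume x: "x \<in> perp L" "x \<notin> L"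
    let ?N = "span (insert x L)"
    have LN: "L \<subseteq> ?N" using span_superset by blast
    have "insert x L \<subseteq> perp (insert x L)"
    proof -
      have "s x y = 0" if "y \<in> L" for y
        using x(1) that form_eq_0_commute[of x y] unfolding perp_def by blast
      moreover have "s y x = 0" if "y \<in> L" for y using x(1) that unfolding perp_def by blast
      moreover have "s y z = 0" if "y \<in> L" "z \<in> L" for y z using sL(3) that unfolding perp_def by blast
      ultimately show ?thesis by (simp add: perp_def subset_iff alternating)
    qed
    hence "?N \<subseteq> perp (insert x L)" by (rule span_minimal[OF _ subspace_perp])
    hence "Q ?N" using LN sL(2) by (simp add: Q_def perp_span subset_trans[OF sL(2) LN])
    hence "dim ?N \<le> dim L" by (rule L(2))
    moreover have "dim L < dim ?N"
      by (rule dim_less_fin_dim[OF fin_dim LN sL(1) span_base x(2)]) simp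
    ultimately show False by simp
  qed
  thus ?thesis using sL by blast
qed

text \<open>By independence \<open>es ! j\<close> is not in the span of the other vectors, which is
  their double orthogonal. So some vector orthogonal to the others pairs nontrivially with
  \<open>es ! j\<close>, and it is rescaled.\<close>

lemma dual_vectors_exist:
  assumes es: "distinct es" "independent (set es)"
  shows "\<exists>g. \<forall>i<length es. \<forall>j<length es. s (es ! i) (g j) = (if i = j then 1 else 0)"
proof -
  have "\<exists>y. \<forall>i<length es. s (es ! i) y = (if i = j then 1 else 0)" if j: "j < length es" for j
  proof -
    let ?H = "set es - {es ! j}"
    have "es ! j \<notin> span ?H" using es(2) j unfolding dependent_def by auto
    moreover have "span ?H = perp (perp ?H)" using perp_perp[OF subspace_span, of ?H] by (simp add: perp_span)
    ultimately obtain y where y: "y \<in> perp ?H" "s y (es ! j) \<noteq> 0" unfolding perp_def by blast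
    have nz: "s (es ! j) y \<noteq> 0" using y(2) form_eq_0_commute[of y "es ! j"] by blast
    let ?y = "scale (inverse (s (es ! j) y)) y"
    have "s (es ! i) ?y = (if i = j then 1 else 0)" if i: "i < length es" for i
    proof (cases "i = j")
      case True thus ?thesis using nz by (simp add: form_simps)
    next
      case False
      hence "es ! i \<in> ?H" using es(1) i j by (auto simp: nth_eq_iff_index_eq)
      thus ?thesis using y(1) False by (simp add: perp_def form_simps)
    qed
    thus ?thesis by blast
  qed
  hence "\<forall>j. \<exists>y. j < length es \<longrightarrow> (\<forall>i<length es. s (es ! i) y = (if i = j then 1 else 0))" by blast
  from choice[OF this] show ?thesis by blast
qed

lemma isotropic_dual_vectors_exist:
  assumes es: "distinct es" "independent (set es)" "\<And>x y. x \<in> set es \<Longrightarrow> y \<in> set es \<Longrightarrow> s x y = 0"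
  shows "\<exists>f. (\<forall>i<length es. \<forall>j<length es. s (es ! i) (f j) = (if i = j then 1 else 0)) \<and>
    (\<forall>i<length es. \<forall>j<length es. s (f i) (f j) = 0)"
proof -
  let ?n = "length es"
  obtain g where g: "\<And>i j. i < ?n \<Longrightarrow> j < ?n \<Longrightarrow> s (es ! i) (g j) = (if i = j then 1 else 0)"
    using dual_vectors_exist[OF es(1,2)] by metis
  have ee: "s (es ! i) (es ! j) = 0" if "i < ?n" "j < ?n" for i j using es(3) that by simp
  define h where "h j = (\<Sum>i<j. scale (s (g i) (g j)) (es ! i))" for j
  define f where "f j = g j + h j" for j
  have eh: "s (es ! i) (h j) = 0" if "i < ?n" "j < ?n" for i j
    unfolding h_def form_sum_right form_scale_right using ee that by simp
  have ef: "s (es ! i) (f j) = (if i = j then 1 else 0)" if "i < ?n" "j < ?n" for i j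
    unfolding f_def form_add_right eh[OF that] g[OF that] by simp
  have gh: "s (g i) (h j) = (if i < j then - s (g i) (g j) else 0)" if ij: "i < ?n" "j < ?n" for i j
  proof -
    have "s (g i) (h j) = (\<Sum>m<j. s (g m) (g j) * s (g i) (es ! m))"
      unfolding h_def form_sum_right form_scale_right ..
    also have "\<dots> = (\<Sum>m<j. if m = i then - s (g m) (g j) else 0)"
    proof (intro sum.cong refl)
      fix m assume m: "m \<in> {..<j}"
      have "s (g i) (es ! m) = - s (es ! m) (g i)" by (rule form_skew)
      also have "\<dots> = (if m = i then - 1 else 0)" using g[of m i] m ij by simp
      finally show "s (g m) (g j) * s (g i) (es ! m) = (if m = i then - s (g m) (g j) else 0)" by simp
    qed
    also have "\<dots> = (if i < j then - s (g i) (g j) else 0)" by simp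
    finally show ?thesis .
  qed
  have hh: "s (h i) (h j) = 0" if ij: "i < ?n" "j < ?n" for i j
  proof -
    have "s (es ! m) (h i) = 0" if "m < j" for m using eh that ij by simp
    hence "s (h i) (es ! m) = 0" if "m < j" for m using that form_eq_0_commute[of "h i" "es ! m"] by blast
    thus ?thesis unfolding h_def[of j] form_sum_right form_scale_right by simp
  qed
  have less: "s (f i) (f j) = 0" if ij: "i < j" "j < ?n" for i j
  proof -
    have "s (h i) (g j) = - s (g j) (h i)" by (rule form_skew)
    also have "\<dots> = 0" using gh[of j i] ij by simp
    finally have "s (h i) (g j) = 0" .
    thus ?thesis unfolding f_def form_add_left form_add_right using gh[of i j] hh[of i j] ij by simp
  qed
  have "s (f i) (f j) = 0" if ij: "i < ?n" "j < ?n" for i j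
  proof -
    consider "i < j" | "i = j" | "j < i" by linarith
    thus ?thesis
    proof cases
      case 1 thus ?thesis using less ij by blast
    next
      case 2 thus ?thesis by (simp add: alternating)
    next
      case 3 thus ?thesis using less[of j i] ij form_eq_0_commute[of "f i" "f j"] by blast
    qed
  qed
  thus ?thesis using ef by blast
qed

text \<open>Pairing a linear relation with the partner of a basis vector isolates the coefficient of
  that vector, so the list is independent; the dimension then makes it spanning.\<close>

lemma ordered_basis_if_gram:
  assumes l: "length bs = r + (2 * k + r)" "dim UNIV = length bs"
    and gram: "\<And>i j. i < length bs \<Longrightarrow> j < length bs \<Longrightarrow>
      s (bs ! i) (bs ! j) = (if j = partner r k i then partner_sign r k i else 0)"
  shows "ordered_basis bs"
proof -
  have p: "partner r k i < length bs" "partner r k (partner r k i) = i" if "i < length bs" for i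
    using that partner_less partner_partner unfolding l(1) by blast+
  have sg: "(partner_sign r k i :: 'a) \<noteq> 0" for i by (simp add: partner_sign_def)
  have dist: "distinct bs" unfolding distinct_conv_nth
  proof (intro allI impI notI)
    fix i j assume ij: "i < length bs" "j < length bs" "i \<noteq> j" "bs ! i = bs ! j"
    have "s (bs ! i) (bs ! partner r k i) \<noteq> 0" using gram[OF ij(1) p(1)[OF ij(1)]] sg by simp
    moreover have "partner r k i \<noteq> partner r k j" using p(2)[OF ij(1)] p(2)[OF ij(2)] ij(3) by metis
    hence "s (bs ! j) (bs ! partner r k i) = 0" using gram[OF ij(2) p(1)[OF ij(1)]] by simp
    ultimately show False using ij(4) by simp
  qed
  have indep: "independent (set bs)"
  proof (rule independent_if_scalars_zero)
    fix f x assume z: "(\<Sum>x\<in>set bs. scale (f x) x) = 0" and "x \<in> set bs"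
    then obtain j where j: "j < length bs" "x = bs ! j" by (auto simp: in_set_conv_nth)
    define i where "i = partner r k j"
    have i: "i < length bs" "partner r k i = j" using p[OF j(1)] by (simp_all add: i_def)
    have bij: "bij_betw ((!) bs) {..<length bs} (set bs)" by (rule bij_betw_nth[OF dist]) simp_all
    have "0 = s (bs ! i) (\<Sum>x\<in>set bs. scale (f x) x)" unfolding z by simp
    also have "\<dots> = (\<Sum>x\<in>set bs. f x * s (bs ! i) x)" by (simp only: form_sum_right form_scale_right)
    also have "\<dots> = (\<Sum>m<length bs. f (bs ! m) * s (bs ! i) (bs ! m))"
      by (rule sum.reindex_bij_betw[OF bij, symmetric])
    also have "\<dots> = (\<Sum>m<length bs. if m = j then f (bs ! m) * partner_sign r k i else 0)"
      by (intro sum.cong refl) (use gram[OF i(1)] i(2) in simp)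
    also have "\<dots> = f x * partner_sign r k i" using j by simp
    finally show "f x = 0" using sg[of i] by simp
  qed simp
  have "dim (span (set bs)) = length bs"
    using dim_span_eq_card_independent[OF indep] distinct_card[OF dist] by simp
  hence "span (set bs) = UNIV"
    using subspace_eq_if_dim_le[OF fin_dim subset_UNIV subspace_span, of "set bs"] l(2) by simp
  thus ?thesis using dist indep by (simp add: ordered_basis_def)
qed

text \<open>A basis of \<open>E\<close> is extended to a Lagrangian space containing it and then
  completed by dual vectors. The dual pairs that do not involve \<open>E\<close> supply the block
  \<open>g\<close>.\<close>

lemma mixed_basis_exists:
  assumes E: "subspace E" "E \<subseteq> perp E" and n: "dim UNIV = 2 * n"
  shows "\<exists>bs. dim E \<le> n \<and> mixed_symplectic_basis (dim E) (n - dim E) bs \<and> seg bs (dim E) = E"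
proof -
  obtain L where L: "subspace L" "E \<subseteq> L" "perp L = L" using lagrangian_exists[OF E] by blast
  have dL: "dim L = n" using dim_perp[OF L(1)] L(3) n by simp
  obtain B1 where B1: "B1 \<subseteq> E" "independent B1" "E \<subseteq> span B1" "card B1 = dim E" by (rule basis_exists)
  obtain B2 where B2: "B1 \<subseteq> B2" "B2 \<subseteq> L" "independent B2" "L \<subseteq> span B2"
    using maximal_independent_subset_extend[of B1 L] B1(1,2) L(2) by blast
  have fin: "finite B2" "card B2 = n"
    using fin_dim_independent(1)[OF fin_dim B2(2,3)] basis_card_eq_dim[OF B2(2,4,3)] dL by simp_all
  have fin1: "finite B1" by (rule finite_subset[OF B2(1) fin(1)])
  obtain es1 where es1: "set es1 = B1" "distinct es1" using finite_distinct_list[OF fin1] by blast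
  obtain es2 where es2: "set es2 = B2 - B1" "distinct es2" using finite_distinct_list[of "B2 - B1"] fin(1) by blast
  define es where "es = es1 @ es2"
  have es: "set es = B2" "distinct es" using es1 es2 B2(1) by (auto simp: es_def)
  have len: "length es = n" "length es1 = dim E"
    using distinct_card[OF es(2)] distinct_card[OF es1(2)] es(1) es1(1) fin(2) B1(4) by simp_all
  define r where "r = dim E"
  define k where "k = n - r"
  have rn: "r \<le> n" using len by (simp add: es_def r_def)
  hence nrk: "n = r + k" by (simp add: k_def)
  have iso: "s x y = 0" if "x \<in> set es" "y \<in> set es" for x y
    using that B2(2) L(3) unfolding es(1) perp_def by blast
  have "independent (set es)" using B2(3) es(1) by simp
  from isotropic_dual_vectors_exist[OF es(2) this iso] obtain f where
    f: "\<And>i j. i < n \<Longrightarrow> j < n \<Longrightarrow> s (es ! i) (f j) = (if i = j then 1 else 0)"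
       "\<And>i j. i < n \<Longrightarrow> j < n \<Longrightarrow> s (f i) (f j) = 0" unfolding len(1) by blast
  have ee: "s (es ! i) (es ! j) = 0" if "i < n" "j < n" for i j
    by (rule iso) (use that len in auto)
  \<comment> \<open>For a position \<open>i \<ge> n\<close> of \<open>bs\<close>, \<open>t i\<close>
    is the index of the dual vector placed there. The list is \<open>es\<close>, then the duals of
    the vectors outside \<open>E\<close> (second half of the \<open>g\<close>-block), then the duals
    of the basis of \<open>E\<close>; hence \<open>t\<close> is \<open>partner\<close> on these
    positions.\<close>
  define t where "t i = (if i < r + 2 * k then i - k else i - (r + 2 * k))" for i
  define bs where "bs = es @ map f ([r..<n] @ [0..<r])"
  have l: "length bs = r + (2 * k + r)" unfolding bs_def using len nrk by simp
  have tn: "t i < n" if "n \<le> i" "i < length bs" for i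
    using that unfolding l t_def nrk by auto
  have nth1: "bs ! i = es ! i" if "i < n" for i using that len by (simp add: bs_def nth_append)
  have nth2: "bs ! i = f (t i)" if i: "n \<le> i" "i < length bs" for i
  proof -
    obtain j where j: "i = n + j" using i(1) le_Suc_ex by blast
    have jl: "j < k + r" using i(2) unfolding j l nrk by simp
    have "bs ! i = map f ([r..<n] @ [0..<r]) ! j" unfolding bs_def j using len by (simp add: nth_append)
    also have "\<dots> = f (([r..<n] @ [0..<r]) ! j)" by (rule nth_map) (use jl nrk in simp)
    also have "([r..<n] @ [0..<r]) ! j = t i" using jl unfolding j t_def nrk by (simp add: nth_append)
    finally show ?thesis .
  qed
  have gram: "s (bs ! i) (bs ! j) = (if j = partner r k i then partner_sign r k i else 0)"
    if i: "i < length bs" and j: "j < length bs" for i j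
  proof (cases "i < n")
    case i': True
    show ?thesis
    proof (cases "j < n")
      case True
      have "j \<noteq> partner r k i" using True i' unfolding partner_def nrk by auto
      thus ?thesis using True i' by (simp add: nth1 ee)
    next
      case False
      hence j': "n \<le> j" by simp
      have "i = t j \<longleftrightarrow> j = partner r k i" using i' j' j unfolding partner_def t_def nrk l by auto
      moreover have "(partner_sign r k i :: 'a) = 1" using i' nrk by (simp add: partner_sign_def)
      ultimately show ?thesis
        unfolding nth1[OF i'] nth2[OF j' j] f(1)[OF i' tn[OF j' j]] by simp
    qed
  next
    case False
    hence i': "n \<le> i" by simp
    have pi: "partner r k i = t i" using i' i unfolding partner_def t_def nrk l by auto
    have sg: "(partner_sign r k i :: 'a) = - 1" using i' nrk by (simp add: partner_sign_def)
    show ?thesis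
    proof (cases "j < n")
      case True
      have "s (f (t i)) (es ! j) = - s (es ! j) (f (t i))" by (rule form_skew)
      thus ?thesis unfolding nth1[OF True] nth2[OF i' i] f(1)[OF True tn[OF i' i]] pi sg by simp
    next
      case False
      hence j': "n \<le> j" by simp
      have "j \<noteq> t i" using tn[OF i' i] j' by simp
      thus ?thesis unfolding nth2[OF i' i] nth2[OF j' j] f(2)[OF tn[OF i' i] tn[OF j' j]] pi by simp
    qed
  qed
  have "dim UNIV = length bs" using n l nrk by simp
  from ordered_basis_if_gram[OF l this gram] have ob: "ordered_basis bs" .
  have mb: "mixed_symplectic_basis r k bs"
    unfolding mixed_symplectic_basis_iff using ob l gram by blast
  have "take r bs = es1" unfolding bs_def es_def using len by (simp add: r_def)
  hence "seg bs r = span B1" using seg_eq_span[OF ob, of r] l es1(1) by simp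
  also have "\<dots> = E" using span_minimal[OF B1(1) E(1)] B1(3) by blast
  finally have "seg bs r = E" .
  thus ?thesis using mb rn unfolding k_def r_def by blast
qed

end

section \<open>Optimality of the diagonal blocks\<close>

text \<open>Functions on pairs of indices form one type that receives square matrices of every size;
  it is the target of the map used with \<open>mat_subspace_dim_eq\<close>.\<close>

lemma vector_space_index_functions:
  "vector_space (\<lambda>c (f :: nat \<times> nat \<Rightarrow> 'a::field) x. c * f x)"
  by unfold_locales (auto simp: fun_eq_iff algebra_simps)

context symplectic_space
begin

text \<open>If \<open>S\<close> is cut out of \<open>R\<close> by the condition that the block lies in \<open>W\<close>, then replacing \<open>W\<close> by
  another trivial spectrum subspace \<open>T\<close> changes the dimension of \<open>S\<close> by \<open>dim T - dim W\<close>.\<close>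
lemma optimal_block:
  assumes S: "optimal_trivial_spectrum S" and bs: "ordered_basis bs"
    and R: "Fun.subspace R" "R \<subseteq> alt_endos"
    and A: "A \<subseteq> carrier_mat m m"
    and SR: "S = {u \<in> R. blk bs bs a m u \<in> W}"
    and surj: "\<And>N. N \<in> A \<Longrightarrow> \<exists>u\<in>R. blk bs bs a m u = N"
    and W: "W \<subseteq> A" "mat_subspace m W"
    and inv: "\<And>u. u \<in> S \<Longrightarrow> invertible_mat (1\<^sub>m m - blk bs bs a m u)"
    and bij: "\<And>u. u \<in> R \<Longrightarrow> invertible_mat (1\<^sub>m m - blk bs bs a m u) \<Longrightarrow> bij (\<lambda>x. x - u x)"
  shows "optimal_trivial_spectrum_mats m A W"
  unfolding optimal_trivial_spectrum_mats_def
proof (intro conjI allI impI)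
  note S' = optimal_trivial_spectrumD[OF S]
  let ?b = "blk bs bs a m"
  have WS: "\<exists>u\<in>S. ?b u = M" if "M \<in> W" for M
  proof -
    have "M \<in> A" using that W(1) by blast
    from surj[OF this] obtain u where "u \<in> R" "?b u = M" by blast
    thus ?thesis using that SR by blast
  qed
  show "trivial_spectrum_mats m W" unfolding trivial_spectrum_mats_def
  proof
    fix M assume "M \<in> W"
    then obtain u where "u \<in> S" "?b u = M" using WS by blast
    thus "invertible_mat (1\<^sub>m m - M)" using inv by blast
  qed
  fix T assume T: "mat_subspace m T \<and> T \<subseteq> A \<and> trivial_spectrum_mats m T"
  define S1 where "S1 = {u \<in> R. ?b u \<in> T}"
  have ms: "0\<^sub>m m m \<in> X" "\<And>A B. A \<in> X \<Longrightarrow> B \<in> X \<Longrightarrow> A + B \<in> X" "\<And>c A. A \<in> X \<Longrightarrow> c \<cdot>\<^sub>m A \<in> X"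
    if "mat_subspace m X" for X :: "'a mat set"
    using that unfolding mat_subspace_iff by blast+
  have mT: "mat_subspace m T" using T by blast
  have subS1: "Fun.subspace S1"
  proof (rule Fun.subspaceI)
    show "0 \<in> S1" using Fun.subspace_0[OF R(1)] ms(1)[OF mT] by (simp add: S1_def blk_zero[OF bs])
    show "u + v \<in> S1" if "u \<in> S1" "v \<in> S1" for u v
      using that Fun.subspace_add[OF R(1)] ms(2)[OF mT] by (simp add: S1_def blk_add[OF bs])
    show "(\<lambda>x. scale c (u x)) \<in> S1" if "u \<in> S1" for c u
      using that Fun.subspace_scale[OF R(1)] ms(3)[OF mT] by (simp add: S1_def blk_scale[OF bs])
  qed
  have S1A: "S1 \<subseteq> alt_endos" using R(2) by (auto simp: S1_def)
  have "bij (\<lambda>x. x - u x)" if u: "u \<in> S1" for u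
    by (rule bij) (use u T in \<open>auto simp: S1_def trivial_spectrum_mats_def\<close>)
  hence le: "Fun.dim S1 \<le> Fun.dim S" by (rule S'(4)[OF subS1 S1A])
  define \<phi> where "\<phi> M = (\<lambda>(i, j). if i < m \<and> j < m then M $$ (i, j) else 0)" for M :: "'a mat"
  interpret N: vector_space "\<lambda>c (f :: nat \<times> nat \<Rightarrow> 'a) x. c * f x" by (rule vector_space_index_functions)
  have \<phi>: "\<And>A B. A \<in> carrier_mat m m \<Longrightarrow> B \<in> carrier_mat m m \<Longrightarrow> \<phi> (A + B) = \<phi> A + \<phi> B"
    "\<And>c A. A \<in> carrier_mat m m \<Longrightarrow> \<phi> (c \<cdot>\<^sub>m A) = (\<lambda>x. c * \<phi> A x)"
    by (auto simp: \<phi>_def fun_eq_iff)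
  have inj: "inj_on \<phi> (carrier_mat m m)"
  proof (rule inj_onI)
    fix A B assume AB: "A \<in> carrier_mat m m" "B \<in> carrier_mat m m" "\<phi> A = \<phi> B"
    show "A = B"
    proof (rule eq_matI)
      fix i j assume "i < dim_row B" "j < dim_col B"
      hence ij: "i < m" "j < m" using AB by auto
      have "\<phi> A (i, j) = \<phi> B (i, j)" by (simp only: AB(3))
      thus "A $$ (i, j) = B $$ (i, j)" using ij by (simp add: \<phi>_def)
    qed (use AB in auto)
  qed
  define f where "f u = \<phi> (?b u)" for u
  have linf: "Vector_Spaces.linear (\<lambda>c u x. scale c (u x)) (\<lambda>c f x. c * f x) f"
    unfolding Vector_Spaces.linear_iff
    by (simp add: f_def blk_add[OF bs] blk_scale[OF bs] \<phi> Fun.vector_space_axioms N.vector_space_axioms)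
  interpret f: Vector_Spaces.linear "\<lambda>c u x. scale c (u x)" "\<lambda>c f x. c * f x" f by (rule linf)
  have f0: "f u = 0 \<longleftrightarrow> ?b u = 0\<^sub>m m m" for u
  proof -
    have "\<phi> (0\<^sub>m m m) = 0" by (auto simp: \<phi>_def fun_eq_iff)
    moreover have "\<phi> (?b u) = \<phi> (0\<^sub>m m m) \<longleftrightarrow> ?b u = 0\<^sub>m m m"
      by (rule inj_on_eq_iff[OF inj]) simp_all
    ultimately show ?thesis by (simp add: f_def)
  qed
  note rn = vector_space_pair.rank_nullity[OF vector_space_pair.intro[OF Fun.vector_space_axioms
        N.vector_space_axioms] linf]
  have 1: "Fun.dim S = Fun.dim {u \<in> S. f u = 0} + N.dim (f ` S)"
    by (rule rn[OF S'(1) fin_dim_alt_endos[OF S'(2)]])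
  have 2: "Fun.dim S1 = Fun.dim {u \<in> S1. f u = 0} + N.dim (f ` S1)"
    by (rule rn[OF subS1 fin_dim_alt_endos[OF S1A]])
  \<comment> \<open>Both kernels consist of the elements of \<open>R\<close> with zero block, so the
    dimensions of \<open>S\<close> and \<open>S1\<close> differ only through the images.\<close>
  have K: "{u \<in> S1. f u = 0} = {u \<in> S. f u = 0}"
    unfolding f0 SR S1_def using ms(1)[OF mT] ms(1)[OF W(2)] by auto
  have fW: "f ` S = \<phi> ` W"
  proof
    show "f ` S \<subseteq> \<phi> ` W" using SR unfolding f_def by blast
    show "\<phi> ` W \<subseteq> f ` S" using WS unfolding f_def by blast
  qed
  have fT: "f ` S1 = \<phi> ` T"
  proof
    show "f ` S1 \<subseteq> \<phi> ` T" unfolding f_def S1_def by blast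
    show "\<phi> ` T \<subseteq> f ` S1"
    proof
      fix y assume "y \<in> \<phi> ` T"
      then obtain M where M: "M \<in> T" "y = \<phi> M" by blast
      then obtain u where "u \<in> R" "?b u = M" using surj[of M] T by blast
      thus "y \<in> f ` S1" using M unfolding f_def S1_def by blast
    qed
  qed
  have fd: "N.fin_dim (f ` X)" if XA: "X \<subseteq> alt_endos" for X
  proof -
    obtain Y where "finite Y" "X \<subseteq> Fun.span Y"
      using fin_dim_alt_endos[OF XA] unfolding Fun.fin_dim_def by blast
    hence "finite (f ` Y)" "f ` X \<subseteq> N.span (f ` Y)" using f.span_image by blast+
    thus ?thesis unfolding N.fin_dim_def by blast
  qed
  have "mat_subspace_dim m W = N.dim (\<phi> ` W)"
    by (rule N.mat_subspace_dim_eq[OF W(2) \<phi> inj]) (use fd[OF S'(2)] fW in simp_all)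
  moreover have "mat_subspace_dim m T = N.dim (\<phi> ` T)"
    by (rule N.mat_subspace_dim_eq[OF mT \<phi> inj]) (use fd[OF S1A] fT in simp_all)
  ultimately show "mat_subspace_dim m T \<le> mat_subspace_dim m W"
    using 1 2 le unfolding K fW fT by simp
qed (use W in simp_all)

lemma mat_subspace_blk_image:
  assumes bs: "ordered_basis bs" and S: "Fun.subspace S"
  shows "mat_subspace m (blk bs bs a m ` S)"
  unfolding mat_subspace_iff
proof (intro conjI ballI allI)
  show "0\<^sub>m m m \<in> blk bs bs a m ` S" using Fun.subspace_0[OF S] blk_zero[OF bs, of bs a m] by (metis image_eqI)
  fix A assume "A \<in> blk bs bs a m ` S"
  then obtain u where u: "A = blk bs bs a m u" "u \<in> S" by blast
  show "c \<cdot>\<^sub>m A \<in> blk bs bs a m ` S" for c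
    unfolding u(1) blk_scale[OF bs, symmetric] using Fun.subspace_scale[OF S u(2)] by blast
  fix B assume "B \<in> blk bs bs a m ` S"
  then obtain v where v: "B = blk bs bs a m v" "v \<in> S" by blast
  show "A + B \<in> blk bs bs a m ` S"
    unfolding u(1) v(1) blk_add[OF bs, symmetric] using Fun.subspace_add[OF S u(2) v(2)] by blast
qed auto

text \<open>The two conditions of \<open>bij_id_minus_isotropic_iff\<close> for the isotropic space
  \<open>seg bs r\<close>, read in coordinates as the cases \<open>a = 0\<close> and
  \<open>a = r\<close>.\<close>

lemma bij_id_minus_blk_iff:
  assumes B: "mixed_symplectic_basis r k bs" and u: "u \<in> alt_endos" "u ` seg bs r \<subseteq> seg bs r"
  shows "bij (\<lambda>x. x - u x) \<longleftrightarrow>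
    invertible_mat (1\<^sub>m r - blk bs bs 0 r u) \<and> invertible_mat (1\<^sub>m (2 * k) - blk bs bs r (2 * k) u)"
proof -
  note bs = mixed_symplectic_basisD(1)[OF B] and l = mixed_symplectic_basisD(2)[OF B]
  note lin = alt_endos_linear[OF u(1)]
  have p: "u ` seg bs (r + 2 * k) \<subseteq> seg bs (r + 2 * k)"
    using perp_invariant[OF u] unfolding perp_seg[OF B] .
  have "invertible_mat (1\<^sub>m r - blk bs bs 0 r u) \<longleftrightarrow>
      (\<forall>z\<in>seg bs (0 + r). z - u z \<in> seg bs 0 \<longrightarrow> z \<in> seg bs 0)"
  proof (rule blk_invertible_iff[OF bs _ lin])
    show "u ` seg bs 0 \<subseteq> seg bs 0" unfolding seg_0[OF bs] using alt_endos_simps(4)[OF u(1)] by simp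
  qed (use l u(2) in simp_all)
  also have "\<dots> \<longleftrightarrow> (\<forall>z\<in>seg bs r. u z = z \<longrightarrow> z = 0)"
  proof -
    have "z - u z \<in> {0} \<longleftrightarrow> u z = z" for z by (metis right_minus_eq singleton_iff)
    thus ?thesis unfolding seg_0[OF bs] by simp
  qed
  finally have 1: "invertible_mat (1\<^sub>m r - blk bs bs 0 r u) \<longleftrightarrow> (\<forall>z\<in>seg bs r. u z = z \<longrightarrow> z = 0)" .
  have 2: "invertible_mat (1\<^sub>m (2 * k) - blk bs bs r (2 * k) u) \<longleftrightarrow>
      (\<forall>z\<in>seg bs (r + 2 * k). z - u z \<in> seg bs r \<longrightarrow> z \<in> seg bs r)"
    by (rule blk_invertible_iff[OF bs _ lin u(2) p]) (use l in simp)
  show ?thesis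
    unfolding 1 2 using bij_id_minus_isotropic_iff[OF u(1) subspace_seg[OF bs] seg_isotropic[OF B] u(2)]
    unfolding perp_seg[OF B] .
qed

text \<open>The witness is block diagonal, with zero in place of \<open>B\<close> and
  \<open>D\<close> in the triangle pattern; \<open>triangle_imp\<close> certifies that it is
  alternating.\<close>

lemma alt_endo_with_blocks_exists:
  assumes B: "mixed_symplectic_basis r k bs" and M: "M \<in> carrier_mat r r" and N: "N \<in> symp_alt_mats k"
  shows "\<exists>u. u \<in> alt_endos \<and> u ` seg bs r \<subseteq> seg bs r \<and> blk bs bs 0 r u = M \<and> blk bs bs r (2 * k) u = N"
proof -
  note bs = mixed_symplectic_basisD(1)[OF B] and l = mixed_symplectic_basisD(2)[OF B]
  define X where "X = (M @\<^sub>c transpose_mat (symp_mat k * 0\<^sub>m (2*k) r) @\<^sub>c 0\<^sub>m r r) @\<^sub>r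
      (0\<^sub>m (2*k) r @\<^sub>c N @\<^sub>c 0\<^sub>m (2*k) r) @\<^sub>r (0\<^sub>m r r @\<^sub>c 0\<^sub>m r (2*k) @\<^sub>c transpose_mat M)"
  have Nc: "N \<in> carrier_mat (2*k) (2*k)" using N by (simp add: symp_alt_mats_def)
  have z: "0\<^sub>m r r \<in> alternating_mats r" by (auto simp: alternating_mats_def)
  have X: "X \<in> triangle r k {M} {N}"
    unfolding triangle_def X_def using z zero_carrier_mat by blast
  have KP: "symp_mat k * 0\<^sub>m (2*k) r \<in> carrier_mat (2*k) r" by (rule mult_carrier_mat[OF symp_mat_carrier]) simp
  have Xc: "X \<in> carrier_mat (length bs) (length bs)"
    unfolding l X_def by (rule blocks_3x3) (use M Nc KP in \<open>auto simp del: index_mult_mat\<close>)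
  from linear_with_coords_exists[OF bs, of "\<lambda>i j. X $$ (i, j)"] obtain u
    where u: "Vector_Spaces.linear scale scale u"
      "\<And>i j. i < length bs \<Longrightarrow> j < length bs \<Longrightarrow> coord bs (u (bs ! j)) i = X $$ (i, j)" by blast
  have "mat_in_basis bs u = X"
    by (rule eq_matI) (use Xc u(2) in \<open>auto simp: mat_in_basis_index mat_in_basis_def coord_def\<close>)
  thus ?thesis using triangle_imp[OF B u(1), of "{M}" "{N}"] X M N by auto
qed

text \<open>Supplies the space \<open>R\<close> of \<open>optimal_block\<close>: one diagonal block
  is confined to a fixed matrix space while the other is free to vary.\<close>

lemma subspace_with_block:
  assumes bs: "ordered_basis bs" and W: "mat_subspace m W"
  shows "Fun.subspace {u \<in> alt_endos. u ` seg bs r \<subseteq> seg bs r \<and> blk bs bs a m u \<in> W}" (is "Fun.subspace ?R")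
proof (rule Fun.subspaceI)
  have ms: "0\<^sub>m m m \<in> W" "\<And>A B. A \<in> W \<Longrightarrow> B \<in> W \<Longrightarrow> A + B \<in> W" "\<And>c A. A \<in> W \<Longrightarrow> c \<cdot>\<^sub>m A \<in> W"
    using W unfolding mat_subspace_iff by blast+
  note sub = subspace_seg[OF bs, of r]
  show "0 \<in> ?R" using Fun.subspace_0[OF subspace_alt_endos] ms(1) subspace_0[OF sub]
    by (auto simp: blk_zero[OF bs])
  show "u + v \<in> ?R" if uv: "u \<in> ?R" "v \<in> ?R" for u v
  proof -
    have "u x + v x \<in> seg bs r" if "x \<in> seg bs r" for x
      by (rule subspace_add[OF sub]) (use uv that in blast)+
    thus ?thesis using uv Fun.subspace_add[OF subspace_alt_endos] ms(2) by (auto simp: blk_add[OF bs])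
  qed
  show "(\<lambda>x. scale c (u x)) \<in> ?R" if u: "u \<in> ?R" for c u
  proof -
    have "scale c (u x) \<in> seg bs r" if "x \<in> seg bs r" for x
      by (rule subspace_scale[OF sub]) (use u that in blast)
    thus ?thesis using u Fun.subspace_scale[OF subspace_alt_endos] ms(3) by (auto simp: blk_scale[OF bs])
  qed
qed

section \<open>Decompositions\<close>

lemma optimal_decomposition_exists:
  assumes S: "optimal_trivial_spectrum S" and n: "dim UNIV = 2 * n"
  shows "\<exists>r bs W C. optimal_decomposition n S r bs W C"
proof -
  note S' = optimal_trivial_spectrumD[OF S]
  obtain E where E: "irreducible_flag S E" using irreducible_flag_exists[OF S] by blast
  note D = irreducible_flagD[OF E]
  define r where "r = dim E"
  define k where "k = n - r"
  obtain bs where rn: "r \<le> n" and B: "mixed_symplectic_basis r k bs" and seg: "seg bs r = E"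
    using mixed_basis_exists[OF D(3,2) n] unfolding r_def k_def by blast
  note bs = mixed_symplectic_basisD(1)[OF B] and l = mixed_symplectic_basisD(2)[OF B]
  note pE = perp_seg[OF B, unfolded seg]
  define W where "W = blk bs bs 0 r ` S"
  define C where "C = blk bs bs r (2*k) ` S"
  have alt: "u \<in> alt_endos" if "u \<in> S" for u using that S'(2) by blast
  have inv: "u ` E \<subseteq> E" if "u \<in> S" for u using D(1) that by (simp add: stable_def)
  have Wc: "W \<subseteq> carrier_mat r r" by (auto simp: W_def)
  have blk_alt: "blk bs bs r (2*k) u \<in> symp_alt_mats k" if u: "u \<in> alt_endos" "u ` E \<subseteq> E" for u
    unfolding symp_alt_mats_def
  proof (intro CollectI conjI ballI)
    fix v :: "'a vec" assume v: "v \<in> carrier_vec (2*k)"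
    have l': "r + 2 * k \<le> length bs" using l by simp
    obtain z where z: "z \<in> seg bs (r + 2*k)" "vc bs r (2*k) z = v" using vc_surj[OF bs l' v] by blast
    have "u z \<in> seg bs (r + 2*k)" using perp_invariant[OF u] z(1) unfolding pE by blast
    hence "symp_form k v (blk bs bs r (2*k) u *\<^sub>v v) = s z (u z)"
      unfolding z(2)[symmetric] vc_apply[OF bs bs l' refl alt_endos_linear[OF u(1)] u(2)[folded seg] z(1), symmetric]
      by (rule symp_form_vc[OF B z(1)])
    thus "symp_form k v (blk bs bs r (2*k) u *\<^sub>v v) = 0" using u(1) by (simp add: alt_endos_def)
  qed simp
  have Cc: "C \<subseteq> symp_alt_mats k" using blk_alt alt inv by (auto simp: C_def)
  \<comment> \<open>The memberships in \<open>W\<close> and \<open>C\<close> may come from different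
    elements \<open>v\<close> and \<open>w\<close> of \<open>S\<close>. Equal blocks mean
    \<open>u = v\<close> on \<open>E\<close> and \<open>u = w\<close> on \<open>perp E\<close>
    modulo \<open>E\<close>, which is the situation of \<open>optimal_mem\<close>.\<close>
  have S_eq: "u \<in> S \<longleftrightarrow> u \<in> alt_endos \<and> u ` E \<subseteq> E \<and> blk bs bs 0 r u \<in> W \<and> blk bs bs r (2*k) u \<in> C" for u
  proof
    assume *: "u \<in> alt_endos \<and> u ` E \<subseteq> E \<and> blk bs bs 0 r u \<in> W \<and> blk bs bs r (2*k) u \<in> C"
    then obtain v w where v: "v \<in> S" "blk bs bs 0 r u = blk bs bs 0 r v"
      and w: "w \<in> S" "blk bs bs r (2*k) u = blk bs bs r (2*k) w" unfolding W_def C_def by blast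
    have u: "u \<in> alt_endos" "u ` E \<subseteq> E" using * by blast+
    have s0: "f ` seg bs 0 \<subseteq> seg bs 0" if "f \<in> alt_endos" for f
      unfolding seg_0[OF bs] using alt_endos_simps(4)[OF that] by simp
    have sp: "f ` seg bs (r + 2*k) \<subseteq> seg bs (r + 2*k)" if "f \<in> alt_endos" "f ` E \<subseteq> E" for f
      using perp_invariant[OF that] unfolding pE .
    show "u \<in> S"
    proof (rule optimal_mem[OF S D(1,2) u v(1) _ w(1)])
      fix x assume x: "x \<in> E"
      \<comment> \<open>As \<open>seg bs 0\<close> is the zero space, the case \<open>a = 0\<close>
        of the block comparison yields equality.\<close>
      have "u x - v x \<in> seg bs 0"
      proof (rule blk_eq_imp[where a = 0 and m = r and u = u and w = v and z = x, OF bs])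
        show "u ` seg bs (0 + r) \<subseteq> seg bs (0 + r)" using u(2) seg by simp
        show "v ` seg bs (0 + r) \<subseteq> seg bs (0 + r)" using inv[OF v(1)] seg by simp
        show "x \<in> seg bs (0 + r)" using x seg by simp
      qed (use l in \<open>simp_all add: alt_endos_linear u(1) alt[OF v(1)] s0 v(2)\<close>)
      thus "u x = v x" unfolding seg_0[OF bs] by simp
    next
      fix x assume x: "x \<in> perp E"
      have "u x - w x \<in> seg bs r"
      proof (rule blk_eq_imp[where a = r and m = "2*k" and u = u and w = w and z = x, OF bs])
        show "u ` seg bs r \<subseteq> seg bs r" using u(2) seg by simp
        show "w ` seg bs r \<subseteq> seg bs r" using inv[OF w(1)] seg by simp
        show "x \<in> seg bs (r + 2 * k)" using x pE by simp
      qed (use l in \<open>simp_all add: alt_endos_linear u alt[OF w(1)] inv[OF w(1)] sp w(2)\<close>)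
      thus "u x - w x \<in> E" unfolding seg .
    qed
  qed (use alt inv in \<open>auto simp: W_def C_def\<close>)
  have subW: "mat_subspace r W" and subC: "mat_subspace (2*k) C"
    unfolding W_def C_def by (rule mat_subspace_blk_image[OF bs S'(1)])+
  have bij_iff: "bij (\<lambda>x. x - u x) \<longleftrightarrow> invertible_mat (1\<^sub>m r - blk bs bs 0 r u) \<and>
      invertible_mat (1\<^sub>m (2*k) - blk bs bs r (2*k) u)" if "u \<in> alt_endos" "u ` E \<subseteq> E" for u
    by (rule bij_id_minus_blk_iff[OF B that(1)]) (use that(2) seg in simp)
  have invS: "invertible_mat (1\<^sub>m r - blk bs bs 0 r u)" "invertible_mat (1\<^sub>m (2*k) - blk bs bs r (2*k) u)"
    if "u \<in> S" for u
    using bij_iff[OF alt[OF that] inv[OF that]] S'(3)[OF that] by blast+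
  have zW: "0\<^sub>m r r \<in> W" and zC: "0\<^sub>m (2*k) (2*k) \<in> C"
    using subW subC unfolding mat_subspace_iff by blast+
  have ex: "\<exists>u. u \<in> alt_endos \<and> u ` E \<subseteq> E \<and> blk bs bs 0 r u = M \<and> blk bs bs r (2*k) u = N"
    if "M \<in> carrier_mat r r" "N \<in> symp_alt_mats k" for M N
    using alt_endo_with_blocks_exists[OF B that] unfolding seg .
  \<comment> \<open>The second block stays in \<open>C\<close>, hence is harmless for the spectrum,
    while the first ranges over all matrices; any of them is realised with second block 0.\<close>
  have optW: "optimal_trivial_spectrum_mats r (carrier_mat r r) W"
  proof (rule optimal_block[OF S bs subspace_with_block[OF bs subC, of r r] _ order_refl _ _ Wc subW invS(1)])
    show "S = {u \<in> {u \<in> alt_endos. u ` seg bs r \<subseteq> seg bs r \<and> blk bs bs r (2*k) u \<in> C}. blk bs bs 0 r u \<in> W}"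
      unfolding seg using S_eq by blast
    show "\<exists>u\<in>{u \<in> alt_endos. u ` seg bs r \<subseteq> seg bs r \<and> blk bs bs r (2*k) u \<in> C}. blk bs bs 0 r u = N"
      if "N \<in> carrier_mat r r" for N
      using ex[OF that symp_alt_mats_zero] zC unfolding seg by auto
    show "bij (\<lambda>x. x - u x)" if "u \<in> {u \<in> alt_endos. u ` seg bs r \<subseteq> seg bs r \<and> blk bs bs r (2*k) u \<in> C}"
      "invertible_mat (1\<^sub>m r - blk bs bs 0 r u)" for u
    proof -
      have u: "u \<in> alt_endos" "u ` E \<subseteq> E" "blk bs bs r (2*k) u \<in> C" using that(1) unfolding seg by blast+
      obtain w where "w \<in> S" "blk bs bs r (2*k) u = blk bs bs r (2*k) w" using u(3) unfolding C_def by blast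
      thus ?thesis using bij_iff[OF u(1,2)] that(2) invS(2)[of w] by simp
    qed
  qed blast+
  have optC: "optimal_trivial_spectrum_mats (2*k) (symp_alt_mats k) C"
  proof (rule optimal_block[OF S bs subspace_with_block[OF bs subW, of r 0] _ _ _ _ Cc subC invS(2)])
    show "symp_alt_mats k \<subseteq> carrier_mat (2*k) (2*k)" by (auto simp: symp_alt_mats_def)
    show "S = {u \<in> {u \<in> alt_endos. u ` seg bs r \<subseteq> seg bs r \<and> blk bs bs 0 r u \<in> W}. blk bs bs r (2*k) u \<in> C}"
      unfolding seg using S_eq by blast
    show "\<exists>u\<in>{u \<in> alt_endos. u ` seg bs r \<subseteq> seg bs r \<and> blk bs bs 0 r u \<in> W}. blk bs bs r (2*k) u = N"
      if "N \<in> symp_alt_mats k" for N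
      using ex[OF zero_carrier_mat that] zW unfolding seg by auto
    show "bij (\<lambda>x. x - u x)" if "u \<in> {u \<in> alt_endos. u ` seg bs r \<subseteq> seg bs r \<and> blk bs bs 0 r u \<in> W}"
      "invertible_mat (1\<^sub>m (2*k) - blk bs bs r (2*k) u)" for u
    proof -
      have u: "u \<in> alt_endos" "u ` E \<subseteq> E" "blk bs bs 0 r u \<in> W" using that(1) unfolding seg by blast+
      obtain w where "w \<in> S" "blk bs bs 0 r u = blk bs bs 0 r w" using u(3) unfolding W_def by blast
      thus ?thesis using bij_iff[OF u(1,2)] that(2) invS(1)[of w] by simp
    qed
  qed blast+
  have irr: "irreducible_mats (2*k) C"
    unfolding C_def
  proof (subst irreducible_mats_blk_iff[OF bs])
    show "\<forall>U. stable S U \<longrightarrow> seg bs r \<subseteq> U \<longrightarrow> U \<subseteq> seg bs (r + 2*k) \<longrightarrow> U = seg bs r \<or> U = seg bs (r + 2*k)"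
      using E unfolding irreducible_flag_def seg pE by blast
    show "u ` seg bs (r + 2*k) \<subseteq> seg bs (r + 2*k)" if "u \<in> S" for u
      using perp_invariant[OF alt[OF that] inv[OF that]] unfolding pE .
  qed (use l alt_endos_linear alt inv seg in auto)
  have "mat_in_basis bs ` S = triangle r k W C"
  proof (rule equalityI; rule subsetI)
    fix X assume "X \<in> mat_in_basis bs ` S"
    then obtain u where u: "u \<in> S" "X = mat_in_basis bs u" by blast
    show "X \<in> triangle r k W C" unfolding u(2)
      by (rule triangle_if[OF B alt[OF u(1)]]) (use inv[OF u(1)] seg u(1) in \<open>auto simp: W_def C_def\<close>)
  next
    fix X assume X: "X \<in> triangle r k W C"
    have "X \<in> carrier_mat (length bs) (length bs)"
    proof -
      obtain M N P D where E: "X = (M @\<^sub>c transpose_mat (symp_mat k * P) @\<^sub>c D) @\<^sub>r (0\<^sub>m (2*k) r @\<^sub>c N @\<^sub>c P) @\<^sub>r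
          (0\<^sub>m r r @\<^sub>c 0\<^sub>m r (2*k) @\<^sub>c transpose_mat M)"
        and *: "M \<in> W" "N \<in> C" "P \<in> carrier_mat (2*k) r" "D \<in> alternating_mats r"
        using X unfolding triangle_def by blast
      have "M \<in> carrier_mat r r" "N \<in> carrier_mat (2*k) (2*k)" "D \<in> carrier_mat r r"
        using * Wc Cc by (auto simp: symp_alt_mats_def alternating_mats_def)
      moreover have "symp_mat k * P \<in> carrier_mat (2*k) r" by (rule mult_carrier_mat[OF symp_mat_carrier *(3)])
      ultimately show ?thesis unfolding l E by (intro blocks_3x3(1)) (use *(3) in \<open>simp_all del: index_mult_mat\<close>)
    qed
    moreover from linear_with_coords_exists[OF bs, of "\<lambda>i j. X $$ (i, j)"] obtain u
      where u: "Vector_Spaces.linear scale scale u"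
        "\<And>i j. i < length bs \<Longrightarrow> j < length bs \<Longrightarrow> coord bs (u (bs ! j)) i = X $$ (i, j)" by blast
    ultimately have e: "mat_in_basis bs u = X"
      by (intro eq_matI) (auto simp: mat_in_basis_index mat_in_basis_def coord_def)
    have "u \<in> S" using triangle_imp[OF B u(1) Wc Cc] X unfolding e seg S_eq by blast
    thus "X \<in> mat_in_basis bs ` S" using e by blast
  qed
  hence "optimal_decomposition n S r bs W C"
    unfolding optimal_decomposition_def using rn B optW optC irr unfolding k_def by blast
  thus ?thesis by blast
qed

section \<open>Recovering the flag from a decomposition, and uniqueness\<close>

lemma optimal_decompositionD:
  assumes S: "optimal_trivial_spectrum S" and dec: "optimal_decomposition n S r bs W C"
  shows "mixed_symplectic_basis r (n - r) bs" "irreducible_flag S (seg bs r)"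
    "W = blk bs bs 0 r ` S" "C = blk bs bs r (2 * (n - r)) ` S"
proof -
  note S' = optimal_trivial_spectrumD[OF S]
  define k where "k = n - r"
  have B: "mixed_symplectic_basis r k bs" and irr: "irreducible_mats (2*k) C"
    and tri: "mat_in_basis bs ` S = triangle r k W C"
    and Ws: "mat_subspace r W" and Cs: "mat_subspace (2*k) C" and Cc: "C \<subseteq> symp_alt_mats k"
    using dec unfolding optimal_decomposition_def optimal_trivial_spectrum_mats_def k_def by blast+
  note bs = mixed_symplectic_basisD(1)[OF B] and l = mixed_symplectic_basisD(2)[OF B]
  have Wc: "W \<subseteq> carrier_mat r r" and zW: "0\<^sub>m r r \<in> W" and zC: "0\<^sub>m (2*k) (2*k) \<in> C"
    using Ws Cs unfolding mat_subspace_iff by blast+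
  have alt: "u \<in> alt_endos" if "u \<in> S" for u using that S'(2) by blast
  have SD: "u ` seg bs r \<subseteq> seg bs r" "blk bs bs 0 r u \<in> W" "blk bs bs r (2*k) u \<in> C" if "u \<in> S" for u
    using triangle_imp[OF B alt_endos_linear[OF alt[OF that]] Wc Cc] tri that by blast+
  \<comment> \<open>The block diagonal endomorphism with blocks \<open>M\<close> and
    \<open>N\<close> has its matrix in the triangle space, so an element of \<open>S\<close> shares
    that matrix. Hence \<open>W\<close> and \<open>C\<close> are exactly the block images of
    \<open>S\<close>, and irreducibility of \<open>C\<close> can be carried back to
    \<open>perp E / E\<close>.\<close>
  have ex: "\<exists>u\<in>S. blk bs bs 0 r u = M \<and> blk bs bs r (2*k) u = N" if M: "M \<in> W" and N: "N \<in> C" for M N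
  proof -
    obtain u where u: "u \<in> alt_endos" "u ` seg bs r \<subseteq> seg bs r" "blk bs bs 0 r u = M" "blk bs bs r (2*k) u = N"
      using alt_endo_with_blocks_exists[OF B, of M N] M N Wc Cc by blast
    have "mat_in_basis bs u \<in> triangle r k W C" by (rule triangle_if[OF B u(1,2)]) (use u M N in simp_all)
    then obtain v where v: "v \<in> S" "mat_in_basis bs v = mat_in_basis bs u" using tri by (metis imageE)
    have c: "coord bs (v (bs ! j)) i = coord bs (u (bs ! j)) i" if "i < length bs" "j < length bs" for i j
      using mat_in_basis_index[OF that, of u] mat_in_basis_index[OF that, of v] v(2) by simp
    have "blk bs bs 0 r v = blk bs bs 0 r u" "blk bs bs r (2*k) v = blk bs bs r (2*k) u"
      by (rule eq_matI; simp add: blk_def c l)+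
    thus ?thesis using u(3,4) v(1) by auto
  qed
  have stab: "stable S (seg bs r)" using subspace_seg[OF bs] SD(1) by (simp add: stable_def)
  have C: "C = blk bs bs r (2*k) ` S" using ex[OF zW] SD(3) by blast
  show "W = blk bs bs 0 r ` S" using ex[OF _ zC] SD(2) by blast
  show "C = blk bs bs r (2 * (n - r)) ` S" using C unfolding k_def .
  show "mixed_symplectic_basis r (n - r) bs" using B unfolding k_def .
  have pinv: "u ` seg bs (r + 2*k) \<subseteq> seg bs (r + 2*k)" if "u \<in> S" for u
    using perp_invariant[OF alt[OF that] SD(1)[OF that]] unfolding perp_seg[OF B] .
  have l': "r + 2*k \<le> length bs" using l by simp
  have "\<forall>U. stable S U \<longrightarrow> seg bs r \<subseteq> U \<longrightarrow> U \<subseteq> seg bs (r + 2*k) \<longrightarrow> U = seg bs r \<or> U = seg bs (r + 2*k)"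
    by (rule irreducible_mats_blk_iff[THEN iffD1, OF bs l' _ _ _ irr[unfolded C]])
       (use alt_endos_linear alt SD(1) pinv in auto)
  thus "irreducible_flag S (seg bs r)"
    unfolding irreducible_flag_def perp_seg[OF B] using stab seg_isotropic[OF B] perp_seg[OF B] by blast
qed

text \<open>The conjugating matrices are the blocks of \<open>f\<close> and \<open>g\<close> between
  the two bases. Closure of \<open>S\<close> under conjugation by \<open>f\<close> gives one
  inclusion, closure under conjugation by \<open>g\<close> the other.\<close>

lemma blk_image_conjugate:
  assumes bs: "ordered_basis bs" "ordered_basis bs'" and l: "a + m \<le> length bs" "length bs' = length bs"
    and S: "\<And>u. u \<in> S \<Longrightarrow> Vector_Spaces.linear scale scale u" "\<And>u. u \<in> S \<Longrightarrow> u ` seg bs a \<subseteq> seg bs a"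
      "\<And>u. u \<in> S \<Longrightarrow> u ` seg bs (a + m) \<subseteq> seg bs (a + m)"
    and f: "Vector_Spaces.linear scale scale f" "f ` seg bs a \<subseteq> seg bs' a" "f ` seg bs (a + m) \<subseteq> seg bs' (a + m)"
    and g: "Vector_Spaces.linear scale scale g" "g ` seg bs' a \<subseteq> seg bs a" "g ` seg bs' (a + m) \<subseteq> seg bs (a + m)"
    and fg: "\<And>v. f (g v) = v" "\<And>v. g (f v) = v"
    and conj: "\<And>u. u \<in> S \<Longrightarrow> (\<lambda>v. f (u (g v))) \<in> S" "\<And>u. u \<in> S \<Longrightarrow> (\<lambda>v. g (u (f v))) \<in> S"
  defines "P \<equiv> blk bs' bs a m f" and "Q \<equiv> blk bs bs' a m g"
  shows "P * Q = 1\<^sub>m m" "Q * P = 1\<^sub>m m"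
    "blk bs' bs' a m ` S = (\<lambda>M. P * M * Q) ` (blk bs bs a m ` S)"
proof -
  have l': "a + m \<le> length bs'" "length bs = length bs'" using l by simp_all
  have "P * Q = blk bs' bs' a m (\<lambda>x. f (g x))"
    unfolding P_def Q_def by (rule blk_mult[OF bs(2,1,2) l'(1,2) refl f(1,2) g(3), symmetric])
  thus "P * Q = 1\<^sub>m m" by (simp add: fg blk_id[OF bs(2) l'(1)])
  have "Q * P = blk bs bs a m (\<lambda>x. g (f x))"
    unfolding P_def Q_def by (rule blk_mult[OF bs(1,2,1) l(1,2) refl g(1,2) f(3), symmetric])
  thus "Q * P = 1\<^sub>m m" by (simp add: fg blk_id[OF bs(1) l(1)])
  have key: "blk bs' bs' a m (\<lambda>v. f (u (g v))) = P * blk bs bs a m u * Q" if u: "u \<in> S" for u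
  proof -
    have fu: "Vector_Spaces.linear scale scale (\<lambda>x. f (u x))"
      using Vector_Spaces.linear_compose[OF S(1)[OF u] f(1)] by (simp add: comp_def)
    have fus: "(\<lambda>x. f (u x)) ` seg bs a \<subseteq> seg bs' a" using S(2)[OF u] f(2) by blast
    have "blk bs' bs' a m (\<lambda>v. f (u (g v))) = blk bs' bs a m (\<lambda>x. f (u x)) * Q"
      unfolding Q_def by (rule blk_mult[OF bs(2,1,2) l'(1,2) refl fu fus g(3)])
    also have "blk bs' bs a m (\<lambda>x. f (u x)) = P * blk bs bs a m u"
      unfolding P_def by (rule blk_mult[OF bs(1,1,2) l(1) refl l(2) f(1,2) S(3)[OF u]])
    finally show ?thesis .
  qed
  show "blk bs' bs' a m ` S = (\<lambda>M. P * M * Q) ` (blk bs bs a m ` S)"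
  proof (rule equalityI; rule subsetI)
    fix X assume "X \<in> blk bs' bs' a m ` S"
    then obtain u where u: "u \<in> S" "X = blk bs' bs' a m u" by blast
    have "X = P * blk bs bs a m (\<lambda>v. g (u (f v))) * Q"
      using key[OF conj(2)[OF u(1)]] unfolding u(2) by (simp add: fg)
    thus "X \<in> (\<lambda>M. P * M * Q) ` (blk bs bs a m ` S)" using conj(2)[OF u(1)] by blast
  next
    fix X assume "X \<in> (\<lambda>M. P * M * Q) ` (blk bs bs a m ` S)"
    then obtain u where u: "u \<in> S" "X = P * blk bs bs a m u * Q" by blast
    show "X \<in> blk bs' bs' a m ` S" unfolding u(2) key[OF u(1), symmetric] using conj(1)[OF u(1)] by blast
  qed
qed

lemma GL_if_inverse:
  assumes "P \<in> carrier_mat m m" "Q \<in> carrier_mat m m" "P * Q = 1\<^sub>m m" "Q * P = 1\<^sub>m m"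
  shows "P \<in> GL m"
  using assms unfolding GL_def invertible_mat_def inverts_mat_def by auto

text \<open>Both bases define irreducible flags of \<open>S\<close>, and an isometry normalising
  \<open>S\<close> carries one flag to the other. Its block on \<open>E\<close> conjugates
  \<open>W\<close> to \<open>W'\<close>, and its block on \<open>perp E / E\<close> conjugates
  \<open>C\<close> to \<open>C'\<close>.\<close>

lemma optimal_decomposition_unique:
  assumes S: "optimal_trivial_spectrum S"
    and dec: "optimal_decomposition n S r bs W C" and dec': "optimal_decomposition n S r' bs' W' C'"
  shows "r = r' \<and> conjugate_under r (GL r) W W' \<and> conjugate_under (2 * (n - r)) (Sp (n - r)) C C'"
proof -
  note S' = optimal_trivial_spectrumD[OF S]
  note d = optimal_decompositionD[OF S dec] and d' = optimal_decompositionD[OF S dec']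
  note bs = mixed_symplectic_basisD(1)[OF d(1)] and bs' = mixed_symplectic_basisD(1)[OF d'(1)]
  note l = mixed_symplectic_basisD(2)[OF d(1)] and l' = mixed_symplectic_basisD(2)[OF d'(1)]
  from irreducible_flags_isometric[OF S d(2) d'(2)] obtain f g where
    f: "Vector_Spaces.linear scale scale f" and fg: "\<And>v. f (g v) = v" "\<And>v. g (f v) = v"
    and iso: "\<And>v w. s (f v) (f w) = s v w" and fE: "f ` seg bs r = seg bs' r'"
    and conj: "\<And>u. u \<in> S \<Longrightarrow> (\<lambda>v. f (u (g v))) \<in> S" "\<And>u. u \<in> S \<Longrightarrow> (\<lambda>v. g (u (f v))) \<in> S"
    by metis
  interpret f: Vector_Spaces.linear scale scale f by (rule f)
  have injf: "inj f" by (rule inj_on_inverseI[of _ g]) (rule fg(2))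
  have g: "Vector_Spaces.linear scale scale g"
  proof (rule linear_endoI)
    show "g (x + y) = g x + g y" for x y by (rule injD[OF injf]) (simp add: f.add fg)
    show "g (scale c x) = scale c (g x)" for c x by (rule injD[OF injf]) (simp add: f.scale fg)
  qed
  have isog: "s (g v) (g w) = s v w" for v w using iso[of "g v" "g w"] by (simp add: fg)
  have gE: "g ` seg bs' r' = seg bs r" unfolding fE[symmetric] by (auto simp: fg image_iff)
  have "dim (seg bs' r') = dim (seg bs r)"
  proof -
    have "vector_space_pair scale scale" by (rule vector_space_pair.intro[OF vector_space_axioms vector_space_axioms])
    from vector_space_pair.rank_nullity[OF this f subspace_seg[OF bs, of r] fin_dim]
    have "dim (seg bs r) = dim {x \<in> seg bs r. f x = 0} + dim (seg bs' r')" unfolding fE .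
    moreover have "{x \<in> seg bs r. f x = 0} = {0}"
    proof
      show "{x \<in> seg bs r. f x = 0} \<subseteq> {0}"
      proof
        fix x assume "x \<in> {x \<in> seg bs r. f x = 0}"
        hence "f x = f 0" by (simp add: f.zero)
        thus "x \<in> {0}" using injD[OF injf] by blast
      qed
    qed (simp add: f.zero subspace_0[OF subspace_seg[OF bs]])
    ultimately show ?thesis using dim_zero_set by simp
  qed
  hence rr: "r' = r" using dim_seg[OF bs, of r] dim_seg[OF bs', of r'] l l' by simp
  define k where "k = n - r"
  note B = d(1)[folded k_def] and B' = d'(1)[unfolded rr, folded k_def]
  note l = l[folded k_def] and l' = l'[unfolded rr, folded k_def]
  note fE = fE[unfolded rr] and gE = gE[unfolded rr]
  \<comment> \<open>An isometry that matches the isotropic spaces also matches their orthogonals, so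
    \<open>f\<close> and \<open>g\<close> respect both steps of the flags.\<close>
  have pf: "f ` seg bs (r + 2*k) \<subseteq> seg bs' (r + 2*k)"
  proof safe
    fix z assume z: "z \<in> seg bs (r + 2*k)"
    have "s y (f z) = 0" if "y \<in> seg bs' r" for y
    proof -
      have "g y \<in> seg bs r" using gE that by blast
      hence "s (g y) z = 0" using z unfolding perp_seg[OF B, symmetric] by (simp add: perp_def)
      thus ?thesis using isog[of y "f z"] by (simp add: fg)
    qed
    thus "f z \<in> seg bs' (r + 2*k)" unfolding perp_seg[OF B', symmetric] by (simp add: perp_def)
  qed
  have pg: "g ` seg bs' (r + 2*k) \<subseteq> seg bs (r + 2*k)"
  proof safe
    fix z assume z: "z \<in> seg bs' (r + 2*k)"
    have "s y (g z) = 0" if "y \<in> seg bs r" for y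
    proof -
      have "f y \<in> seg bs' r" using fE that by blast
      hence "s (f y) z = 0" using z unfolding perp_seg[OF B', symmetric] by (simp add: perp_def)
      thus ?thesis using iso[of y "g z"] by (simp add: fg)
    qed
    thus "g z \<in> seg bs (r + 2*k)" unfolding perp_seg[OF B, symmetric] by (simp add: perp_def)
  qed
  have ll: "length bs' = length bs" "0 + r \<le> length bs" "r + 2*k \<le> length bs" using l l' by simp_all
  have alt: "u \<in> alt_endos" if "u \<in> S" for u using that S'(2) by blast
  have lin: "Vector_Spaces.linear scale scale u" if "u \<in> S" for u by (rule alt_endos_linear[OF alt[OF that]])
  have iE: "u ` seg bs r \<subseteq> seg bs r" if "u \<in> S" for u
    using irreducible_flagD(1)[OF d(2)] that by (simp add: stable_def)
  have ip: "u ` seg bs (r + 2*k) \<subseteq> seg bs (r + 2*k)" if "u \<in> S" for u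
    using perp_invariant[OF alt[OF that] iE[OF that]] unfolding perp_seg[OF B] .
  have s0: "h ` seg bs1 0 \<subseteq> seg bs2 0"
    if "Vector_Spaces.linear scale scale h" "ordered_basis bs1" "ordered_basis bs2" for h bs1 bs2
  proof -
    interpret h: Vector_Spaces.linear scale scale h by (rule that(1))
    show ?thesis using that(2,3) by (simp add: seg_0 h.zero)
  qed
  define P1 where "P1 = blk bs' bs 0 r f"
  define Q1 where "Q1 = blk bs bs' 0 r g"
  have u0: "u ` seg bs 0 \<subseteq> seg bs 0" if "u \<in> S" for u by (rule s0[OF lin[OF that] bs bs])
  have fE': "f ` seg bs r \<subseteq> seg bs' r" and gE': "g ` seg bs' r \<subseteq> seg bs r" using fE gE by simp_all
  note conj1 = blk_image_conjugate[where a = 0 and m = r, unfolded add_0,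
      OF bs bs' ll(2)[unfolded add_0] ll(1) lin u0 iE f s0[OF f bs bs'] fE' g s0[OF g bs' bs] gE' fg conj]
  have PQ1: "P1 * Q1 = 1\<^sub>m r" "Q1 * P1 = 1\<^sub>m r" "W' = (\<lambda>M. P1 * M * Q1) ` W"
    unfolding P1_def Q1_def d(3) d'(3)[unfolded rr] by (rule conj1; assumption)+
  have c1: "P1 \<in> carrier_mat r r" "Q1 \<in> carrier_mat r r" by (simp_all add: P1_def Q1_def)
  have "conjugate_under r (GL r) W W'"
    unfolding conjugate_under_def
    using GL_if_inverse[OF c1 PQ1(1,2)] c1(2) PQ1 by blast
  moreover
  define P2 where "P2 = blk bs' bs r (2*k) f"
  define Q2 where "Q2 = blk bs bs' r (2*k) g"
  have PQ2: "P2 * Q2 = 1\<^sub>m (2*k)" "Q2 * P2 = 1\<^sub>m (2*k)" "C' = (\<lambda>M. P2 * M * Q2) ` C"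
    unfolding P2_def Q2_def d(4)[folded k_def] d'(4)[unfolded rr, folded k_def]
    by (rule blk_image_conjugate[OF bs bs' ll(3,1) lin iE ip f fE' pf g gE' pg fg conj]; assumption)+
  have c2: "P2 \<in> carrier_mat (2*k) (2*k)" "Q2 \<in> carrier_mat (2*k) (2*k)" by (simp_all add: P2_def Q2_def)
  \<comment> \<open>In either mixed basis the form induced on the middle subquotient is the standard
    one, so the block of an isometry is a symplectic matrix.\<close>
  have "P2 \<in> Sp k" unfolding Sp_def
  proof (intro CollectI conjI ballI)
    show "P2 \<in> GL (2*k)" by (rule GL_if_inverse[OF c2 PQ2(1,2)])
    fix x y :: "'a vec" assume x: "x \<in> carrier_vec (2*k)" and y: "y \<in> carrier_vec (2*k)"
    obtain x' where x': "x' \<in> seg bs (r + 2*k)" "vc bs r (2*k) x' = x" using vc_surj[OF bs ll(3) x] by blast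
    obtain y' where y': "y' \<in> seg bs (r + 2*k)" "vc bs r (2*k) y' = y" using vc_surj[OF bs ll(3) y] by blast
    have P: "P2 *\<^sub>v vc bs r (2*k) z = vc bs' r (2*k) (f z)" if "z \<in> seg bs (r + 2*k)" for z
      unfolding P2_def by (rule vc_apply[OF bs bs' ll(3,1) f _ that, symmetric]) (simp add: fE)
    have fx: "f x' \<in> seg bs' (r + 2*k)" "f y' \<in> seg bs' (r + 2*k)" using pf x'(1) y'(1) by blast+
    show "symp_form k (P2 *\<^sub>v x) (P2 *\<^sub>v y) = symp_form k x y"
      unfolding x'(2)[symmetric] y'(2)[symmetric] P[OF x'(1)] P[OF y'(1)]
        symp_form_vc[OF B x'(1) y'(1)] symp_form_vc[OF B' fx] by (rule iso)
  qed
  hence "conjugate_under (2*k) (Sp k) C C'"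
    unfolding conjugate_under_def using c2(2) PQ2 by blast
  ultimately show ?thesis using rr unfolding k_def by simp
qed

end

theorem theorem1p7:
  fixes scale :: "'a::field \<Rightarrow> 'b::ab_group_add \<Rightarrow> 'b"
    and s :: "'b \<Rightarrow> 'b \<Rightarrow> 'a"
    and n :: nat
    and S :: "('b \<Rightarrow> 'b) set"
  assumes "symplectic_space scale s"
    and "vector_space.dim scale (UNIV :: 'b set) = 2 * n"
    and "infinite (UNIV :: 'a set) \<or> card (UNIV :: 'a set) + 2 > 2 * n"
    and "symplectic_space.optimal_trivial_spectrum scale s S"
  shows "(\<exists>r bs W C. symplectic_space.optimal_decomposition scale s n S r bs W C) \<and>
    (\<forall>r bs W C r' bs' W' C'.
       symplectic_space.optimal_decomposition scale s n S r bs W C \<and>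
       symplectic_space.optimal_decomposition scale s n S r' bs' W' C' \<longrightarrow>
         r = r' \<and>
         conjugate_under r (GL r) W W' \<and>
         conjugate_under (2 * (n - r)) (Sp (n - r)) C C')"
proof -
  interpret symplectic_space scale s by (rule assms(1))
  show ?thesis
    using optimal_decomposition_exists[OF assms(4,2)] optimal_decomposition_unique[OF assms(4)] by blast
qed

end
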